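(* Let $Z$ be a random variable with values in a Polish space $\mathcal{Z}$. Let $Y=(Y_1,\dots,Y_N)$ and $X=(X_1,\dots,X_N)$ be stochastic processes (on the same probability space) with values in Polish spaces $\mathcal{Y}$ and $\mathcal{X}$ respectively, where $\mathcal{X}$ is homeomorphic to a convex subset of a locally convex space. Suppose the law of $Y_1$ is nonatomic and $Y_n$ is $\sigma(Z)$-measurable for every $n$. Let $\mathcal{F}^X_n=\sigma(X_1,\dots,X_n)$ and $\mathcal{F}^Y_n=\sigma(Y_1,\dots,Y_n)$. Then the following are equivalent: (i) For each $n=1,\dots,N$, $\mathcal{F}^X_n$ is conditionally independent of $Z$ given $\mathcal{F}^Y_n$. (ii) There exists a sequence $X^{(k)}=(X^{(k)}_1,\dots,X^{(k)}_N)$ of $(\mathcal{F}^Y_n)_{n=1}^N$-adapted processes such that $(Z,X^{(k)})\to(Z,X)$ in law in $\mathcal{Z}\times\mathcal{X}^N$. (iii) There exists a sequence $X^{(k)}$ as in (ii) with, in addition, $X^{(k)}_n=f^k_n(Y_1,\dots,Y_n)$ for some continuous functions $f^k_n:\mathcal{Y}^n\to\mathcal{X}$.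
   Context: A process $(X'_n)$ is $(\mathcal{F}^Y_n)$-adapted if $X'_n$ is $\mathcal{F}^Y_n$-measurable for each $n$. *)

theory Defs
  imports "HOL-Probability.Probability"
begin

definition locally_convex_tvs :: "'v::{real_vector, t2_space} itself \<Rightarrow> bool" where
  "locally_convex_tvs _ \<longleftrightarrow>
     continuous_on UNIV (\<lambda>p::'v \<times> 'v. fst p + snd p) \<and>
     continuous_on UNIV (\<lambda>p::real \<times> 'v. fst p *\<^sub>R snd p) \<and>
     (\<forall>U::'v set. open U \<and> 0 \<in> U \<longrightarrow> (\<exists>V. open V \<and> convex V \<and> 0 \<in> V \<and> V \<subseteq> U))"

definition nonatomic :: "'b measure \<Rightarrow> bool" where
  "nonatomic \<mu> \<longleftrightarrow> (\<forall>A\<in>sets \<mu>. 0 < emeasure \<mu> A \<longrightarrow>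
      (\<exists>B\<in>sets \<mu>. B \<subseteq> A \<and> 0 < emeasure \<mu> B \<and> emeasure \<mu> B < emeasure \<mu> A))"

definition nat_filt :: "'a measure \<Rightarrow> (nat \<Rightarrow> 'a \<Rightarrow> 'b::topological_space) \<Rightarrow> nat \<Rightarrow> 'a measure" where
  "nat_filt M Y n = vimage_algebra (space M) (\<lambda>\<omega>. restrict (\<lambda>i. Y i \<omega>) {1..n}) (PiM {1..n} (\<lambda>_. borel))"

definition cond_indep :: "'a measure \<Rightarrow> 'a measure \<Rightarrow> 'a measure \<Rightarrow> 'a measure \<Rightarrow> bool" where
  "cond_indep M F H G \<longleftrightarrow> (\<forall>A\<in>sets F. \<forall>B\<in>sets H.
     AE \<omega> in M. real_cond_exp M G (indicator (A \<inter> B)) \<omega>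
               = real_cond_exp M G (indicator A) \<omega> * real_cond_exp M G (indicator B) \<omega>)"

definition conv_in_law :: "'a measure \<Rightarrow> 'b::topological_space set \<Rightarrow> (nat \<Rightarrow> 'a \<Rightarrow> 'b) \<Rightarrow> ('a \<Rightarrow> 'b) \<Rightarrow> bool" where
  "conv_in_law M S Wk W \<longleftrightarrow> (\<forall>F :: 'b \<Rightarrow> real. continuous_on S F \<and> bounded (F ` S) \<longrightarrow>
     (\<lambda>k. integral\<^sup>L M (\<lambda>\<omega>. F (Wk k \<omega>))) \<longlonglongrightarrow> integral\<^sup>L M (\<lambda>\<omega>. F (W \<omega>)))"

end

theory Submission
  imports Defs
begin

text \<open>(ii) \<open>\<Longrightarrow>\<close> (i): as the law of \<open>Z\<close> is fixed, \<open>(Z, X\<^sup>k) \<rightarrow> (Z, X)\<close> in law gives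
  \<open>E[g(X\<^sup>k) h(Z)] \<rightarrow> E[g(X) h(Z)]\<close> for continuous bounded \<open>g\<close> and merely integrable \<open>h(Z)\<close>. Adaptedness
  allows \<open>h(Z)\<close> to be replaced by its conditional expectation given \<open>\<F>\<^sup>Y\<^sub>n\<close>, which is again a function
  of \<open>Z\<close>, and this identity passes to the limit.

  (i) \<open>\<Longrightarrow>\<close> (iii): discretise \<open>X\<close> to finitely many values. A uniform variable that is a function of
  \<open>Y\<^sub>1\<close> has digits which, far down its expansion, are asymptotically independent of everything. Feeding
  such a digit into the inverse conditional distribution functions of the discretised histories given
  \<open>\<F>\<^sup>Y\<^sub>n\<close> yields finite-valued adapted processes; by (i) these distribution functions agree with those
  given \<open>Z\<close>, so the joint law with \<open>Z\<close> is almost right. Finite-valued functions of \<open>Y\<close> are then replaced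
  by continuous ones off a small set, and all errors are measured in the bounded Lipschitz metric.\<close>

text \<open>Every \<open>Y n\<close> is a function of \<open>Z\<close>, so the data carry no
  randomness independent of \<open>Z\<close> with which a conditional law could be sampled outright.
  Convergence in law leaves room for a substitute: the indicator of a rapidly oscillating set of
  values of a uniform variable \<open>U\<close> converges weakly to a constant, so in the limit it
  is independent of any fixed finite family of events, although \<open>U\<close> itself is a
  function of \<open>Z\<close>. Nonatomicity is asked of the first coordinate because the same
  \<open>U\<close> has to be known at every time. One digit drives all times, and the samples drawn
  at different times must fit together. Lexicographic order of histories achieves this: "the history
  up to \<open>n\<close> has code below \<open>l\<close>" is the same event as "the full history has
  code below \<open>l * R ^ (N - n)\<close>". Hence, if all conditional distribution functions are
  versions of a single one, the quantile at time \<open>n\<close> is the truncation of the quantile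
  at time \<open>N\<close>. Adaptedness and compatibility conflict in general; condition (i) is what
  reconciles them.\<close>

section \<open>Weak limits of bounded functions, tested against integrable ones\<close>

lemma (in prob_space) integrable_bounded_mult:
  fixes w f :: "'a \<Rightarrow> real"
  assumes "w \<in> borel_measurable M" "\<And>\<omega>. \<omega> \<in> space M \<Longrightarrow> \<bar>w \<omega>\<bar> \<le> b" "integrable M f"
  shows "integrable M (\<lambda>\<omega>. w \<omega> * f \<omega>)"
proof (rule Bochner_Integration.integrable_bound)
  show "integrable M (\<lambda>\<omega>. b * \<bar>f \<omega>\<bar>)" using assms by auto
  show "(\<lambda>\<omega>. w \<omega> * f \<omega>) \<in> borel_measurable M" using assms by auto
  show "AE \<omega> in M. norm (w \<omega> * f \<omega>) \<le> norm (b * \<bar>f \<omega>\<bar>)"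
  proof (rule AE_I2)
    fix \<omega> assume "\<omega> \<in> space M"
    then have "\<bar>w \<omega>\<bar> \<le> b" using assms by auto
    then have "\<bar>w \<omega>\<bar> * \<bar>f \<omega>\<bar> \<le> \<bar>b\<bar> * \<bar>f \<omega>\<bar>" by (intro mult_right_mono) auto
    then show "norm (w \<omega> * f \<omega>) \<le> norm (b * \<bar>f \<omega>\<bar>)" by (simp add: abs_mult)
  qed
qed

lemma (in prob_space) integral_bounded_mult_diff_le:
  fixes w f g :: "'a \<Rightarrow> real"
  assumes "w \<in> borel_measurable M" "\<And>\<omega>. \<omega> \<in> space M \<Longrightarrow> \<bar>w \<omega>\<bar> \<le> b" "integrable M f" "integrable M g"
  shows "\<bar>(\<integral>\<omega>. w \<omega> * f \<omega> \<partial>M) - (\<integral>\<omega>. w \<omega> * g \<omega> \<partial>M)\<bar> \<le> b * (\<integral>\<omega>. \<bar>f \<omega> - g \<omega>\<bar> \<partial>M)"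
proof -
  have i: "integrable M (\<lambda>\<omega>. w \<omega> * f \<omega>)" "integrable M (\<lambda>\<omega>. w \<omega> * g \<omega>)"
    by (rule integrable_bounded_mult[OF assms(1,2)]; use assms in simp)+
  have "\<bar>(\<integral>\<omega>. w \<omega> * f \<omega> \<partial>M) - (\<integral>\<omega>. w \<omega> * g \<omega> \<partial>M)\<bar> = \<bar>\<integral>\<omega>. w \<omega> * f \<omega> - w \<omega> * g \<omega> \<partial>M\<bar>"
    using i by simp
  also have "\<dots> \<le> (\<integral>\<omega>. \<bar>w \<omega> * f \<omega> - w \<omega> * g \<omega>\<bar> \<partial>M)" by (rule integral_abs_bound)
  also have "\<dots> \<le> (\<integral>\<omega>. b * \<bar>f \<omega> - g \<omega>\<bar> \<partial>M)"
  proof (rule integral_mono)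
    show "integrable M (\<lambda>\<omega>. \<bar>w \<omega> * f \<omega> - w \<omega> * g \<omega>\<bar>)" "integrable M (\<lambda>\<omega>. b * \<bar>f \<omega> - g \<omega>\<bar>)"
      using i assms by auto
    fix \<omega> assume "\<omega> \<in> space M"
    then have "\<bar>w \<omega>\<bar> * \<bar>f \<omega> - g \<omega>\<bar> \<le> b * \<bar>f \<omega> - g \<omega>\<bar>" using assms by (intro mult_right_mono) auto
    then show "\<bar>w \<omega> * f \<omega> - w \<omega> * g \<omega>\<bar> \<le> b * \<bar>f \<omega> - g \<omega>\<bar>"
      by (simp add: abs_mult flip: right_diff_distrib)
  qed
  finally show ?thesis by simp
qed

text \<open>A three-epsilon argument: since all weights share the bound \<open>b\<close>, replacing
  \<open>f\<close> by \<open>s i\<close> costs at most \<open>b\<close> times their distance in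
  mean, uniformly in \<open>k\<close>.\<close>

lemma (in prob_space) weak_limit_L1_closed:
  fixes w :: "nat \<Rightarrow> 'a \<Rightarrow> real"
  assumes w: "\<And>k. w k \<in> borel_measurable M" "\<And>k \<omega>. \<omega> \<in> space M \<Longrightarrow> \<bar>w k \<omega>\<bar> \<le> b"
    and v: "v \<in> borel_measurable M" "\<And>\<omega>. \<omega> \<in> space M \<Longrightarrow> \<bar>v \<omega>\<bar> \<le> b"
    and s: "\<And>i. integrable M (s i)" "\<And>i. (\<lambda>k. \<integral>\<omega>. w k \<omega> * s i \<omega> \<partial>M) \<longlonglongrightarrow> (\<integral>\<omega>. v \<omega> * s i \<omega> \<partial>M)"
    and f: "integrable M f"
    and l: "(\<lambda>i. \<integral>\<omega>. \<bar>f \<omega> - s i \<omega>\<bar> \<partial>M) \<longlonglongrightarrow> 0"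
  shows "(\<lambda>k. \<integral>\<omega>. w k \<omega> * f \<omega> \<partial>M) \<longlonglongrightarrow> (\<integral>\<omega>. v \<omega> * f \<omega> \<partial>M)"
proof (rule LIMSEQ_I)
  fix r :: real assume r: "r > 0"
  have "b \<ge> 0" using v(2) not_empty by (meson abs_ge_zero all_not_in_conv order_trans)
  \<comment> \<open>The \<open>+ 1\<close> covers the case \<open>b = 0\<close>.\<close>
  define e where "e = r / (3 * (b + 1))"
  have e: "e > 0" "b * e \<le> r / 3"
    using r \<open>b \<ge> 0\<close> by (auto simp: e_def field_simps)
  from LIMSEQ_D[OF l e(1)] obtain i where "norm ((\<integral>\<omega>. \<bar>f \<omega> - s i \<omega>\<bar> \<partial>M) - 0) < e" by blast
  then have i: "(\<integral>\<omega>. \<bar>f \<omega> - s i \<omega>\<bar> \<partial>M) < e" by simp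
  have bi: "b * (\<integral>\<omega>. \<bar>f \<omega> - s i \<omega>\<bar> \<partial>M) \<le> r / 3"
    using mult_left_mono[OF less_imp_le[OF i] \<open>b \<ge> 0\<close>] e(2) by linarith
  from LIMSEQ_D[OF s(2)[of i], of "r/3"] r obtain K where
    K: "\<And>k. k \<ge> K \<Longrightarrow> norm ((\<integral>\<omega>. w k \<omega> * s i \<omega> \<partial>M) - (\<integral>\<omega>. v \<omega> * s i \<omega> \<partial>M)) < r / 3" by auto
  show "\<exists>no. \<forall>n\<ge>no. norm ((\<integral>\<omega>. w n \<omega> * f \<omega> \<partial>M) - (\<integral>\<omega>. v \<omega> * f \<omega> \<partial>M)) < r"
  proof (intro exI allI impI)
    fix k assume "k \<ge> K"
    from K[OF this] integral_bounded_mult_diff_le[OF w f s(1)[of i], of k]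
      integral_bounded_mult_diff_le[OF v f s(1)[of i]] bi
    show "norm ((\<integral>\<omega>. w k \<omega> * f \<omega> \<partial>M) - (\<integral>\<omega>. v \<omega> * f \<omega> \<partial>M)) < r"
      unfolding real_norm_def by linarith
  qed
qed

text \<open>The functions tested successfully form a closed subspace of \<open>L\<^sup>1\<close>, so a generating
  \<open>\<pi>\<close>-system suffices.\<close>

lemma (in prob_space) weak_limit_of_generator:
  fixes w :: "nat \<Rightarrow> 'a \<Rightarrow> real"
  assumes H: "subalgebra M H" and E: "sets H = sigma_sets (space M) E" "E \<subseteq> Pow (space M)" "Int_stable E"
    and w: "\<And>k. w k \<in> borel_measurable M" "\<And>k \<omega>. \<omega> \<in> space M \<Longrightarrow> \<bar>w k \<omega>\<bar> \<le> b"
    and v: "v \<in> borel_measurable M" "\<And>\<omega>. \<omega> \<in> space M \<Longrightarrow> \<bar>v \<omega>\<bar> \<le> b"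
    and total: "(\<lambda>k. \<integral>\<omega>. w k \<omega> \<partial>M) \<longlonglongrightarrow> (\<integral>\<omega>. v \<omega> \<partial>M)"
    and basic: "\<And>A. A \<in> E \<Longrightarrow>
      (\<lambda>k. \<integral>\<omega>. w k \<omega> * indicator A \<omega> \<partial>M) \<longlonglongrightarrow> (\<integral>\<omega>. v \<omega> * indicator A \<omega> \<partial>M)"
    and f: "integrable M f" "f \<in> borel_measurable H"
  shows "(\<lambda>k. \<integral>\<omega>. w k \<omega> * f \<omega> \<partial>M) \<longlonglongrightarrow> (\<integral>\<omega>. v \<omega> * f \<omega> \<partial>M)"
proof -
  let ?P = "\<lambda>f. (\<lambda>k. \<integral>\<omega>. w k \<omega> * f \<omega> \<partial>M) \<longlonglongrightarrow> (\<integral>\<omega>. v \<omega> * f \<omega> \<partial>M)"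
  have closed: "?P f" if "\<And>i. integrable M (s i)" "\<And>i. ?P (s i)" "integrable M f"
    "(\<lambda>i. \<integral>\<omega>. \<bar>f \<omega> - s i \<omega>\<bar> \<partial>M) \<longlonglongrightarrow> 0" for s f
    by (rule weak_limit_L1_closed[where s=s and b=b]) (use w v that in auto)
  have HM: "A \<in> sets M" if "A \<in> sets H" for A
    using H that by (auto simp: subalgebra_def)
  have wi: "integrable M (\<lambda>\<omega>. w k \<omega> * g \<omega>)" "integrable M (\<lambda>\<omega>. v \<omega> * g \<omega>)" if "integrable M g" for k g
    using integrable_bounded_mult[OF w that] integrable_bounded_mult[OF v that] by auto
  have wi0: "integrable M (w k)" "integrable M v" for k
    using wi[of "\<lambda>_. 1"] by auto
  have set: "?P (indicator A)" if A: "A \<in> sets H" for A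
  proof -
    from E(3,2) A[unfolded E(1)] show ?thesis
    proof (induction rule: sigma_sets_induct_disjoint)
      case (basic A) then show ?case by (rule assms(10))
    next
      case empty then show ?case by simp
    next
      \<comment> \<open>Complements are where \<open>total\<close> enters: the whole space need not
        belong to \<open>E\<close>.\<close>
      case (compl A)
      then have A: "A \<in> sets M" using E(1) HM by auto
      have I: "integrable M (\<lambda>\<omega>. indicator A \<omega> :: real)" using A by (auto intro!: integrable_real_indicator simp: emeasure_eq_measure)
      have eq: "(\<integral>\<omega>. u \<omega> * indicator (space M - A) \<omega> \<partial>M) = (\<integral>\<omega>. u \<omega> \<partial>M) - (\<integral>\<omega>. u \<omega> * indicator A \<omega> \<partial>M)"
        if "integrable M u" "integrable M (\<lambda>\<omega>. u \<omega> * indicator A \<omega>)" for u :: "'a \<Rightarrow> real"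
        unfolding Bochner_Integration.integral_diff[OF that, symmetric]
        by (rule Bochner_Integration.integral_cong) (auto simp: indicator_def)
      show ?case
        unfolding eq[OF wi0(1) wi(1)[OF I]] eq[OF wi0(2) wi(2)[OF I]]
        by (intro tendsto_diff total compl.IH)
    next
      \<comment> \<open>Finite partial unions follow by linearity; they converge in mean to the full
        union, and \<open>closed\<close> passes to the limit.\<close>
      case (union A)
      have A: "A i \<in> sets H" for i using union(2) E(1) by auto
      have AM: "A i \<in> sets M" for i using HM[OF A] .
      let ?s = "\<lambda>i \<omega>. indicator (\<Union>j<i. A j) \<omega> :: real"
      let ?U = "\<Union>i. A i"
      have sint: "integrable M (?s i)" for i using AM by (auto intro!: integrable_real_indicator simp: emeasure_eq_measure)
      have s: "?s i \<omega> = (\<Sum>j<i. indicator (A j) \<omega>)" for i \<omega>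
        by (rule indicator_UN_disjoint) (use union(1) in \<open>auto simp: disjoint_family_on_def\<close>)
      have Iint: "integrable M (indicator (A j) :: 'a \<Rightarrow> real)" for j
        using AM by (auto intro!: integrable_real_indicator simp: emeasure_eq_measure)
      have P: "?P (?s i)" for i
      proof -
        have e: "(\<integral>\<omega>. u \<omega> * ?s i \<omega> \<partial>M) = (\<Sum>j<i. \<integral>\<omega>. u \<omega> * indicator (A j) \<omega> \<partial>M)"
          if "\<And>j. integrable M (\<lambda>\<omega>. u \<omega> * indicator (A j) \<omega>)" for u :: "'a \<Rightarrow> real"
          unfolding s sum_distrib_left by (rule Bochner_Integration.integral_sum) (rule that)
        show ?thesis unfolding e[OF wi(1)[OF Iint]] e[OF wi(2)[OF Iint]]
          by (intro tendsto_sum union)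
      qed
      have L: "(\<lambda>i. \<integral>\<omega>. \<bar>indicator ?U \<omega> - ?s i \<omega>\<bar> \<partial>M) \<longlonglongrightarrow> (\<integral>\<omega>. 0 \<partial>M)"
      proof (rule integral_dominated_convergence[where w="\<lambda>_. 1"])
        show "AE \<omega> in M. (\<lambda>i. \<bar>indicator ?U \<omega> - ?s i \<omega>\<bar>) \<longlonglongrightarrow> 0"
        proof (rule AE_I2)
          fix \<omega>
          have "(\<lambda>i. \<bar>indicator ?U \<omega> - ?s i \<omega>\<bar>) \<longlonglongrightarrow> \<bar>indicator ?U \<omega> - indicator ?U \<omega> :: real\<bar>"
            by (intro tendsto_intros LIMSEQ_indicator_UN)
          then show "(\<lambda>i. \<bar>indicator ?U \<omega> - ?s i \<omega>\<bar>) \<longlonglongrightarrow> 0" by simp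
        qed
        show "AE \<omega> in M. norm \<bar>indicator ?U \<omega> - ?s i \<omega>\<bar> \<le> 1" for i
          by (auto simp: indicator_def)
      qed (use AM in auto)
      show ?case
        by (rule closed[OF sint P])
          (use L AM in \<open>auto intro!: integrable_real_indicator simp: emeasure_eq_measure\<close>)
    qed
  qed
  have "integrable (restr_to_subalg M H) f"
    by (rule integrable_in_subalg[OF H f(2,1)])
  then show "?P f"
  proof (induction rule: integrable_induct)
    case (base A c)
    then have "?P (indicator A)" using set by (simp add: sets_restr_to_subalg[OF H])
    from tendsto_mult_right[OF this, of c] show ?case by (simp flip: mult.assoc)
  next
    case (add f g)
    note i = integrable_from_subalg[OF H add.hyps(1)] integrable_from_subalg[OF H add.hyps(2)]
    show ?case
      using tendsto_add[OF add.IH] i by (simp add: distrib_left wi)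
  next
    case (lim f s)
    note fi = integrable_from_subalg[OF H lim.hyps(4)] and si = integrable_from_subalg[OF H lim.hyps(1)]
    have "(\<lambda>i. \<integral>\<omega>. \<bar>f \<omega> - s i \<omega>\<bar> \<partial>M) \<longlonglongrightarrow> (\<integral>\<omega>. 0 \<partial>M)"
    \<comment> \<open>The induction rule for integrable functions bounds \<open>s i\<close> by twice
      \<open>f\<close> in norm; the third copy of \<open>f\<close> comes from the
      difference.\<close>
    proof (rule integral_dominated_convergence[where w="\<lambda>\<omega>. 3 * \<bar>f \<omega>\<bar>"])
      show "AE \<omega> in M. (\<lambda>i. \<bar>f \<omega> - s i \<omega>\<bar>) \<longlonglongrightarrow> 0"
      proof (rule AE_I2)
        fix \<omega> assume "\<omega> \<in> space M"
        then have "(\<lambda>i. s i \<omega>) \<longlonglongrightarrow> f \<omega>" using lim.hyps(2) by (simp add: space_restr_to_subalg)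
        then have "(\<lambda>i. \<bar>f \<omega> - s i \<omega>\<bar>) \<longlonglongrightarrow> \<bar>f \<omega> - f \<omega>\<bar>" by (intro tendsto_intros)
        then show "(\<lambda>i. \<bar>f \<omega> - s i \<omega>\<bar>) \<longlonglongrightarrow> 0" by simp
      qed
      show "AE \<omega> in M. norm \<bar>f \<omega> - s i \<omega>\<bar> \<le> 3 * \<bar>f \<omega>\<bar>" for i
      proof (rule AE_I2)
        fix \<omega> assume "\<omega> \<in> space M"
        then have "norm (s i \<omega>) \<le> 2 * norm (f \<omega>)" using lim.hyps(3) by (simp add: space_restr_to_subalg)
        then show "norm \<bar>f \<omega> - s i \<omega>\<bar> \<le> 3 * \<bar>f \<omega>\<bar>" by simp
      qed
    qed (use fi si in auto)
    then show ?case by (intro closed[OF si lim.IH fi]) simp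
  qed
qed

section \<open>Mixing digits of a nonatomic variable\<close>

text \<open>Base 3 rather than 2 avoids ambiguous expansions: at the first index \<open>n\<close>
  where the digits differ the change is \<open>(1/3)^n\<close>, while all later digits together
  contribute at most half of that.\<close>

lemma ternary_expansion_inj:
  fixes b c :: "nat \<Rightarrow> real"
  assumes b: "\<And>i. b i \<in> {0, 1}" and c: "\<And>i. c i \<in> {0, 1}"
    and eq: "(\<Sum>i. b i * (1/3)^i) = (\<Sum>i. c i * (1/3)^i)"
  shows "b = c"
proof (rule ccontr)
  assume "b \<noteq> c"
  define n where "n = (LEAST i. b i \<noteq> c i)"
  have "\<exists>i. b i \<noteq> c i" using \<open>b \<noteq> c\<close> by auto
  from LeastI_ex[OF this] have n: "b n \<noteq> c n" unfolding n_def .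
  have n': "b i = c i" if "i < n" for i
    using not_less_Least that unfolding n_def by blast
  define d where "d i = b i - c i" for i
  have d: "\<bar>d i\<bar> \<le> 1" for i using b[of i] c[of i] by (auto simp: d_def)
  have g: "summable (\<lambda>i. (1/3::real)^i)" by (rule summable_geometric) auto
  have s: "summable (\<lambda>i. u i * (1/3)^i)" if "\<And>i. \<bar>u i\<bar> \<le> 1" for u :: "nat \<Rightarrow> real"
  proof (rule summable_comparison_test'[OF g, of 0])
    fix i show "norm (u i * (1/3)^i) \<le> (1/3)^i"
      using mult_right_mono[OF that[of i], of "(1/3)^i"] by (simp add: abs_mult)
  qed
  have b1: "\<bar>b i\<bar> \<le> 1" and c1: "\<bar>c i\<bar> \<le> 1" for i using b[of i] c[of i] by auto
  have "(\<Sum>i. d i * (1/3)^i) = 0"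
    using suminf_diff[OF s[of b, OF b1] s[of c, OF c1]] eq by (simp add: d_def left_diff_distrib)
  moreover have "(\<Sum>i. d i * (1/3)^i) = (\<Sum>i. d (i + Suc n) * (1/3)^(i + Suc n)) + (\<Sum>i<Suc n. d i * (1/3)^i)"
    by (rule suminf_split_initial_segment[OF s[OF d]])
  moreover have "(\<Sum>i<Suc n. d i * (1/3)^i) = d n * (1/3)^n"
    using n' by (simp add: d_def)
  moreover have "\<bar>\<Sum>i. d (i + Suc n) * (1/3)^(i + Suc n)\<bar> \<le> (1/3)^n / 2"
  proof -
    have g': "(\<lambda>i. (1/3)^(Suc n) * (1/3::real)^i) sums ((1/3)^(Suc n) * (1 / (1 - 1/3)))"
      by (intro sums_mult geometric_sums) auto
    have "norm (\<Sum>i. d (i + Suc n) * (1/3)^(i + Suc n)) \<le> (\<Sum>i. (1/3)^(Suc n) * (1/3::real)^i)"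
    proof (rule norm_suminf_le)
      show "summable (\<lambda>i. (1/3)^(Suc n) * (1/3::real)^i)" using g' by (rule sums_summable)
      fix i show "norm (d (i + Suc n) * (1/3)^(i + Suc n)) \<le> (1/3)^(Suc n) * (1/3::real)^i"
        using mult_right_mono[OF d[of "i + Suc n"], of "(1/3)^(i + Suc n)"]
        by (simp add: abs_mult power_add mult.commute)
    qed
    also have "\<dots> = (1/3)^n / 2" using sums_unique[OF g', symmetric] by simp
    finally show ?thesis by simp
  qed
  moreover have "\<bar>d n\<bar> = 1" using n b[of n] c[of n] by (auto simp: d_def)
  then have "\<bar>d n * (1/3)^n\<bar> = (1/3)^n" by (simp add: abs_mult)
  moreover have "(1/3::real)^n > 0" by simp
  ultimately show False by linarith
qed

text \<open>A point is recorded by the sequence of basic open sets containing it, read as a ternary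
  expansion; the T1 property makes this sequence determine the point.\<close>

lemma ex_borel_injection_real:
  "\<exists>W :: 'y::{second_countable_topology, t1_space} \<Rightarrow> real. W \<in> borel_measurable borel \<and> inj W"
proof -
  obtain B :: "'y set set" where B: "countable B" "topological_basis B"
    using ex_countable_basis by blast
  have ne: "B \<noteq> {}" using topological_basisE[OF B(2) open_UNIV UNIV_I] by auto
  define U where "U = from_nat_into B"
  have U: "range U = B" using range_from_nat_into[OF ne B(1)] by (simp add: U_def)
  have opU: "open (U n)" for n
    using topological_basis_open[OF B(2)] U by (metis rangeI)
  define W where "W y = (\<Sum>i. indicator (U i) y * (1/3::real)^i)" for y
  have "W \<in> borel_measurable borel"
    unfolding W_def using opU by (intro borel_measurable_suminf borel_measurable_times) auto
  moreover have "inj W"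
  proof (rule injI, rule ccontr)
    fix x y assume xy: "W x = W y" "x \<noteq> y"
    have eq: "(\<lambda>i. indicator (U i) x) = (\<lambda>i. indicator (U i) y :: real)"
      by (rule ternary_expansion_inj) (use xy in \<open>auto simp: W_def indicator_def\<close>)
    obtain O' where O': "open O'" "x \<in> O'" "y \<notin> O'" using t1_space[OF xy(2)] by blast
    then obtain B' where "B' \<in> B" "x \<in> B'" "B' \<subseteq> O'" using topological_basisE[OF B(2)] by metis
    then obtain i where "x \<in> U i" "y \<notin> U i" using U O' by blast
    then show False using fun_cong[OF eq, of i] by simp
  qed
  ultimately show ?thesis by blast
qed

lemma nonatomic_singleton:
  assumes "nonatomic \<mu>" "{y} \<in> sets \<mu>"
  shows "emeasure \<mu> {y} = 0"
proof (rule ccontr)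
  assume "emeasure \<mu> {y} \<noteq> 0"
  then have "0 < emeasure \<mu> {y}" by (simp add: zero_less_iff_neq_zero)
  then obtain B where B: "B \<subseteq> {y}" "0 < emeasure \<mu> B" "emeasure \<mu> B < emeasure \<mu> {y}"
    using assms unfolding nonatomic_def by blast
  then have "B = {} \<or> B = {y}" by auto
  then show False using B by auto
qed

text \<open>The probability integral transform, after a Borel injection \<open>W\<close> into the
  reals. Injectivity carries the absence of atoms over to the law of \<open>W (Y \<omega>)\<close>,
  so its distribution function \<open>F\<close> is continuous and \<open>T = F \<circ> W\<close> is
  uniform.\<close>

lemma (in prob_space) ex_uniform_of_nonatomic:
  fixes Y :: "'a \<Rightarrow> 'y::{second_countable_topology, t1_space}"
  assumes Y: "Y \<in> borel_measurable M" and na: "nonatomic (distr M borel Y)"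
  shows "\<exists>T :: 'y \<Rightarrow> real. T \<in> borel_measurable borel \<and> (\<forall>y. 0 \<le> T y \<and> T y \<le> 1) \<and>
    (\<forall>x. 0 \<le> x \<and> x \<le> 1 \<longrightarrow> prob {\<omega>\<in>space M. T (Y \<omega>) \<le> x} = x \<and> prob {\<omega>\<in>space M. T (Y \<omega>) < x} = x)"
proof -
  obtain W :: "'y \<Rightarrow> real" where W: "W \<in> borel_measurable borel" "inj W"
    using ex_borel_injection_real by blast
  have [measurable]: "(\<lambda>\<omega>. W (Y \<omega>)) \<in> borel_measurable M" using W Y by measurable
  let ?D = "distr M borel (\<lambda>\<omega>. W (Y \<omega>))"
  interpret D: real_distribution ?D by simp
  define F where "F = cdf ?D"
  have Fp: "F w = prob {\<omega>\<in>space M. W (Y \<omega>) \<le> w}" for w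
    by (auto simp: F_def cdf_def measure_distr intro!: arg_cong[where f=prob])
  have atom: "prob {\<omega>\<in>space M. W (Y \<omega>) = w} = 0" for w
  proof (cases "\<exists>y. W y = w")
    case True
    then obtain y where y: "W y = w" by blast
    have [measurable]: "{y} \<in> sets borel" by auto
    have "emeasure (distr M borel Y) {y} = 0"
      by (rule nonatomic_singleton[OF na]) auto
    then have "emeasure M (Y -` {y} \<inter> space M) = 0" using Y by (simp add: emeasure_distr)
    moreover have "Y -` {y} \<inter> space M = {\<omega>\<in>space M. W (Y \<omega>) = w}"
      using W(2) y by (auto simp: inj_def)
    ultimately show ?thesis by (simp add: measure_def)
  next
    case False then show ?thesis by (metis (mono_tags, lifting) Collect_empty_eq measure_empty)
  qed
  have contF: "isCont F w" for w
    unfolding F_def D.isCont_cdf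
    using atom[of w] by (simp add: measure_distr vimage_def Int_def conj_commute)
  have monoF: "F a \<le> F b" if "a \<le> b" for a b unfolding F_def by (rule D.cdf_nondecreasing[OF that])
  have F01: "0 \<le> F a" "F a \<le> 1" for a unfolding F_def by (auto simp: D.cdf_nonneg D.cdf_bounded_prob)
  define T where "T y = F (W y)" for y
  have Fm: "F \<in> borel_measurable borel"
    by (intro borel_measurable_continuous_onI continuous_at_imp_continuous_on ballI contF)
  have T: "T \<in> borel_measurable borel" unfolding T_def using Fm W by measurable
  have [measurable]: "(\<lambda>\<omega>. T (Y \<omega>)) \<in> borel_measurable M" using T Y by measurable
  \<comment> \<open>A point \<open>w\<close> with \<open>F w = x\<close> places the event
    \<open>W (Y \<omega>) \<le> w\<close>, of probability \<open>x\<close>, between the strict and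
    the closed event. Such a \<open>w\<close> may fail to exist for \<open>x = 0\<close> or
    \<open>x = 1\<close>. The two opposite inequalities follow afterwards by comparison with
    thresholds slightly above and slightly below \<open>x\<close>.\<close>
  have key: "x \<le> prob {\<omega>\<in>space M. T (Y \<omega>) \<le> x} \<and> prob {\<omega>\<in>space M. T (Y \<omega>) < x} \<le> x" if x: "0 \<le> x" "x \<le> 1" for x
  proof -
    consider "x = 0" | "x = 1" | "0 < x" "x < 1" using x by linarith
    then show ?thesis
    proof cases
      case 1
      have "{\<omega>\<in>space M. T (Y \<omega>) < x} = {}" using F01 by (auto simp: T_def 1 not_less)
      then show ?thesis using 1 by (simp only: measure_empty) simp
    next
      case 2
      have "{\<omega>\<in>space M. T (Y \<omega>) \<le> x} = space M" using F01 by (auto simp: T_def 2)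
      then show ?thesis using 2 prob_space by simp
    next
      case 3
      have "eventually (\<lambda>a. F a < x) at_bot" using order_tendstoD(2)[OF D.cdf_lim_at_bot 3(1)] by (simp add: F_def)
      then obtain a where a: "F a < x" by (auto simp: eventually_at_bot_linorder)
      have "eventually (\<lambda>a. F a > x) at_top" using order_tendstoD(1)[OF D.cdf_lim_at_top_prob 3(2)] by (simp add: F_def)
      then obtain b where b: "F b > x" by (auto simp: eventually_at_top_linorder)
      have "a \<le> b" using monoF[of b a] a b by linarith
      then obtain w where w: "F w = x"
        using IVT[of F a x b] a b contF by auto
      have lt: "W y \<le> w" if "T y < x" for y
        using monoF[of w "W y"] that w by (cases "W y \<le> w") (auto simp: T_def)
      have "prob {\<omega>\<in>space M. W (Y \<omega>) \<le> w} \<le> prob {\<omega>\<in>space M. T (Y \<omega>) \<le> x}"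
        by (rule finite_measure_mono) ((use monoF w in \<open>auto simp: T_def\<close>)[1], measurable)
      moreover have "prob {\<omega>\<in>space M. T (Y \<omega>) < x} \<le> prob {\<omega>\<in>space M. W (Y \<omega>) \<le> w}"
        by (rule finite_measure_mono) ((use lt in blast)[1], measurable)
      ultimately show ?thesis using Fp[of w] w by simp
    qed
  qed
  have "prob {\<omega>\<in>space M. T (Y \<omega>) \<le> x} = x \<and> prob {\<omega>\<in>space M. T (Y \<omega>) < x} = x" if x: "0 \<le> x" "x \<le> 1" for x
  proof
    have "prob {\<omega>\<in>space M. T (Y \<omega>) \<le> x} \<le> x"
    proof (cases "x = 1")
      case False
      show ?thesis
      proof (rule dense_ge_bounded[of x 1])
        show "x < 1" using False x by simp
        fix w assume w: "x < w" "w < 1"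
        have "prob {\<omega>\<in>space M. T (Y \<omega>) \<le> x} \<le> prob {\<omega>\<in>space M. T (Y \<omega>) < w}"
          by (rule finite_measure_mono) (use w in auto)
        then show "prob {\<omega>\<in>space M. T (Y \<omega>) \<le> x} \<le> w" using key[of w] w x by linarith
      qed
    qed simp
    then show "prob {\<omega>\<in>space M. T (Y \<omega>) \<le> x} = x" using key[OF x] by linarith
    have "x \<le> prob {\<omega>\<in>space M. T (Y \<omega>) < x}"
    proof (cases "x = 0")
      case False
      show ?thesis
      proof (rule dense_le_bounded[of 0 x])
        show "0 < x" using False x by simp
        fix w assume w: "0 < w" "w < x"
        have "prob {\<omega>\<in>space M. T (Y \<omega>) \<le> w} \<le> prob {\<omega>\<in>space M. T (Y \<omega>) < x}"
          by (rule finite_measure_mono) (use w in auto)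
        then show "w \<le> prob {\<omega>\<in>space M. T (Y \<omega>) < x}" using key[of w] w x by linarith
      qed
    qed simp
    then show "prob {\<omega>\<in>space M. T (Y \<omega>) < x} = x" using key[OF x] by linarith
  qed
  then show ?thesis using T F01 by (intro exI[of _ T]) (auto simp: T_def)
qed

lemma measurable_floor_mod [measurable]:
  "(\<lambda>u. nat \<lfloor>real m * u\<rfloor> mod B) \<in> measurable borel (count_space UNIV)"
proof -
  have "(\<lambda>u::real. nat \<lfloor>real m * u\<rfloor>) \<in> measurable borel (count_space UNIV)" by measurable
  then show ?thesis by (rule measurable_compose[where g="\<lambda>n. n mod B"]) simp
qed

text \<open>The digit equals \<open>j\<close> on the intervals \<open>I i\<close> of length
  \<open>1 / (K * B)\<close>, one in each period of length \<open>1 / K\<close>. The first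
  \<open>m\<close> periods lie entirely below \<open>x\<close> and at most one further interval
  meets the event, which bounds the error by a single interval length.\<close>

lemma (in prob_space) digit_prob_bound:
  fixes U :: "'a \<Rightarrow> real"
  assumes U [measurable]: "U \<in> borel_measurable M"
    and U01: "\<And>\<omega>. \<omega> \<in> space M \<Longrightarrow> 0 \<le> U \<omega> \<and> U \<omega> \<le> 1"
    and unif: "\<And>x. 0 \<le> x \<Longrightarrow> x \<le> 1 \<Longrightarrow> prob {\<omega>\<in>space M. U \<omega> < x} = x"
    and B: "j < B" and K: "K > 0" and x: "0 \<le> x" "x \<le> 1"
  shows "\<bar>prob {\<omega>\<in>space M. nat \<lfloor>real (K * B) * U \<omega>\<rfloor> mod B = j \<and> U \<omega> \<le> x} - x / B\<bar> \<le> 1 / real (K * B)"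
proof -
  define m where "m = nat \<lfloor>K * x\<rfloor>"
  have m: "m \<le> K * x" "K * x < m + 1"
    using K x by (auto simp: m_def) linarith
  have KB: "K * B > 0" using K B by simp
  let ?d = "\<lambda>\<omega>. nat \<lfloor>real (K * B) * U \<omega>\<rfloor>"
  define I where "I i = {\<omega>\<in>space M. real (i * B + j) / (K * B) \<le> U \<omega> \<and> U \<omega> < real (i * B + j + 1) / (K * B)}" for i
  have [measurable]: "I i \<in> sets M" for i unfolding I_def by measurable
  have d: "\<omega> \<in> I i \<longleftrightarrow> \<omega> \<in> space M \<and> ?d \<omega> = i * B + j" for \<omega> i
  proof (cases "\<omega> \<in> space M")
    case True
    then have "0 \<le> real (K * B) * U \<omega>" using U01 by auto
    then have "?d \<omega> = i * B + j \<longleftrightarrow> real (i * B + j) \<le> real (K * B) * U \<omega> \<and> real (K * B) * U \<omega> < real (i * B + j) + 1"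
      by linarith
    also have "\<dots> \<longleftrightarrow> \<omega> \<in> I i"
      using KB True by (simp add: I_def field_simps)
    finally show ?thesis using True by simp
  qed (simp add: I_def)
  \<comment> \<open>For \<open>i \<ge> m\<close> the interval may extend beyond 1, so its length is
    then just an upper bound for its probability.\<close>
  have P1: "prob (I i) \<le> 1 / (K * B)" and P2: "i < m \<Longrightarrow> prob (I i) = 1 / (K * B)" for i
  proof -
    let ?a = "real (i * B + j) / (K * B)" and ?b = "real (i * B + j + 1) / (K * B)"
    have ab: "0 \<le> ?a" "?a \<le> ?b" "?b - ?a = 1 / (K * B)" using KB by (auto simp: field_simps)
    have eq: "prob (I i) = prob {\<omega>\<in>space M. U \<omega> < ?b} - prob {\<omega>\<in>space M. U \<omega> < ?a}"
      by (subst finite_measure_Diff[symmetric])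
        (use ab in \<open>auto simp: I_def intro!: arg_cong[where f=prob]\<close>)
    show "prob (I i) \<le> 1 / (K * B)"
    proof (cases "?a \<le> 1")
      case True
      have "prob {\<omega>\<in>space M. U \<omega> < ?b} \<le> ?b"
        using unif[of ?b] ab prob_le_1[of "{\<omega>\<in>space M. U \<omega> < ?b}"] by linarith
      then show ?thesis using eq unif[OF ab(1) True] ab by linarith
    next
      case False
      then have "I i = {}" using U01 by (force simp: I_def)
      then show ?thesis by simp
    qed
    assume "i < m"
    then have "i * B + j + 1 \<le> m * B"
      using B mult_le_mono1[of "i + 1" m B] by simp
    then have "real (i * B + j + 1) \<le> real (m * B)" by linarith
    also have "\<dots> \<le> real K * x * B" using m(1) B by (simp add: mult_right_mono)
    also have "\<dots> \<le> K * B" using x KB by (simp add: mult_left_le)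
    finally have "?b \<le> 1" using KB by simp
    then show "prob (I i) = 1 / (K * B)"
      using eq unif[of ?a] unif[of ?b] ab by linarith
  qed
  have disj: "disjoint_family I"
    using B by (auto simp: disjoint_family_on_def d)
  let ?A = "{\<omega>\<in>space M. ?d \<omega> mod B = j \<and> U \<omega> \<le> x}"
  have A [measurable]: "?A \<in> sets M"
  proof -
    have "{\<omega>\<in>space M. ?d \<omega> mod B = j} \<in> sets M"
      using measurable_sets[OF measurable_compose[OF U measurable_floor_mod[of "K * B" B]], of "{j}"]
      by (simp add: vimage_def Int_def conj_commute)
    then have "{\<omega>\<in>space M. ?d \<omega> mod B = j} \<inter> {\<omega>\<in>space M. U \<omega> \<le> x} \<in> sets M" by measurable
    then show ?thesis by (rule back_subst[of "\<lambda>A. A \<in> sets M"]) auto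
  qed
  have "?A \<subseteq> (\<Union>i\<le>m. I i)"
  proof
    fix \<omega> assume w: "\<omega> \<in> ?A"
    let ?i = "?d \<omega> div B"
    have "?d \<omega> = ?i * B + j" using w by (metis (mono_tags, lifting) div_mult_mod_eq mem_Collect_eq)
    then have "\<omega> \<in> I ?i" using w by (simp add: d)
    moreover have "?i \<le> m"
    proof -
      have "real (?i * B + j) \<le> real (K * B) * U \<omega>"
        using \<open>\<omega> \<in> I ?i\<close> KB by (simp add: I_def field_simps)
      then have "real (?i * B) \<le> real (K * B) * U \<omega>" by linarith
      also have "real (K * B) * U \<omega> \<le> real (K * B) * x" using w by (auto intro: mult_left_mono)
      finally have "real ?i * B \<le> (K * x) * B" by (simp add: algebra_simps)
      then have "real ?i \<le> K * x" using B by simp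
      then show ?thesis using m by linarith
    qed
    ultimately show "\<omega> \<in> (\<Union>i\<le>m. I i)" by blast
  qed
  then have "prob ?A \<le> prob (\<Union>i\<le>m. I i)" by (rule finite_measure_mono) measurable
  also have "\<dots> \<le> (\<Sum>i\<le>m. prob (I i))" by (rule finite_measure_subadditive_finite) auto
  also have "\<dots> \<le> (\<Sum>i\<le>m. 1 / (K * B))" by (rule sum_mono) (rule P1)
  also have "\<dots> = (m + 1) / (K * B)" by simp
  also have "\<dots> \<le> (K * x + 1) / (K * B)" using m(1) by (intro divide_right_mono) auto
  also have "\<dots> = x / B + 1 / (K * B)" using K by (simp add: add_divide_distrib)
  finally have up: "prob ?A \<le> x / B + 1 / (K * B)" .
  have "(\<Union>i<m. I i) \<subseteq> ?A"
  proof
    fix \<omega> assume "\<omega> \<in> (\<Union>i<m. I i)"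
    then obtain i where i: "i < m" "\<omega> \<in> I i" by blast
    have "real (K * B) * U \<omega> < real (i * B + j + 1)"
      using i(2) KB by (simp add: I_def field_simps)
    also have "\<dots> \<le> real ((i + 1) * B)" unfolding of_nat_le_iff using B by simp
    also have "\<dots> \<le> real (m * B)" unfolding of_nat_le_iff using i(1) by (intro mult_right_mono) auto
    also have "\<dots> \<le> real K * x * B" using m(1) B by (simp add: mult_right_mono)
    finally have "U \<omega> \<le> x" using KB by (simp add: field_simps)
    then show "\<omega> \<in> ?A" using i(2) B by (simp add: d)
  qed
  then have "prob (\<Union>i<m. I i) \<le> prob ?A" by (rule finite_measure_mono) measurable
  moreover have "prob (\<Union>i<m. I i) = (\<Sum>i<m. prob (I i))"
    by (rule finite_measure_finite_Union) (use disj in \<open>auto simp: disjoint_family_on_def\<close>)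
  moreover have "(\<Sum>i<m. prob (I i)) = m / (K * B)" using P2 by simp
  moreover have "(K * x - 1) / (K * B) \<le> m / (K * B)" using m(2) by (intro divide_right_mono) auto
  moreover have "(K * x - 1) / (K * B) = x / B - 1 / (K * B)" using K by (simp add: diff_divide_distrib)
  ultimately have "x / B - 1 / (K * B) \<le> prob ?A" by linarith
  then show ?thesis using up by linarith
qed

text \<open>A Riemann-Lebesgue effect: the indicator of a digit oscillates ever faster and converges
  weakly to its mean \<open>1 / B\<close>. The rate in \<open>digit_prob_bound\<close> gives this on
  the events \<open>U \<le> x\<close>, which generate the sigma-algebra of \<open>U\<close>.\<close>

lemma (in prob_space) mixing_digits:
  fixes U :: "'a \<Rightarrow> real"
  assumes U: "U \<in> borel_measurable M"
    and U01: "\<And>\<omega>. \<omega> \<in> space M \<Longrightarrow> 0 \<le> U \<omega> \<and> U \<omega> \<le> 1"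
    and unif: "\<And>x. 0 \<le> x \<Longrightarrow> x \<le> 1 \<Longrightarrow> prob {\<omega>\<in>space M. U \<omega> < x} = x"
    and j: "j < B" and f: "integrable M f"
  shows "(\<lambda>k. \<integral>\<omega>. indicator {\<omega>\<in>space M. nat \<lfloor>real (Suc k * B) * U \<omega>\<rfloor> mod B = j} \<omega> * f \<omega> \<partial>M)
    \<longlonglongrightarrow> (\<integral>\<omega>. f \<omega> \<partial>M) / B"
proof -
  define H where "H = vimage_algebra (space M) U borel"
  define E where "E = {U -` A \<inter> space M | A. A \<in> range (\<lambda>x. {..x})}"
  have HE: "sets H = sigma_sets (space M) E"
    unfolding H_def E_def borel_eq_atMost
    by (subst vimage_algebra_sigma, simp, simp, rule sets_measure_of) auto
  have UH [measurable]: "U \<in> borel_measurable H" unfolding H_def by (rule measurable_vimage_algebra1) auto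
  have H: "subalgebra M H"
    unfolding subalgebra_def H_def using U by (auto simp: sets_vimage_algebra2)
  interpret H: finite_measure_subalgebra M H by unfold_locales (rule H)
  define S where "S k = {\<omega>\<in>space M. nat \<lfloor>real (Suc k * B) * U \<omega>\<rfloor> mod B = j}" for k
  have spH: "space H = space M" by (simp add: H_def)
  have SH [measurable]: "S k \<in> sets H" for k
    using measurable_sets[OF measurable_compose[OF UH measurable_floor_mod[of "Suc k * B" B]], of "{j}"]
    by (simp add: S_def vimage_def Int_def conj_commute spH)
  have SM [measurable]: "S k \<in> sets M" for k using SH H by (auto simp: subalgebra_def)
  have b: "\<bar>prob (S k \<inter> {\<omega>\<in>space M. U \<omega> \<le> x}) - x / B\<bar> \<le> 1 / real (Suc k * B)" if "0 \<le> x" "x \<le> 1" for k x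
  proof -
    have "S k \<inter> {\<omega>\<in>space M. U \<omega> \<le> x}
        = {\<omega>\<in>space M. nat \<lfloor>real (Suc k * B) * U \<omega>\<rfloor> mod B = j \<and> U \<omega> \<le> x}"
      by (auto simp: S_def)
    then show ?thesis using digit_prob_bound[OF U U01 unif j zero_less_Suc that, of k] by (simp only:)
  qed
  have lim: "(\<lambda>k. prob (S k \<inter> {\<omega>\<in>space M. U \<omega> \<le> x})) \<longlonglongrightarrow> x / B" if "0 \<le> x" "x \<le> 1" for x
  proof -
    have "(\<lambda>k. 1 / B * inverse (real (Suc k))) \<longlonglongrightarrow> 1 / B * 0"
      by (intro tendsto_intros LIMSEQ_inverse_real_of_nat)
    then have "(\<lambda>k. 1 / (real (Suc k * B))) \<longlonglongrightarrow> 0" by (simp add: field_simps)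
    then have "(\<lambda>k. prob (S k \<inter> {\<omega>\<in>space M. U \<omega> \<le> x}) - x / B) \<longlonglongrightarrow> 0"
      by (rule Lim_null_comparison[rotated]) (intro always_eventually allI, unfold real_norm_def, rule b[OF that])
    then show ?thesis by (simp add: LIM_zero_iff)
  qed
  \<comment> \<open>\<open>f\<close> need not be a function of \<open>U\<close>; as the digit events
    belong to \<open>H\<close>, replacing \<open>f\<close> by its conditional expectation given
    \<open>U\<close> changes none of the integrals.\<close>
  let ?f = "real_cond_exp M H f"
  have "(\<lambda>k. \<integral>\<omega>. indicator (S k) \<omega> * ?f \<omega> \<partial>M) \<longlonglongrightarrow> (\<integral>\<omega>. (1 / B) * ?f \<omega> \<partial>M)"
  proof (rule weak_limit_of_generator[OF H HE, where b=1])
    show "E \<subseteq> Pow (space M)" by (auto simp: E_def)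
    show "Int_stable E"
    proof (rule Int_stableI)
      fix a b assume "a \<in> E" "b \<in> E"
      then obtain x y where "a = U -` {..x} \<inter> space M" "b = U -` {..y} \<inter> space M" by (auto simp: E_def)
      then have "a \<inter> b = U -` {..min x y} \<inter> space M" by auto
      then show "a \<inter> b \<in> E" by (auto simp: E_def)
    qed
    have "prob (S k \<inter> {\<omega>\<in>space M. U \<omega> \<le> 1}) = (\<integral>\<omega>. indicator (S k) \<omega> \<partial>M)" for k
      using U01 by (auto intro!: arg_cong[where f=prob] simp: S_def)
    with lim[of 1] show "(\<lambda>k. \<integral>\<omega>. indicator (S k) \<omega> \<partial>M) \<longlonglongrightarrow> (\<integral>\<omega>. 1 / B \<partial>M)"
      by (simp add: prob_space)
    fix A assume "A \<in> E"
    then obtain x where A: "A = {\<omega>\<in>space M. U \<omega> \<le> x}" by (auto simp: E_def)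
    have AM [measurable]: "A \<in> sets M" unfolding A using U by measurable
    \<comment> \<open>A threshold outside the unit interval gives the empty event or the whole
      space, so it can be moved to where \<open>lim\<close> applies.\<close>
    consider "x < 0" | "0 \<le> x" "x \<le> 1" | "1 < x" by linarith
    then obtain y where y: "0 \<le> y" "y \<le> 1" "A = {} \<or> A = {\<omega>\<in>space M. U \<omega> \<le> y}"
    proof cases
      case 1 then show ?thesis using that[of 0] U01 by (force simp: A)
    next
      case 2 then show ?thesis using that[of x] by (simp add: A)
    next
      case 3 then show ?thesis using that[of 1] U01 by (force simp: A)
    qed
    show "(\<lambda>k. \<integral>\<omega>. indicator (S k) \<omega> * indicator A \<omega> \<partial>M) \<longlonglongrightarrow> (\<integral>\<omega>. 1 / B * indicator A \<omega> \<partial>M)"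
    proof (cases "A = {}")
      case False
      have leq: "prob {\<omega>\<in>space M. U \<omega> \<le> y} = y"
      proof (rule antisym)
        have "prob {\<omega>\<in>space M. U \<omega> < y} \<le> prob {\<omega>\<in>space M. U \<omega> \<le> y}"
          by (rule finite_measure_mono) (use U in auto)
        then show "y \<le> prob {\<omega>\<in>space M. U \<omega> \<le> y}" using unif[OF y(1,2)] by simp
        show "prob {\<omega>\<in>space M. U \<omega> \<le> y} \<le> y"
        proof (rule dense_ge)
          fix z assume z: "y < z"
          have "prob {\<omega>\<in>space M. U \<omega> \<le> y} \<le> prob {\<omega>\<in>space M. U \<omega> < z}"
            by (rule finite_measure_mono) (use U z in auto)
          then show "prob {\<omega>\<in>space M. U \<omega> \<le> y} \<le> z"
            using unif[of z] z y prob_le_1[of "{\<omega>\<in>space M. U \<omega> \<le> y}"] by linarith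
        qed
      qed
      have "(\<integral>\<omega>. indicator (S k) \<omega> * indicator A \<omega> \<partial>M) = prob (S k \<inter> A)" for k
        by (simp flip: indicator_inter_arith)
      moreover have "(\<integral>\<omega>. 1 / B * indicator A \<omega> \<partial>M) = y / B"
      proof -
        have "prob A = y" using leq y(3) False by simp
        then show ?thesis using sets.Int_space_eq2[OF AM] by simp
      qed
      moreover have "A = {\<omega>\<in>space M. U \<omega> \<le> y}" using y(3) False by simp
      ultimately show ?thesis using lim[OF y(1,2)] by (simp only:)
    qed simp
  qed (use j in \<open>auto simp: indicator_def H.real_cond_exp_int f\<close>)
  moreover have "(\<integral>\<omega>. (1 / B) * ?f \<omega> \<partial>M) = (\<integral>\<omega>. f \<omega> \<partial>M) / B"
    using H.real_cond_exp_int(2)[OF f] by simp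
  moreover have "(\<integral>\<omega>. indicator (S k) \<omega> * ?f \<omega> \<partial>M) = (\<integral>\<omega>. indicator (S k) \<omega> * f \<omega> \<partial>M)" for k
    by (rule H.real_cond_exp_intg(2)) (use f integrable_mult_indicator[OF SM f] in auto)
  ultimately show ?thesis unfolding S_def by (simp only:)
qed

section \<open>The bounded Lipschitz metric and continuous approximation\<close>

text \<open>Composition with the retraction extends test functions from \<open>S\<close> to the
  whole type. It is needed because paths are encoded as functions on all natural numbers with a
  fixed value off the index set, while convergence is stated on the set of such functions.\<close>

lemma conv_in_law_retract_iff:
  fixes W :: "'a \<Rightarrow> 'b::topological_space"
  assumes r: "continuous_on UNIV r" "\<And>x. r x \<in> S" "\<And>x. x \<in> S \<Longrightarrow> r x = x"
    and W: "\<And>k \<omega>. \<omega> \<in> space M \<Longrightarrow> Wk k \<omega> \<in> S" "\<And>\<omega>. \<omega> \<in> space M \<Longrightarrow> W \<omega> \<in> S"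
  shows "conv_in_law M S Wk W \<longleftrightarrow> conv_in_law M UNIV Wk W"
proof
  assume L: "conv_in_law M S Wk W"
  show "conv_in_law M UNIV Wk W"
    unfolding conv_in_law_def
  proof (intro allI impI)
    fix F :: "'b \<Rightarrow> real" assume F: "continuous_on UNIV F \<and> bounded (range F)"
    then have "continuous_on S F \<and> bounded (F ` S)"
      using continuous_on_subset bounded_subset by (metis image_mono subset_UNIV)
    then show "(\<lambda>k. \<integral>\<omega>. F (Wk k \<omega>) \<partial>M) \<longlonglongrightarrow> (\<integral>\<omega>. F (W \<omega>) \<partial>M)"
      using L unfolding conv_in_law_def by blast
  qed
next
  assume L: "conv_in_law M UNIV Wk W"
  show "conv_in_law M S Wk W"
    unfolding conv_in_law_def
  proof (intro allI impI)
    fix F :: "'b \<Rightarrow> real" assume F: "continuous_on S F \<and> bounded (F ` S)"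
    have "continuous_on UNIV (\<lambda>x. F (r x))"
      using F r by (intro continuous_on_compose2[of S F UNIV r]) auto
    moreover have "bounded (range (\<lambda>x. F (r x)))"
      using F r(2) by (elim conjE bounded_subset) auto
    ultimately have "(\<lambda>k. \<integral>\<omega>. F (r (Wk k \<omega>)) \<partial>M) \<longlonglongrightarrow> (\<integral>\<omega>. F (r (W \<omega>)) \<partial>M)"
      using L unfolding conv_in_law_def by blast
    moreover have "(\<integral>\<omega>. F (r (Wk k \<omega>)) \<partial>M) = (\<integral>\<omega>. F (Wk k \<omega>) \<partial>M)" for k
      by (rule Bochner_Integration.integral_cong) (use r W in auto)
    moreover have "(\<integral>\<omega>. F (r (W \<omega>)) \<partial>M) = (\<integral>\<omega>. F (W \<omega>) \<partial>M)"
      by (rule Bochner_Integration.integral_cong) (use r W in auto)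
    ultimately show "(\<lambda>k. \<integral>\<omega>. F (Wk k \<omega>) \<partial>M) \<longlonglongrightarrow> (\<integral>\<omega>. F (W \<omega>) \<partial>M)" by simp
  qed
qed

definition bl_functions :: "('b::metric_space \<Rightarrow> real) set" where
  "bl_functions = {F. (\<forall>x. \<bar>F x\<bar> \<le> 1) \<and> (\<forall>x y. \<bar>F x - F y\<bar> \<le> dist x y)}"

lemma bl_functions_continuous: "F \<in> bl_functions \<Longrightarrow> continuous_on UNIV F"
  unfolding bl_functions_def continuous_on_iff
  by (auto simp: dist_real_def) (meson le_less_trans)

text \<open>The Pasch-Hausdorff envelope: for bounded \<open>F\<close> and \<open>m \<ge> 0\<close>
  it is the largest \<open>m\<close>-Lipschitz function below \<open>F\<close>.\<close>

definition inf_conv :: "('b::metric_space \<Rightarrow> real) \<Rightarrow> real \<Rightarrow> 'b \<Rightarrow> real" where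
  "inf_conv F m x = (INF y. F y + m * dist x y)"

context
  fixes F :: "'b::metric_space \<Rightarrow> real" and b :: real
  assumes bounded: "\<bar>F x\<bar> \<le> b"
begin

lemma inf_conv_lower: "m \<ge> 0 \<Longrightarrow> inf_conv F m x \<le> F y + m * dist x y"
  unfolding inf_conv_def
proof (rule cINF_lower)
  assume "m \<ge> 0"
  then show "bdd_below (range (\<lambda>y. F y + m * dist x y))"
    using bounded by (intro bdd_belowI2[of _ "- b"]) (smt (verit) mult_nonneg_nonneg zero_le_dist)
qed simp

lemma inf_conv_greatest: "(\<And>y. a \<le> F y + m * dist x y) \<Longrightarrow> a \<le> inf_conv F m x"
  unfolding inf_conv_def by (rule cINF_greatest) auto

lemma inf_conv_le: "m \<ge> 0 \<Longrightarrow> inf_conv F m x \<le> F x"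
  using inf_conv_lower[of m x x] by simp

lemma inf_conv_abs_le:
  assumes "m \<ge> 0" shows "\<bar>inf_conv F m x\<bar> \<le> b"
proof -
  have "- b \<le> inf_conv F m x"
  proof (rule inf_conv_greatest)
    fix y show "- b \<le> F y + m * dist x y"
      using bounded[of y] mult_nonneg_nonneg[OF assms zero_le_dist[of x y]] by linarith
  qed
  moreover have "inf_conv F m x \<le> b" using inf_conv_le[OF assms, of x] bounded[of x] by linarith
  ultimately show ?thesis by linarith
qed

lemma inf_conv_lipschitz:
  assumes "m \<ge> 0" shows "inf_conv F m x - inf_conv F m x' \<le> m * dist x x'"
proof -
  have "inf_conv F m x - m * dist x x' \<le> inf_conv F m x'"
  proof (rule inf_conv_greatest)
    fix y
    have "m * dist x y \<le> m * (dist x x' + dist x' y)"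
      by (intro mult_left_mono assms dist_triangle)
    then show "inf_conv F m x - m * dist x x' \<le> F y + m * dist x' y"
      using inf_conv_lower[OF assms, of x y] by (simp add: distrib_left)
  qed
  then show ?thesis by linarith
qed

text \<open>The divisor dominates both the sup bound \<open>b\<close> and the Lipschitz constant
  \<open>m\<close>; the added 1 keeps it positive.\<close>

lemma inf_conv_scaled_bl:
  assumes "m \<ge> 0" shows "(\<lambda>x. inf_conv F m x / (b + m + 1)) \<in> bl_functions"
proof -
  have b: "b \<ge> 0" using bounded by (meson abs_ge_zero order_trans)
  have "\<bar>inf_conv F m x / (b + m + 1)\<bar> \<le> 1" for x
    using inf_conv_abs_le[OF assms, of x] b assms by (simp add: abs_divide divide_le_eq_1)
  moreover have "\<bar>inf_conv F m x / (b + m + 1) - inf_conv F m y / (b + m + 1)\<bar> \<le> dist x y" for x y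
  proof -
    have "\<bar>inf_conv F m x - inf_conv F m y\<bar> \<le> m * dist x y"
      using inf_conv_lipschitz[OF assms, of x y] inf_conv_lipschitz[OF assms, of y x]
      by (simp add: abs_le_iff dist_commute)
    also have "\<dots> \<le> (b + m + 1) * dist x y"
      using b by (intro mult_right_mono) auto
    finally have "\<bar>inf_conv F m x - inf_conv F m y\<bar> / (b + m + 1) \<le> dist x y"
      using b assms by (simp add: field_simps)
    moreover have "\<bar>b + m + 1\<bar> = b + m + 1" using b assms by simp
    ultimately show ?thesis by (simp add: abs_divide flip: diff_divide_distrib)
  qed
  ultimately show ?thesis by (simp add: bl_functions_def)
qed

text \<open>Near \<open>x\<close> continuity keeps \<open>F y\<close> close to \<open>F x\<close>;
  at distance at least \<open>d\<close> the penalty \<open>m * d\<close> eventually exceeds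
  \<open>2 * b\<close>, the largest possible gain.\<close>

lemma inf_conv_tendsto:
  assumes "continuous_on UNIV F"
  shows "(\<lambda>m. inf_conv F (real m) x) \<longlonglongrightarrow> F x"
proof (rule LIMSEQ_I)
  fix e :: real assume e: "e > 0"
  have "isCont F x" using assms by (simp add: continuous_on_eq_continuous_at)
  then obtain d where d: "d > 0" "\<And>y. dist y x < d \<Longrightarrow> \<bar>F y - F x\<bar> < e / 2"
    using e unfolding continuous_at_eps_delta dist_real_def by (meson half_gt_zero)
  obtain m0 where m0: "real m0 > 2 * b / d" using reals_Archimedean2 by blast
  show "\<exists>no. \<forall>n\<ge>no. norm (inf_conv F (real n) x - F x) < e"
  proof (intro exI allI impI)
    fix n assume "n \<ge> m0"
    have "2 * b < real m0 * d" using m0 d(1) by (simp add: field_simps)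
    also have "\<dots> \<le> real n * d" using \<open>n \<ge> m0\<close> d(1) by (intro mult_right_mono) auto
    finally have n: "real n * d > 2 * b" .
    have "F x - e / 2 \<le> inf_conv F (real n) x"
    proof (rule inf_conv_greatest)
      fix y
      show "F x - e / 2 \<le> F y + real n * dist x y"
      proof (cases "dist y x < d")
        case True
        have "0 \<le> real n * dist x y" by simp
        then show ?thesis using d(2)[OF True] by linarith
      next
        case False
        then have "real n * d \<le> real n * dist x y" by (intro mult_left_mono) (auto simp: dist_commute)
        then show ?thesis using n bounded[of x] bounded[of y] e by linarith
      qed
    qed
    then show "norm (inf_conv F (real n) x - F x) < e"
      using inf_conv_le[of "real n" x] e by simp
  qed
qed

end

lemma (in prob_space) integrable_of_continuous_bounded:
  fixes F :: "'b::topological_space \<Rightarrow> real"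
  assumes "W \<in> borel_measurable M" "continuous_on UNIV F" "\<And>x. \<bar>F x\<bar> \<le> b"
  shows "integrable M (\<lambda>\<omega>. F (W \<omega>))"
  by (rule integrable_const_bound[where B=b])
    (use assms measurable_compose[OF assms(1) borel_measurable_continuous_onI[OF assms(2)]] in auto)

text \<open>The semicontinuous half of a portmanteau argument. A Lipschitz envelope whose integral
  at \<open>W\<close> is within \<open>e / 2\<close> of that of \<open>F\<close> is, up to scaling,
  an admissible test function, and it lies below \<open>F\<close> along the whole sequence.\<close>

lemma (in prob_space) bl_convergence_lower:
  fixes W :: "'a \<Rightarrow> 'b::metric_space" and F :: "'b \<Rightarrow> real"
  assumes W: "\<And>k. Wk k \<in> borel_measurable M" "W \<in> borel_measurable M"
    and conv: "\<And>G. G \<in> bl_functions \<Longrightarrow> (\<lambda>k. \<integral>\<omega>. G (Wk k \<omega>) \<partial>M) \<longlonglongrightarrow> (\<integral>\<omega>. G (W \<omega>) \<partial>M)"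
    and F: "continuous_on UNIV F" "\<And>x. \<bar>F x\<bar> \<le> b" and e: "e > 0"
  shows "eventually (\<lambda>k. (\<integral>\<omega>. F (Wk k \<omega>) \<partial>M) > (\<integral>\<omega>. F (W \<omega>) \<partial>M) - e) sequentially"
proof -
  note [measurable] = W
  have cont: "continuous_on UNIV (inf_conv F (real m))" for m
  proof -
    have "b + real m + 1 \<noteq> 0" using F(2) abs_ge_zero[of "F undefined"] F(2)[of undefined] by linarith
    then show ?thesis
    using continuous_on_mult[OF bl_functions_continuous[OF inf_conv_scaled_bl[OF F(2), of "real m"]]
        continuous_on_const[of UNIV "b + real m + 1"]] by simp
  qed
  have bd: "\<bar>inf_conv F (real m) x\<bar> \<le> b" for m x by (rule inf_conv_abs_le[OF F(2)]) simp
  have int: "integrable M (\<lambda>\<omega>. inf_conv F (real m) (V \<omega>))" "integrable M (\<lambda>\<omega>. F (V \<omega>))"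
    if "V \<in> borel_measurable M" for m V
    using integrable_of_continuous_bounded[OF that cont bd] integrable_of_continuous_bounded[OF that F] by auto
  have "(\<lambda>m. \<integral>\<omega>. inf_conv F (real m) (W \<omega>) \<partial>M) \<longlonglongrightarrow> (\<integral>\<omega>. F (W \<omega>) \<partial>M)"
    by (rule integral_dominated_convergence[where w="\<lambda>_. b"])
      (use inf_conv_tendsto[OF F(2,1)] bd int[OF W(2)] in auto)
  then have "eventually (\<lambda>m. (\<integral>\<omega>. inf_conv F (real m) (W \<omega>) \<partial>M) > (\<integral>\<omega>. F (W \<omega>) \<partial>M) - e / 2) sequentially"
    using e by (intro order_tendstoD) auto
  then obtain m where m: "(\<integral>\<omega>. inf_conv F (real m) (W \<omega>) \<partial>M) > (\<integral>\<omega>. F (W \<omega>) \<partial>M) - e / 2"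
    by (auto simp: eventually_sequentially)
  define c where "c = b + real m + 1"
  have c: "c > 0" using F(2)[of undefined] abs_ge_zero[of "F undefined"] unfolding c_def by linarith
  have "(\<lambda>k. c * (\<integral>\<omega>. inf_conv F (real m) (Wk k \<omega>) / c \<partial>M)) \<longlonglongrightarrow> c * (\<integral>\<omega>. inf_conv F (real m) (W \<omega>) / c \<partial>M)"
    by (intro tendsto_mult tendsto_const conv) (use inf_conv_scaled_bl[OF F(2), of "real m"] in \<open>simp add: c_def\<close>)
  then have "(\<lambda>k. \<integral>\<omega>. inf_conv F (real m) (Wk k \<omega>) \<partial>M) \<longlonglongrightarrow> (\<integral>\<omega>. inf_conv F (real m) (W \<omega>) \<partial>M)"
    using c by simp
  then have "eventually (\<lambda>k. (\<integral>\<omega>. inf_conv F (real m) (Wk k \<omega>) \<partial>M) > (\<integral>\<omega>. inf_conv F (real m) (W \<omega>) \<partial>M) - e / 2) sequentially"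
    using e by (intro order_tendstoD) auto
  then show ?thesis
  proof eventually_elim
    case (elim k)
    have "(\<integral>\<omega>. inf_conv F (real m) (Wk k \<omega>) \<partial>M) \<le> (\<integral>\<omega>. F (Wk k \<omega>) \<partial>M)"
      by (rule integral_mono) (use int[OF W(1)] inf_conv_le[OF F(2), of "real m"] in auto)
    with elim m show ?case by linarith
  qed
qed

text \<open>The lower bound for \<open>F\<close> and for \<open>- F\<close> squeezes the
  limit.\<close>

lemma (in prob_space) conv_in_law_of_bl:
  fixes W :: "'a \<Rightarrow> 'b::metric_space"
  assumes W: "\<And>k. Wk k \<in> borel_measurable M" "W \<in> borel_measurable M"
    and conv: "\<And>G. G \<in> bl_functions \<Longrightarrow> (\<lambda>k. \<integral>\<omega>. G (Wk k \<omega>) \<partial>M) \<longlonglongrightarrow> (\<integral>\<omega>. G (W \<omega>) \<partial>M)"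
  shows "conv_in_law M UNIV Wk W"
  unfolding conv_in_law_def
proof (intro allI impI)
  fix F :: "'b \<Rightarrow> real" assume F: "continuous_on UNIV F \<and> bounded (range F)"
  then obtain b where b: "\<And>x. \<bar>F x\<bar> \<le> b" by (auto simp: bounded_iff)
  show "(\<lambda>k. \<integral>\<omega>. F (Wk k \<omega>) \<partial>M) \<longlonglongrightarrow> (\<integral>\<omega>. F (W \<omega>) \<partial>M)"
  proof (rule order_tendstoI)
    fix a assume "a < (\<integral>\<omega>. F (W \<omega>) \<partial>M)"
    then show "eventually (\<lambda>k. a < (\<integral>\<omega>. F (Wk k \<omega>) \<partial>M)) sequentially"
      using bl_convergence_lower[OF W conv conjunct1[OF F] b, of "(\<integral>\<omega>. F (W \<omega>) \<partial>M) - a"] by simp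
  next
    fix a assume a: "(\<integral>\<omega>. F (W \<omega>) \<partial>M) < a"
    have "continuous_on UNIV (\<lambda>x. - F x)" using F by (intro continuous_intros) auto
    from bl_convergence_lower[OF W conv this, of b "a - (\<integral>\<omega>. F (W \<omega>) \<partial>M)"] a b
    show "eventually (\<lambda>k. (\<integral>\<omega>. F (Wk k \<omega>) \<partial>M) < a) sequentially" by simp
  qed
qed

text \<open>Off \<open>A\<close> the Lipschitz bound applies; on \<open>A\<close> two values in
  \<open>[-1, 1]\<close> differ by at most 2.\<close>

lemma (in prob_space) bl_coupling:
  fixes W W' :: "'a \<Rightarrow> 'b::metric_space"
  assumes F: "F \<in> bl_functions" and W: "W \<in> borel_measurable M" "W' \<in> borel_measurable M"
    and A: "A \<in> events" and e: "e \<ge> 0"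
    and d: "\<And>\<omega>. \<omega> \<in> space M \<Longrightarrow> \<omega> \<notin> A \<Longrightarrow> dist (W \<omega>) (W' \<omega>) \<le> e"
  shows "\<bar>(\<integral>\<omega>. F (W \<omega>) \<partial>M) - (\<integral>\<omega>. F (W' \<omega>) \<partial>M)\<bar> \<le> e + 2 * prob A"
proof -
  have F1: "\<bar>F x\<bar> \<le> 1" and F2: "\<bar>F x - F y\<bar> \<le> dist x y" for x y
    using F by (auto simp: bl_functions_def)
  have i: "integrable M (\<lambda>\<omega>. F (W \<omega>))" "integrable M (\<lambda>\<omega>. F (W' \<omega>))"
    using integrable_of_continuous_bounded[OF _ bl_functions_continuous[OF F] F1] W by auto
  have iA: "integrable M (\<lambda>\<omega>. 2 * indicator A \<omega> :: real)"
    using A by (auto intro!: integrable_real_indicator simp: emeasure_eq_measure)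
  have "\<bar>(\<integral>\<omega>. F (W \<omega>) \<partial>M) - (\<integral>\<omega>. F (W' \<omega>) \<partial>M)\<bar> = \<bar>\<integral>\<omega>. F (W \<omega>) - F (W' \<omega>) \<partial>M\<bar>" using i by simp
  also have "\<dots> \<le> (\<integral>\<omega>. \<bar>F (W \<omega>) - F (W' \<omega>)\<bar> \<partial>M)" by (rule integral_abs_bound)
  also have "\<dots> \<le> (\<integral>\<omega>. e + 2 * indicator A \<omega> \<partial>M)"
  proof (rule integral_mono)
    fix \<omega> assume "\<omega> \<in> space M"
    then show "\<bar>F (W \<omega>) - F (W' \<omega>)\<bar> \<le> e + 2 * indicator A \<omega>"
      using F2[of "W \<omega>" "W' \<omega>"] F1[of "W \<omega>"] F1[of "W' \<omega>"] d[of \<omega>] e by (cases "\<omega> \<in> A") auto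
  qed (use i iA in auto)
  also have "\<dots> = e + 2 * prob A"
    using iA A by (simp add: prob_space sets.Int_space_eq2)
  finally show ?thesis .
qed

section \<open>Product metrics, quantisation and truncation\<close>

text \<open>The metric on functions weights the coordinates by \<open>(1/2)^n\<close>, and these
  weights sum to 2.\<close>

lemma dist_fun_le:
  fixes x y :: "'i::countable \<Rightarrow> 'b::metric_space"
  assumes "\<And>i. dist (x i) (y i) \<le> e"
  shows "dist x y \<le> 2 * e"
proof -
  have g: "summable (\<lambda>n. (1/2::real)^n)" by (rule summable_geometric) auto
  have e: "e \<ge> 0" using assms zero_le_dist order_trans by blast
  have le: "(1/2)^n * min (dist (x (from_nat n)) (y (from_nat n))) 1 \<le> (1/2)^n * e" for n
    using assms[of "from_nat n"] by (intro mult_left_mono) auto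
  have "dist x y \<le> (\<Sum>n. (1/2)^n * e)"
    unfolding dist_fun_def
  proof (rule suminf_le)
    show "summable (\<lambda>n. (1/2)^n * e)" using g by (rule summable_mult2)
    then show "summable (\<lambda>n. (1/2)^n * min (dist (x (from_nat n)) (y (from_nat n))) 1)"
      by (rule summable_comparison_test'[where N=0]) (use le in auto)
  qed (rule le)
  also have "\<dots> = 2 * e" by (simp add: suminf_mult2[OF g, symmetric] suminf_geometric)
  finally show ?thesis .
qed

lemma dist_prod_le: "dist (a, b) (c, d) \<le> dist a c + dist b d"
  unfolding dist_Pair_Pair by (rule sqrt_sum_squares_le_sum) auto

text \<open>The cell of a point is the least index of a close enough member of a dense sequence.
  Separating the index \<open>q w\<close> from the point \<open>x (q w)\<close> lets the later
  combinatorics run on integers.\<close>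

lemma ex_countable_quantizer:
  assumes "e > 0"
  shows "\<exists>x (q :: 'w::{metric_space, second_countable_topology} \<Rightarrow> nat).
    q \<in> measurable borel (count_space UNIV) \<and> (\<forall>w. dist w (x (q w)) < e)"
proof -
  obtain D :: "'w set" where D: "countable D" "\<And>X. open X \<Longrightarrow> X \<noteq> {} \<Longrightarrow> \<exists>d\<in>D. d \<in> X"
    using countable_dense_setE by blast
  have "D \<noteq> {}" using D(2)[OF open_UNIV] by auto
  define x where "x = from_nat_into D"
  have ex: "\<exists>i. dist w (x i) < e" for w
  proof -
    obtain d where "d \<in> D" "d \<in> ball w e" using D(2)[OF open_ball, of w e] assms by auto
    then show ?thesis using from_nat_into_surj[OF D(1)] by (auto simp: x_def)
  qed
  define q where "q w = (LEAST i. dist w (x i) < e)" for w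
  have "q \<in> measurable borel (count_space UNIV)" unfolding q_def by measurable
  moreover have "dist w (x (q w)) < e" for w unfolding q_def by (rule LeastI_ex[OF ex])
  ultimately show ?thesis by blast
qed

lemma (in prob_space) prob_tail_less:
  fixes c :: "'a \<Rightarrow> nat"
  assumes c [measurable]: "c \<in> measurable M (count_space UNIV)" and "e > 0"
  shows "eventually (\<lambda>R. prob {\<omega>\<in>space M. R \<le> c \<omega>} < e) sequentially"
proof -
  have "(\<lambda>R. prob {\<omega>\<in>space M. R \<le> c \<omega>}) \<longlonglongrightarrow> prob (\<Inter>R. {\<omega>\<in>space M. R \<le> c \<omega>})"
    by (rule finite_Lim_measure_decseq) (auto simp: decseq_def)
  moreover have "(\<Inter>R. {\<omega>\<in>space M. R \<le> c \<omega>}) = {}" by auto (meson Suc_n_not_le_n)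
  ultimately show ?thesis using assms(2) by (auto dest!: order_tendstoD(2))
qed

section \<open>Continuous realisation of finitely many values\<close>

text \<open>Paths between consecutive points are glued end to end, so that an integer index read as
  a real parameter gives the prescribed point.\<close>

lemma path_connected_interpolation:
  fixes x :: "nat \<Rightarrow> 'x::topological_space"
  assumes pc: "path_connected (UNIV :: 'x set)"
  shows "\<exists>p :: real \<Rightarrow> 'x. continuous_on UNIV p \<and> (\<forall>i\<le>R. p (real i) = x i)"
proof (induction R)
  case 0
  show ?case by (intro exI[of _ "\<lambda>_. x 0"]) auto
next
  case (Suc R)
  then obtain p where p: "continuous_on UNIV p" "\<And>i. i \<le> R \<Longrightarrow> p (real i) = x i" by blast
  obtain g where g: "path g" "pathstart g = x R" "pathfinish g = x (Suc R)"
    using pc unfolding path_connected_def by blast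
  \<comment> \<open>A path is continuous on \<open>{0..1}\<close> by definition; clamping its
    parameter makes it continuous on the whole line.\<close>
  let ?h = "\<lambda>t. g (max 0 (min 1 (t - real R)))"
  have h: "continuous_on UNIV ?h"
    using g(1) unfolding path_def
    by (intro continuous_on_compose2[of "{0..1}" g UNIV] continuous_intros) auto
  define q where "q t = (if t \<le> real R then p t else ?h t)" for t
  have "continuous_on UNIV q"
    unfolding q_def
    by (rule continuous_on_cases_le)
      (use p h g in \<open>auto simp: pathstart_def intro: continuous_on_subset\<close>)
  moreover have "q (real i) = x i" if "i \<le> Suc R" for i
    using that p g by (auto simp: q_def pathfinish_def le_Suc_eq)
  ultimately show ?case by blast
qed

lemma path_connected_convex_tvs:
  fixes C :: "'v::{real_vector, t2_space} set"
  assumes "locally_convex_tvs TYPE('v)" "convex C"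
  shows "path_connected C"
  unfolding path_connected_def
proof (intro ballI)
  fix a b assume ab: "a \<in> C" "b \<in> C"
  have s: "continuous_on UNIV (\<lambda>p::real \<times> 'v. fst p *\<^sub>R snd p)"
    and p: "continuous_on UNIV (\<lambda>p::'v \<times> 'v. fst p + snd p)"
    using assms(1) unfolding locally_convex_tvs_def by blast+
  have sc: "continuous_on UNIV (\<lambda>t. u t *\<^sub>R v)" if "continuous_on UNIV u" for u :: "real \<Rightarrow> real" and v :: 'v
    using continuous_on_compose2[OF s continuous_on_Pair[OF that continuous_on_const[of _ v]]] by simp
  have "continuous_on UNIV (\<lambda>t. ((1 - t) *\<^sub>R a, t *\<^sub>R b))"
    by (intro continuous_on_Pair sc continuous_intros)
  then have "continuous_on UNIV (\<lambda>t::real. (1 - t) *\<^sub>R a + t *\<^sub>R b)"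
    using continuous_on_compose2[OF p, of UNIV "\<lambda>t. ((1 - t) *\<^sub>R a, t *\<^sub>R b)"] by auto
  then have "path (\<lambda>t. (1 - t) *\<^sub>R a + t *\<^sub>R b)"
    unfolding path_def by (rule continuous_on_subset) simp
  moreover have "path_image (\<lambda>t. (1 - t) *\<^sub>R a + t *\<^sub>R b) \<subseteq> C"
    using assms(2) ab by (auto simp: path_image_def convex_def)
  ultimately show "\<exists>g. path g \<and> path_image g \<subseteq> C \<and> pathstart g = a \<and> pathfinish g = b"
    by (intro exI[of _ "\<lambda>t. (1 - t) *\<^sub>R a + t *\<^sub>R b"]) (auto simp: pathstart_def pathfinish_def)
qed

lemma inner_regular_compact:
  fixes \<mu> :: "'t::polish_space measure"
  assumes "finite_measure \<mu>" "sets \<mu> = sets borel" "B \<in> sets borel" "e > 0"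
  shows "\<exists>K. K \<subseteq> B \<and> compact K \<and> measure \<mu> B < measure \<mu> K + e"
proof (rule ccontr)
  interpret finite_measure \<mu> by fact
  assume no: "\<not> ?thesis"
  then have K: "measure \<mu> K \<le> measure \<mu> B - e" if "K \<subseteq> B" "compact K" for K
    using that by force
  have "emeasure \<mu> B = (SUP K\<in>{K. K \<subseteq> B \<and> compact K}. emeasure \<mu> K)"
    by (rule inner_regular) (use assms in auto)
  also have "\<dots> \<le> ennreal (measure \<mu> B - e)"
    by (rule SUP_least) (use K in \<open>auto simp: emeasure_eq_measure intro!: ennreal_leI\<close>)
  \<comment> \<open>The empty compact set shows \<open>measure \<mu> B - e \<ge> 0\<close>, so
    \<open>ennreal\<close> truncates nothing.\<close>
  finally have "measure \<mu> B \<le> measure \<mu> B - e"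
    using K[of "{}"] by (simp add: emeasure_eq_measure)
  then show False using assms(4) by simp
qed

text \<open>A function with finitely many values is locally constant on a disjoint union of compact sets
  of almost full measure. Tietze extends the index of the value to a real function, which a path
  through the values turns into a continuous function; no Dugundji extension into the convex set
  is needed.\<close>

lemma (in prob_space) continuous_approx_finite_valued:
  fixes V :: "'a \<Rightarrow> 't::polish_space" and x :: "nat \<Rightarrow> 'x::topological_space"
  assumes pc: "path_connected (UNIV :: 'x set)"
    and V: "V \<in> borel_measurable M"
    and c: "c \<in> measurable (vimage_algebra (space M) V borel) (count_space UNIV)" "\<And>\<omega>. c \<omega> < (R::nat)"
    and e: "e > 0"
  shows "\<exists>(f :: 't \<Rightarrow> 'x) A. continuous_on UNIV f \<and> A \<in> events \<and> prob A < e \<and>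
    (\<forall>\<omega>\<in>space M. \<omega> \<notin> A \<longrightarrow> f (V \<omega>) = x (c \<omega>))"
proof -
  let ?\<mu> = "distr M borel V"
  have fin: "finite_measure ?\<mu>" by (rule finite_measure_distr[OF V])
  have "\<exists>E. E \<in> sets borel \<and> c -` {i} \<inter> space M = V -` E \<inter> space M" for i
    using measurable_sets[OF c(1), of "{i}"] by (auto simp: sets_vimage_algebra2)
  then obtain E where E: "\<And>i. E i \<in> sets borel" "\<And>i. c -` {i} \<inter> space M = V -` E i \<inter> space M"
    by metis
  \<comment> \<open>The sets \<open>E i\<close> are disjoint along the range of \<open>V\<close>;
    \<open>disjointed\<close> makes them disjoint in the whole target space, so that the index
    \<open>u\<close> is well defined on the compact sets below.\<close>
  define B where "B = disjointed E"
  have B: "B i \<in> sets borel" for i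
    using sets.range_disjointed_sets[of E borel] E(1) by (auto simp: B_def)
  have cE: "V \<omega> \<in> E i \<longleftrightarrow> c \<omega> = i" if "\<omega> \<in> space M" for \<omega> i using E(2)[of i] that by auto
  have cB: "V \<omega> \<in> B i \<longleftrightarrow> c \<omega> = i" if "\<omega> \<in> space M" for \<omega> i
    using cE[OF that] by (auto simp: B_def disjointed_def)
  have R: "R > 0" using c(2)[of undefined] by simp
  \<comment> \<open>Each of the \<open>R\<close> sets loses at most \<open>d\<close>; the factor 2
    makes the total loss strictly less than \<open>e\<close>.\<close>
  define d where "d = e / (2 * R)"
  have d: "d > 0" "R * d < e" using e R by (auto simp: d_def)
  have "\<exists>K. K \<subseteq> B i \<and> compact K \<and> measure ?\<mu> (B i) < measure ?\<mu> K + d" for i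
    by (rule inner_regular_compact) (use fin B d in auto)
  then obtain K where K: "\<And>i. K i \<subseteq> B i" "\<And>i. compact (K i)" "\<And>i. measure ?\<mu> (B i) < measure ?\<mu> (K i) + d"
    by metis
  have Kb: "K i \<in> sets borel" for i using K(2) by (intro borel_closed compact_imp_closed)
  have disj: "i = j" if "t \<in> K i" "t \<in> K j" for i j t
    using that K(1) disjoint_family_disjointed[of E] unfolding B_def disjoint_family_on_def by blast
  define u :: "'t \<Rightarrow> real" where "u t = real (SOME i. t \<in> K i)" for t
  have u: "u t = real i" if "t \<in> K i" for t i
    unfolding u_def using disj[OF that] that by (metis someI_ex)
  define S where "S = (\<Union>i\<in>{..<R}. K i)"
  have "continuous_on S u"
    unfolding S_def
  proof (rule continuous_on_closed_Union)
    show "continuous_on (K i) u" for i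
      by (rule continuous_on_eq[OF continuous_on_const[of _ "real i"]]) (use u in auto)
  qed (use K(2) compact_imp_closed in auto)
  moreover have "closed S" unfolding S_def using K(2) compact_imp_closed by auto
  \<comment> \<open>Off \<open>S\<close> the extension may take any real value, which is why the
    path composed with it is defined on the whole line.\<close>
  ultimately obtain g where g: "continuous_on UNIV g" "\<And>t. t \<in> S \<Longrightarrow> g t = u t"
    using Tietze_unbounded[of S u UNIV] by auto
  obtain p where p: "continuous_on UNIV p" "\<And>i. i \<le> R \<Longrightarrow> p (real i) = x i"
    using path_connected_interpolation[OF pc, of R x] by blast
  define A where "A = (\<Union>i\<in>{..<R}. V -` (B i - K i) \<inter> space M)"
  have As: "V -` (B i - K i) \<inter> space M \<in> events" for i
    using V B Kb by (intro measurable_sets[where A=borel]) auto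
  have "prob A \<le> (\<Sum>i<R. prob (V -` (B i - K i) \<inter> space M))"
    unfolding A_def using As by (intro finite_measure_subadditive_finite) auto
  also have "\<dots> \<le> (\<Sum>i<R. d)"
  proof (rule sum_mono)
    fix i
    have "prob (V -` (B i - K i) \<inter> space M) = measure ?\<mu> (B i - K i)"
      using V B Kb by (subst measure_distr) auto
    also have "\<dots> = measure ?\<mu> (B i) - measure ?\<mu> (K i)"
      using B Kb K(1) by (intro finite_measure.finite_measure_Diff[OF fin]) auto
    finally show "prob (V -` (B i - K i) \<inter> space M) \<le> d" using K(3)[of i] by linarith
  qed
  also have "\<dots> < e" using d by simp
  finally have "prob A < e" .
  moreover have "A \<in> events" unfolding A_def using As by blast
  moreover have "continuous_on UNIV (\<lambda>t. p (g t))"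
    using continuous_on_compose2[OF p(1) g(1)] by simp
  moreover have "p (g (V \<omega>)) = x (c \<omega>)" if "\<omega> \<in> space M" "\<omega> \<notin> A" for \<omega>
  proof -
    have "V \<omega> \<in> K (c \<omega>)" using that c(2)[of \<omega>] cB[OF that(1), of "c \<omega>"] by (auto simp: A_def)
    then have "g (V \<omega>) = real (c \<omega>)" using g(2)[of "V \<omega>"] u c(2)[of \<omega>] by (auto simp: S_def)
    then show ?thesis using p(2)[of "c \<omega>"] c(2)[of \<omega>] by simp
  qed
  ultimately show ?thesis by (intro exI[of _ "\<lambda>t. p (g t)"] exI[of _ A]) auto
qed

section \<open>Stable convergence implies conditional independence\<close>

text \<open>Relates the product sigma-algebra on \<open>{1..n}\<close> to the Borel sigma-algebra of
  the full function space, where the topological lemmas work. A restricted function is constant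
  outside \<open>{1..n}\<close>, and by second countability coordinatewise measurability gives Borel
  measurability.\<close>

lemma sets_nat_filt:
  fixes X :: "nat \<Rightarrow> 'a \<Rightarrow> 'b::second_countable_topology"
  shows "sets (nat_filt M X n) = sets (vimage_algebra (space M) (\<lambda>\<omega>. restrict (\<lambda>i. X i \<omega>) {1..n}) borel)"
    (is "_ = sets (vimage_algebra _ ?V _)")
proof (rule antisym)
  have r: "(\<lambda>f. restrict f {1..n}) \<in> measurable borel (Pi\<^sub>M {1..n} (\<lambda>_. borel :: 'b measure))"
    using measurable_restrict_subset[of "{1..n}" UNIV "\<lambda>_. borel :: 'b measure"]
    by (simp add: measurable_cong_sets[OF sets_PiM_equal_borel refl])
  show "sets (nat_filt M X n) \<subseteq> sets (vimage_algebra (space M) ?V borel)"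
  proof
    fix A assume "A \<in> sets (nat_filt M X n)"
    then obtain E where E: "E \<in> sets (Pi\<^sub>M {1..n} (\<lambda>_. borel :: 'b measure))" "A = ?V -` E \<inter> space M"
      unfolding nat_filt_def by (subst (asm) sets_vimage_algebra2) (auto simp: space_PiM)
    have "(\<lambda>f. restrict f {1..n}) -` E \<in> sets borel" using measurable_sets[OF r E(1)] by simp
    moreover have "A = ?V -` ((\<lambda>f. restrict f {1..n}) -` E) \<inter> space M" unfolding E(2) by auto
    ultimately show "A \<in> sets (vimage_algebra (space M) ?V borel)" by (auto simp: sets_vimage_algebra2)
  qed
  have V: "?V \<in> measurable (nat_filt M X n) (Pi\<^sub>M {1..n} (\<lambda>_. borel))"
    unfolding nat_filt_def by (rule measurable_vimage_algebra1) (auto simp: space_PiM)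
  have Vb: "?V \<in> borel_measurable (nat_filt M X n)"
  proof (rule measurable_coordinatewise_then_product)
    fix i
    show "(\<lambda>\<omega>. ?V \<omega> i) \<in> borel_measurable (nat_filt M X n)"
    proof (cases "i \<in> {1..n}")
      case True
      then show ?thesis by (rule measurable_compose[OF V measurable_component_singleton])
    qed auto
  qed
  have "space (nat_filt M X n) = space M" by (simp add: nat_filt_def)
  then show "sets (vimage_algebra (space M) ?V borel) \<subseteq> sets (nat_filt M X n)"
    using measurable_sets[OF Vb] by (auto simp: sets_vimage_algebra2)
qed

text \<open>The empty set is treated apart because \<open>infdist w {}\<close> is 0 by convention,
  which would give the constant 1.\<close>

definition closed_bump :: "'w::metric_space set \<Rightarrow> nat \<Rightarrow> 'w \<Rightarrow> real" where
  "closed_bump C m w = (if C = {} then 0 else max 0 (1 - real m * infdist w C))"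

lemma closed_bump_bounds: "0 \<le> closed_bump C m w" "closed_bump C m w \<le> 1"
  by (auto simp: closed_bump_def infdist_nonneg)

lemma closed_bump_continuous: "continuous_on UNIV (closed_bump C m)"
proof (cases "C = {}")
  case False
  then have "closed_bump C m = (\<lambda>w. max 0 (1 - real m * infdist w C))" by (auto simp: closed_bump_def)
  then show ?thesis by (simp, intro continuous_intros)
qed (simp add: closed_bump_def)

lemma closed_bump_tendsto:
  assumes "closed C"
  shows "(\<lambda>m. closed_bump C m w) \<longlonglongrightarrow> indicator C w"
proof (cases "w \<in> C")
  case True
  then have "C \<noteq> {}" by auto
  then show ?thesis using True by (simp add: closed_bump_def)
next
  case False
  show ?thesis
  proof (cases "C = {}")
    case ne: False
    have d: "infdist w C > 0"
      using in_closed_iff_infdist_zero[OF assms ne] False infdist_nonneg[of w C] by force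
    obtain m0 where m0: "real m0 > 1 / infdist w C" using reals_Archimedean2 by blast
    have "closed_bump C m w = 0" if "m \<ge> m0" for m
    proof -
      have "1 < real m0 * infdist w C" using m0 d by (simp add: field_simps)
      also have "\<dots> \<le> real m * infdist w C" using that d by (intro mult_right_mono) auto
      finally show ?thesis using ne by (simp add: closed_bump_def)
    qed
    then show ?thesis using False by (auto intro!: tendsto_eventually eventually_sequentiallyI)
  qed (simp add: closed_bump_def)
qed

lemma vimage_algebra_borel_closed:
  "sets (vimage_algebra S W borel) = sigma_sets S {W -` C \<inter> S | C. C \<in> Collect closed}"
  unfolding borel_eq_closed
  by (subst vimage_algebra_sigma, simp, simp, rule sets_measure_of) auto

lemma Int_stable_vimage_closed: "Int_stable {W -` C \<inter> S | C. C \<in> Collect closed}"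
proof (rule Int_stableI)
  fix a b assume "a \<in> {W -` C \<inter> S | C. C \<in> Collect closed}" "b \<in> {W -` C \<inter> S | C. C \<in> Collect closed}"
  then obtain x y where "a = W -` x \<inter> S" "b = W -` y \<inter> S" "closed x" "closed y" by auto
  then have "a \<inter> b = W -` (x \<inter> y) \<inter> S" "closed (x \<inter> y)" by auto
  then show "a \<inter> b \<in> {W -` C \<inter> S | C. C \<in> Collect closed}" by blast
qed

lemma subalgebra_vimage_algebra:
  assumes "W \<in> measurable M N" shows "subalgebra M (vimage_algebra (space M) W N)"
  unfolding subalgebra_def using sets_image_in_sets[OF refl assms] by simp

text \<open>Since \<open>Z\<close> does not depend on \<open>k\<close>, approximating \<open>f\<close> by continuous functions of \<open>Z\<close> in
  \<open>L\<^sup>1\<close> costs an error that is uniform in \<open>k\<close>.\<close>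

lemma (in prob_space) stable_convergence:
  fixes Z :: "'a \<Rightarrow> 'z::metric_space" and W :: "'a \<Rightarrow> 'w::metric_space" and g :: "'w \<Rightarrow> real"
  assumes Z: "Z \<in> borel_measurable M" and W: "\<And>k. Wk k \<in> borel_measurable M" "W \<in> borel_measurable M"
    and conv: "conv_in_law M UNIV (\<lambda>k \<omega>. (Z \<omega>, Wk k \<omega>)) (\<lambda>\<omega>. (Z \<omega>, W \<omega>))"
    and g: "continuous_on UNIV g" "\<And>w. \<bar>g w\<bar> \<le> 1"
    and f: "integrable M f" "f \<in> borel_measurable (vimage_algebra (space M) Z borel)"
  shows "(\<lambda>k. \<integral>\<omega>. g (Wk k \<omega>) * f \<omega> \<partial>M) \<longlonglongrightarrow> (\<integral>\<omega>. g (W \<omega>) * f \<omega> \<partial>M)"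
proof -
  have gm [measurable]: "g \<in> borel_measurable borel" by (rule borel_measurable_continuous_onI[OF g(1)])
  note [measurable] = W Z
  have prod: "(\<lambda>k. \<integral>\<omega>. g (Wk k \<omega>) * h (Z \<omega>) \<partial>M) \<longlonglongrightarrow> (\<integral>\<omega>. g (W \<omega>) * h (Z \<omega>) \<partial>M)"
    if h: "continuous_on UNIV h" "\<And>z. \<bar>h z\<bar> \<le> 1" for h :: "'z \<Rightarrow> real"
  proof -
    let ?F = "\<lambda>p. g (snd p) * h (fst p)"
    have "continuous_on UNIV ?F"
      by (intro continuous_on_mult continuous_on_compose2[OF g(1)] continuous_on_compose2[OF h(1)]
          continuous_on_snd continuous_on_fst continuous_on_id) auto
    moreover have "bounded (range ?F)"
      unfolding bounded_iff using g(2) h(2)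
      by (intro exI[of _ 1]) (auto simp: abs_mult intro!: mult_le_one)
    ultimately have "(\<lambda>k. \<integral>\<omega>. ?F (Z \<omega>, Wk k \<omega>) \<partial>M) \<longlonglongrightarrow> (\<integral>\<omega>. ?F (Z \<omega>, W \<omega>) \<partial>M)"
      using conv unfolding conv_in_law_def by blast
    then show ?thesis by simp
  qed
  show ?thesis
  proof (rule weak_limit_of_generator[OF subalgebra_vimage_algebra[OF Z] vimage_algebra_borel_closed _
        Int_stable_vimage_closed, where b=1])
    show "(\<lambda>k. \<integral>\<omega>. g (Wk k \<omega>) \<partial>M) \<longlonglongrightarrow> (\<integral>\<omega>. g (W \<omega>) \<partial>M)"
      using prod[of "\<lambda>_. 1"] by simp
    fix A assume "A \<in> {Z -` C \<inter> space M | C. C \<in> Collect closed}"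
    then obtain C where C: "closed C" "A = Z -` C \<inter> space M" by auto
    have [measurable]: "closed_bump C m \<in> borel_measurable borel" for m
      by (rule borel_measurable_continuous_onI[OF closed_bump_continuous])
    have AM [measurable]: "A \<in> events" unfolding C using Z C(1) by measurable
    have bump_abs: "\<bar>closed_bump C m z\<bar> \<le> 1" for m z using closed_bump_bounds[of C m z] by simp
    show "(\<lambda>k. \<integral>\<omega>. g (Wk k \<omega>) * indicator A \<omega> \<partial>M) \<longlonglongrightarrow> (\<integral>\<omega>. g (W \<omega>) * indicator A \<omega> \<partial>M)"
    proof (rule weak_limit_L1_closed[where b=1 and s="\<lambda>m \<omega>. closed_bump C m (Z \<omega>)"])
      show "integrable M (\<lambda>\<omega>. closed_bump C m (Z \<omega>))" for m
        by (rule integrable_of_continuous_bounded[OF Z closed_bump_continuous bump_abs])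
      show "(\<lambda>k. \<integral>\<omega>. g (Wk k \<omega>) * closed_bump C i (Z \<omega>) \<partial>M) \<longlonglongrightarrow> (\<integral>\<omega>. g (W \<omega>) * closed_bump C i (Z \<omega>) \<partial>M)" for i
        by (rule prod[OF closed_bump_continuous bump_abs])
      show "integrable M (\<lambda>\<omega>. indicator A \<omega> :: real)"
        by (auto intro!: integrable_real_indicator simp: emeasure_eq_measure)
      have "(\<lambda>i. \<integral>\<omega>. \<bar>indicator A \<omega> - closed_bump C i (Z \<omega>)\<bar> \<partial>M) \<longlonglongrightarrow> (\<integral>\<omega>. 0 \<partial>M)"
      proof (rule integral_dominated_convergence[where w="\<lambda>_. 1"])
        show "AE \<omega> in M. (\<lambda>i. \<bar>indicator A \<omega> - closed_bump C i (Z \<omega>)\<bar>) \<longlonglongrightarrow> 0"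
        proof (rule AE_I2)
          fix \<omega> assume "\<omega> \<in> space M"
          then have "indicator A \<omega> = (indicator C (Z \<omega>) :: real)" by (auto simp: C indicator_def)
          moreover have "(\<lambda>i. \<bar>indicator C (Z \<omega>) - closed_bump C i (Z \<omega>)\<bar>) \<longlonglongrightarrow> \<bar>indicator C (Z \<omega>) - indicator C (Z \<omega>) :: real\<bar>"
            by (intro tendsto_intros closed_bump_tendsto C)
          ultimately show "(\<lambda>i. \<bar>indicator A \<omega> - closed_bump C i (Z \<omega>)\<bar>) \<longlonglongrightarrow> 0" by simp
        qed
        show "AE \<omega> in M. norm \<bar>indicator A \<omega> - closed_bump C i (Z \<omega>)\<bar> \<le> 1" for i
        proof (rule AE_I2)
          fix \<omega>
          show "norm \<bar>indicator A \<omega> - closed_bump C i (Z \<omega>)\<bar> \<le> 1"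
            using closed_bump_bounds[of C i "Z \<omega>"] by (auto simp: indicator_def)
        qed
      qed auto
      then show "(\<lambda>i. \<integral>\<omega>. \<bar>indicator A \<omega> - closed_bump C i (Z \<omega>)\<bar> \<partial>M) \<longlonglongrightarrow> 0" by simp
    qed (use g in auto)
  qed (use g f in auto)
qed

text \<open>The hypothesis tests against \<open>A\<close> alone. The extra set \<open>D\<close> of
  \<open>G\<close> that characterises a conditional expectation is absorbed into
  \<open>B\<close>.\<close>

lemma (in prob_space) cond_indep_of_integral_eq:
  assumes F: "subalgebra M F" and H: "subalgebra M H" and G: "subalgebra H G"
    and eq: "\<And>A B. A \<in> sets F \<Longrightarrow> B \<in> sets H \<Longrightarrow>
      (\<integral>\<omega>. indicator B \<omega> * indicator A \<omega> \<partial>M) = (\<integral>\<omega>. real_cond_exp M G (indicator B) \<omega> * indicator A \<omega> \<partial>M)"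
  shows "cond_indep M F H G"
  unfolding cond_indep_def
proof (intro ballI)
  fix A B assume A: "A \<in> sets F" and B: "B \<in> sets H"
  have MG: "subalgebra M G" using H G by (auto simp: subalgebra_def)
  interpret G: finite_measure_subalgebra M G by unfold_locales (rule MG)
  have [measurable]: "A \<in> events" "B \<in> events" using A B F H by (auto simp: subalgebra_def)
  have int: "integrable M (indicator D :: 'a \<Rightarrow> real)" if "D \<in> events" for D
    using that by (auto intro!: integrable_real_indicator simp: emeasure_eq_measure)
  let ?a = "real_cond_exp M G (indicator A)" and ?b = "real_cond_exp M G (indicator B)"
  have bG [measurable]: "?b \<in> borel_measurable G" by simp
  have bint: "integrable M (\<lambda>\<omega>. ?b \<omega> * indicator A \<omega>)"
    using integrable_mult_indicator[of A M ?b] G.real_cond_exp_int(1)[OF int[of B]] by (simp add: mult.commute)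
  show "AE \<omega> in M. real_cond_exp M G (indicator (A \<inter> B)) \<omega> = ?a \<omega> * ?b \<omega>"
  proof (rule G.real_cond_exp_charact)
    fix D assume D [measurable]: "D \<in> sets G"
    have DH: "D \<in> sets H" using D G by (auto simp: subalgebra_def)
    have DM [measurable]: "D \<in> events" using DH H by (auto simp: subalgebra_def)
    \<comment> \<open>\<open>B \<inter> D\<close> lies in \<open>H\<close> because \<open>G\<close>
      is a subalgebra of \<open>H\<close>, so \<open>eq\<close> applies to it; then \<open>D\<close>
      is pulled out of the conditional expectation given \<open>G\<close>.\<close>
    have "(\<integral>\<omega>\<in>D. indicator (A \<inter> B) \<omega> \<partial>M) = (\<integral>\<omega>. indicat_real (B \<inter> D) \<omega> * indicator A \<omega> \<partial>M)"
      unfolding set_lebesgue_integral_def by (intro Bochner_Integration.integral_cong) (auto simp: indicator_def)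
    also have "\<dots> = (\<integral>\<omega>. real_cond_exp M G (indicator (B \<inter> D)) \<omega> * indicator A \<omega> \<partial>M)"
      by (rule eq[OF A]) (use B DH in auto)
    also have "\<dots> = (\<integral>\<omega>. (indicator D \<omega> * ?b \<omega>) * indicator A \<omega> \<partial>M)"
    proof (rule integral_cong_AE)
      have "AE \<omega> in M. real_cond_exp M G (\<lambda>\<omega>. indicator D \<omega> * indicator B \<omega>) \<omega> = indicator D \<omega> * ?b \<omega>"
        by (rule G.real_cond_exp_mult)
          (use int[of "D \<inter> B"] in \<open>auto simp flip: indicator_inter_arith\<close>)
      moreover have "(\<lambda>\<omega>. indicator D \<omega> * indicator B \<omega>) = (indicator (B \<inter> D) :: 'a \<Rightarrow> real)"
        by (auto simp: indicator_def)
      ultimately show "AE \<omega> in M. real_cond_exp M G (indicator (B \<inter> D)) \<omega> * indicator A \<omega>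
          = (indicator D \<omega> * ?b \<omega>) * indicator A \<omega>" by auto
    qed auto
    also have "\<dots> = (\<integral>\<omega>. (indicator D \<omega> * ?b \<omega>) * ?a \<omega> \<partial>M)"
      by (rule G.real_cond_exp_intg(2)[symmetric])
        (use integrable_mult_indicator[OF DM bint] in \<open>auto simp: mult.assoc\<close>)
    also have "\<dots> = (\<integral>\<omega>\<in>D. ?a \<omega> * ?b \<omega> \<partial>M)"
      unfolding set_lebesgue_integral_def by (intro Bochner_Integration.integral_cong) auto
    finally show "(\<integral>\<omega>\<in>D. indicator (A \<inter> B) \<omega> \<partial>M) = (\<integral>\<omega>\<in>D. ?a \<omega> * ?b \<omega> \<partial>M)" .
  next
    show "integrable M (indicator (A \<inter> B) :: 'a \<Rightarrow> real)" by (rule int) auto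
    show "integrable M (\<lambda>\<omega>. ?a \<omega> * ?b \<omega>)"
      using G.real_cond_exp_intg(1)[OF bint] by (simp add: mult.commute)
  qed auto
qed

text \<open>The core of (ii) implies (i) at a fixed time. The limit identity is first known for
  continuous test functions of \<open>W\<close>, then for closed sets by bump functions, and finally
  for the whole sigma-algebra of \<open>W\<close>.\<close>

lemma (in prob_space) cond_indep_of_conv_in_law:
  fixes Z :: "'a \<Rightarrow> 'z::metric_space" and W :: "'a \<Rightarrow> 'w::metric_space"
  assumes Z: "Z \<in> borel_measurable M" and W: "W \<in> borel_measurable M"
    and G: "subalgebra (vimage_algebra (space M) Z borel) G"
    and Wk: "\<And>k. Wk k \<in> borel_measurable G"
    and conv: "conv_in_law M UNIV (\<lambda>k \<omega>. (Z \<omega>, Wk k \<omega>)) (\<lambda>\<omega>. (Z \<omega>, W \<omega>))"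
  shows "cond_indep M (vimage_algebra (space M) W borel) (vimage_algebra (space M) Z borel) G"
proof -
  let ?H = "vimage_algebra (space M) Z borel" and ?F = "vimage_algebra (space M) W borel"
  note H = subalgebra_vimage_algebra[OF Z] and F = subalgebra_vimage_algebra[OF W]
  have MG: "subalgebra M G" using H G by (auto simp: subalgebra_def)
  interpret G: finite_measure_subalgebra M G by unfold_locales (rule MG)
  have WkM: "Wk k \<in> borel_measurable M" for k by (rule measurable_from_subalg[OF MG Wk])
  note [measurable] = W
  show ?thesis
  proof (rule cond_indep_of_integral_eq[OF F H G])
    fix A B assume A: "A \<in> sets ?F" and B: "B \<in> sets ?H"
    have BM [measurable]: "B \<in> events" and AM [measurable]: "A \<in> events" using A B F H by (auto simp: subalgebra_def)
    have intB: "integrable M (indicator B :: 'a \<Rightarrow> real)"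
      by (auto intro!: integrable_real_indicator simp: emeasure_eq_measure)
    let ?b = "real_cond_exp M G (indicator B)"
    \<comment> \<open>A version of the conditional probability with values in the unit interval
      everywhere: the lemmas on weak limits ask for pointwise bounds.\<close>
    define p where "p \<omega> = max 0 (min 1 (?b \<omega>))" for \<omega>
    have pG: "p \<in> borel_measurable G" unfolding p_def by measurable
    have pM [measurable]: "p \<in> borel_measurable M" by (rule measurable_from_subalg[OF MG pG])
    have "AE \<omega> in M. ?b \<omega> \<ge> 0" by (rule G.real_cond_exp_pos) auto
    moreover have "AE \<omega> in M. ?b \<omega> \<le> 1"
      by (rule G.real_cond_exp_le_c) (use intB in \<open>auto simp: indicator_def\<close>)
    ultimately have pb: "AE \<omega> in M. p \<omega> = ?b \<omega>" by eventually_elim (auto simp: p_def)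
    have p01: "0 \<le> p \<omega>" "p \<omega> \<le> 1" for \<omega> by (auto simp: p_def)
    have pint: "integrable M p" by (rule integrable_const_bound[where B=1]) (use p01 in auto)
    \<comment> \<open>Both \<open>indicator B\<close> and \<open>p\<close> are measurable with
      respect to \<open>Z\<close>, the latter because \<open>G\<close> is a subalgebra, so stable
      convergence gives the limit of each side.\<close>
    have test: "(\<integral>\<omega>. g (W \<omega>) * indicator B \<omega> \<partial>M) = (\<integral>\<omega>. g (W \<omega>) * p \<omega> \<partial>M)"
      if g: "continuous_on UNIV g" "\<And>w. \<bar>g w\<bar> \<le> 1" for g :: "'w \<Rightarrow> real"
    proof -
      have gm [measurable]: "g \<in> borel_measurable borel" by (rule borel_measurable_continuous_onI[OF g(1)])
      have eq: "(\<integral>\<omega>. g (Wk k \<omega>) * indicator B \<omega> \<partial>M) = (\<integral>\<omega>. g (Wk k \<omega>) * p \<omega> \<partial>M)" for k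
      proof -
        have [measurable]: "Wk k \<in> borel_measurable M" by (rule WkM)
        have gG: "(\<lambda>\<omega>. g (Wk k \<omega>)) \<in> borel_measurable G" using measurable_compose[OF Wk gm] .
        have "(\<integral>\<omega>. g (Wk k \<omega>) * indicator B \<omega> \<partial>M) = (\<integral>\<omega>. g (Wk k \<omega>) * ?b \<omega> \<partial>M)"
          by (rule G.real_cond_exp_intg(2)[symmetric]) (auto intro!: integrable_bounded_mult[OF _ g(2) intB] gG)
        also have "\<dots> = (\<integral>\<omega>. g (Wk k \<omega>) * p \<omega> \<partial>M)"
          by (rule integral_cong_AE) (use pb in auto)
        finally show ?thesis .
      qed
      have "(\<lambda>k. \<integral>\<omega>. g (Wk k \<omega>) * indicator B \<omega> \<partial>M) \<longlonglongrightarrow> (\<integral>\<omega>. g (W \<omega>) * indicator B \<omega> \<partial>M)"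
        by (rule stable_convergence[OF Z WkM W conv g]) (use intB B in auto)
      moreover have "(\<lambda>k. \<integral>\<omega>. g (Wk k \<omega>) * p \<omega> \<partial>M) \<longlonglongrightarrow> (\<integral>\<omega>. g (W \<omega>) * p \<omega> \<partial>M)"
        by (rule stable_convergence[OF Z WkM W conv g pint measurable_from_subalg[OF G pG]])
      ultimately show ?thesis unfolding eq by (rule LIMSEQ_unique)
    qed
    have closed: "(\<integral>\<omega>. (indicator B \<omega> - p \<omega>) * indicator C (W \<omega>) \<partial>M) = 0" if C: "closed C" for C
    proof -
      have "(\<lambda>m. \<integral>\<omega>. (indicator B \<omega> - p \<omega>) * closed_bump C m (W \<omega>) \<partial>M)
          \<longlonglongrightarrow> (\<integral>\<omega>. (indicator B \<omega> - p \<omega>) * indicator C (W \<omega>) \<partial>M)"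
      proof (rule integral_dominated_convergence[where w="\<lambda>_. 1"])
        show "AE \<omega> in M. (\<lambda>m. (indicator B \<omega> - p \<omega>) * closed_bump C m (W \<omega>)) \<longlonglongrightarrow> (indicator B \<omega> - p \<omega>) * indicator C (W \<omega>)"
          by (intro AE_I2 tendsto_intros closed_bump_tendsto C)
        show "AE \<omega> in M. norm ((indicator B \<omega> - p \<omega>) * closed_bump C m (W \<omega>)) \<le> 1" for m
        proof (rule AE_I2)
          fix \<omega>
          have "\<bar>indicator B \<omega> - p \<omega>\<bar> \<le> 1" "\<bar>closed_bump C m (W \<omega>)\<bar> \<le> 1"
            using p01[of \<omega>] closed_bump_bounds[of C m "W \<omega>"] by (auto simp: indicator_def)
          then show "norm ((indicator B \<omega> - p \<omega>) * closed_bump C m (W \<omega>)) \<le> 1"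
            by (simp add: abs_mult mult_le_one)
        qed
        have [measurable]: "closed_bump C m \<in> borel_measurable borel" for m
          by (rule borel_measurable_continuous_onI[OF closed_bump_continuous])
        show "(\<lambda>\<omega>. (indicator B \<omega> - p \<omega>) * closed_bump C m (W \<omega>)) \<in> borel_measurable M" for m by measurable
        have [measurable]: "C \<in> sets borel" using C by auto
        show "(\<lambda>\<omega>. (indicator B \<omega> - p \<omega>) * indicator C (W \<omega>)) \<in> borel_measurable M" by measurable
      qed simp
      moreover have "(\<integral>\<omega>. (indicator B \<omega> - p \<omega>) * closed_bump C m (W \<omega>) \<partial>M) = 0" for m
      proof -
        have ba: "\<bar>closed_bump C m w\<bar> \<le> 1" for w using closed_bump_bounds[of C m w] by simp
        have bm: "(\<lambda>\<omega>. closed_bump C m (W \<omega>)) \<in> borel_measurable M"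
          using measurable_compose[OF W borel_measurable_continuous_onI[OF closed_bump_continuous]] .
        have "(\<integral>\<omega>. (indicator B \<omega> - p \<omega>) * closed_bump C m (W \<omega>) \<partial>M)
          = (\<integral>\<omega>. closed_bump C m (W \<omega>) * indicator B \<omega> - closed_bump C m (W \<omega>) * p \<omega> \<partial>M)"
          by (intro Bochner_Integration.integral_cong) (auto simp: algebra_simps)
        also have "\<dots> = (\<integral>\<omega>. closed_bump C m (W \<omega>) * indicator B \<omega> \<partial>M) - (\<integral>\<omega>. closed_bump C m (W \<omega>) * p \<omega> \<partial>M)"
          by (intro Bochner_Integration.integral_diff integrable_bounded_mult[OF bm ba] intB pint)
        finally show ?thesis using test[OF closed_bump_continuous ba] by simp
      qed
      ultimately show ?thesis by (simp add: LIMSEQ_const_iff)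
    qed
    \<comment> \<open>With weights constant in \<open>k\<close> the convergence statement is an
      equation: the generator argument is used as a uniqueness theorem for signed measures.\<close>
    have "(\<lambda>k::nat. \<integral>\<omega>. (indicator B \<omega> - p \<omega>) * indicator A \<omega> \<partial>M) \<longlonglongrightarrow> (\<integral>\<omega>. 0 * indicator A \<omega> \<partial>M)"
    proof (rule weak_limit_of_generator[OF F vimage_algebra_borel_closed _ Int_stable_vimage_closed, where b=1])
      show "\<bar>indicator B \<omega> - p \<omega>\<bar> \<le> 1" for \<omega> using p01[of \<omega>] by (auto simp: indicator_def)
      show "(\<lambda>k. \<integral>\<omega>. indicator B \<omega> - p \<omega> \<partial>M) \<longlonglongrightarrow> (\<integral>\<omega>. 0 \<partial>M)"
        using closed[of UNIV] by simp
      fix D assume "D \<in> {W -` C \<inter> space M | C. C \<in> Collect closed}"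
      then obtain C where C: "closed C" "D = W -` C \<inter> space M" by auto
      have "(\<integral>\<omega>. (indicator B \<omega> - p \<omega>) * indicator D \<omega> \<partial>M) = (\<integral>\<omega>. (indicator B \<omega> - p \<omega>) * indicator C (W \<omega>) \<partial>M)"
        by (intro Bochner_Integration.integral_cong) (auto simp: C indicator_def)
      then show "(\<lambda>k. \<integral>\<omega>. (indicator B \<omega> - p \<omega>) * indicator D \<omega> \<partial>M) \<longlonglongrightarrow> (\<integral>\<omega>. 0 * indicator D \<omega> \<partial>M)"
        using closed[OF C(1)] by simp
    next
      show "integrable M (indicator A :: 'a \<Rightarrow> real)"
        by (auto intro!: integrable_real_indicator simp: emeasure_eq_measure)
    qed (use A in auto)
    then have "(\<integral>\<omega>. (indicator B \<omega> - p \<omega>) * indicator A \<omega> \<partial>M) = 0" by (simp add: LIMSEQ_const_iff)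
    moreover have "(\<integral>\<omega>. (indicator B \<omega> - p \<omega>) * indicator A \<omega> \<partial>M)
        = (\<integral>\<omega>. indicator B \<omega> * indicator A \<omega> \<partial>M) - (\<integral>\<omega>. p \<omega> * indicator A \<omega> \<partial>M)"
      unfolding left_diff_distrib
      by (intro Bochner_Integration.integral_diff integrable_real_mult_indicator AM intB pint)
    moreover have "(\<integral>\<omega>. p \<omega> * indicator A \<omega> \<partial>M) = (\<integral>\<omega>. ?b \<omega> * indicator A \<omega> \<partial>M)"
      by (rule integral_cong_AE) (use pb in auto)
    ultimately show "(\<integral>\<omega>. indicator B \<omega> * indicator A \<omega> \<partial>M) = (\<integral>\<omega>. ?b \<omega> * indicator A \<omega> \<partial>M)" by simp
  qed
qed

section \<open>Approximation in law by adapted processes\<close>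

text \<open>A downward closed set of integers is an initial segment, so counting its elements
  inverts a monotone function. This is how quantiles are computed below.\<close>

lemma card_initial_segment:
  fixes P :: "nat \<Rightarrow> bool"
  assumes P: "\<And>i j. i \<le> j \<Longrightarrow> P j \<Longrightarrow> P i" and m: "1 \<le> m" "m < L"
  shows "m \<le> card {i\<in>{1..<L}. P i} \<longleftrightarrow> P m"
proof
  assume "P m"
  then have "{1..m} \<subseteq> {i\<in>{1..<L}. P i}" using P m by auto
  then have "card {1..m} \<le> card {i\<in>{1..<L}. P i}" by (intro card_mono) auto
  then show "m \<le> card {i\<in>{1..<L}. P i}" by simp
next
  assume le: "m \<le> card {i\<in>{1..<L}. P i}"
  show "P m"
  proof (rule ccontr)
    assume "\<not> P m"
    then have "{i\<in>{1..<L}. P i} \<subseteq> {1..<m}" using P by (auto simp: not_le[symmetric])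
    then have "card {i\<in>{1..<L}. P i} \<le> card {1..<m}" by (intro card_mono) auto
    then show False using le m by simp
  qed
qed

text \<open>The probability that a uniform variable is at least \<open>q\<close>, approximated by
  \<open>B\<close> equally spaced points.\<close>

lemma grid_average_approx:
  fixes q :: real
  assumes "0 \<le> q" "q \<le> 1" "B > 0"
  shows "\<bar>(\<Sum>j<B. of_bool (q \<le> real j / real B)) / real B - (1 - q)\<bar> \<le> 1 / real B"
proof -
  \<comment> \<open>The first grid index that reaches \<open>q\<close>; exactly \<open>B - c\<close>
    points count.\<close>
  define c where "c = nat \<lceil>q * B\<rceil>"
  have c: "real c < q * B + 1" "q * B \<le> real c" using assms by (auto simp: c_def) linarith+
  have "q * B \<le> real B" using assms by (simp add: mult_left_le_one_le)
  then have cB: "c \<le> B" using assms by (simp add: c_def ceiling_le_iff nat_le_iff)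
  have iff: "q \<le> real j / real B \<longleftrightarrow> c \<le> j" for j
    using assms by (simp add: c_def pos_le_divide_eq nat_le_iff ceiling_le_iff)
  have "(\<Sum>j<B. of_bool (q \<le> real j / real B)) = (\<Sum>j\<in>{c..<B}. 1::real)"
    unfolding iff by (intro sum.mono_neutral_cong_right) auto
  also have "\<dots> = real B - real c" using cB by (simp add: of_nat_diff)
  finally have "(\<Sum>j<B. of_bool (q \<le> real j / real B)) / real B = 1 - real c / real B"
    using assms by (simp add: diff_divide_distrib)
  moreover have "q \<le> real c / real B" using c assms by (simp add: pos_le_divide_eq)
  moreover have "real c / real B \<le> q + 1 / real B" using c assms by (simp add: field_simps)
  ultimately show ?thesis by (simp add: abs_le_iff)
qed

text \<open>Doob's form of conditional independence: once \<open>G\<close> is known, the larger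
  \<open>H\<close> says nothing more about \<open>A\<close>.\<close>

lemma (in prob_space) cond_indep_cond_exp_eq:
  assumes F: "subalgebra M F" and H: "subalgebra M H" and G: "subalgebra H G"
    and ci: "cond_indep M F H G" and A: "A \<in> sets F"
  shows "AE \<omega> in M. real_cond_exp M H (indicator A) \<omega> = real_cond_exp M G (indicator A) \<omega>"
proof -
  have MG: "subalgebra M G" using H G by (auto simp: subalgebra_def)
  interpret G: finite_measure_subalgebra M G by unfold_locales (rule MG)
  interpret H: finite_measure_subalgebra M H by unfold_locales (rule H)
  have int: "integrable M (indicator D :: 'a \<Rightarrow> real)" if "D \<in> events" for D
    using that by (auto intro!: integrable_real_indicator simp: emeasure_eq_measure)
  have AM [measurable]: "A \<in> events" using A F by (auto simp: subalgebra_def)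
  let ?a = "real_cond_exp M G (indicator A)"
  have aint: "integrable M ?a" by (rule G.real_cond_exp_int(1)[OF int[OF AM]])
  show ?thesis
  proof (rule H.real_cond_exp_charact)
    fix B assume B: "B \<in> sets H"
    have BM [measurable]: "B \<in> events" using B H by (auto simp: subalgebra_def)
    let ?b = "real_cond_exp M G (indicator B)"
    have "(\<integral>\<omega>\<in>B. indicator A \<omega> \<partial>M) = (\<integral>\<omega>. indicat_real (A \<inter> B) \<omega> \<partial>M)"
      unfolding set_lebesgue_integral_def by (intro Bochner_Integration.integral_cong) (auto simp: indicator_def)
    also have "\<dots> = (\<integral>\<omega>. real_cond_exp M G (indicator (A \<inter> B)) \<omega> \<partial>M)"
      by (rule G.real_cond_exp_int(2)[symmetric], rule int) auto
    also have "\<dots> = (\<integral>\<omega>. ?a \<omega> * ?b \<omega> \<partial>M)"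
      by (rule integral_cong_AE) (use ci A B in \<open>auto simp: cond_indep_def\<close>)
    also have "\<dots> = (\<integral>\<omega>. ?a \<omega> * indicator B \<omega> \<partial>M)"
      by (rule G.real_cond_exp_intg(2)) (use integrable_real_mult_indicator[OF BM aint] in auto)
    also have "\<dots> = (\<integral>\<omega>\<in>B. ?a \<omega> \<partial>M)"
      unfolding set_lebesgue_integral_def by (intro Bochner_Integration.integral_cong) auto
    finally show "(\<integral>\<omega>\<in>B. indicator A \<omega> \<partial>M) = (\<integral>\<omega>\<in>B. ?a \<omega> \<partial>M)" .
  next
    show "?a \<in> borel_measurable H" by (rule measurable_from_subalg[OF G]) simp
  qed (use aint int[OF AM] in auto)
qed

text \<open>When \<open>Suc k\<close> is a power of \<open>B\<close> this is a base-\<open>B\<close>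
  digit of \<open>u\<close>. Other scales serve equally well, since what matters is oscillation with
  period \<open>1 / Suc k\<close>.\<close>

definition digit :: "nat \<Rightarrow> nat \<Rightarrow> real \<Rightarrow> nat" where
  "digit B k u = nat \<lfloor>real (Suc k * B) * u\<rfloor> mod B"

lemma measurable_digit [measurable]: "digit B k \<in> measurable borel (count_space UNIV)"
  unfolding digit_def by (rule measurable_floor_mod)

text \<open>In the limit the digit is uniform on \<open>{..<B}\<close> and independent of
  \<open>A\<close> and \<open>Q\<close>, so it can be averaged out. The limit is exact; the error
  \<open>1 / B\<close> stems from replacing a continuous uniform variable by a grid.\<close>

lemma (in prob_space) randomized_threshold:
  fixes U Q :: "'a \<Rightarrow> real"
  assumes U [measurable]: "U \<in> borel_measurable M"
    and U01: "\<And>\<omega>. \<omega> \<in> space M \<Longrightarrow> 0 \<le> U \<omega> \<and> U \<omega> \<le> 1"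
    and unif: "\<And>x. 0 \<le> x \<Longrightarrow> x \<le> 1 \<Longrightarrow> prob {\<omega>\<in>space M. U \<omega> < x} = x"
    and B: "B > 0" and A [measurable]: "A \<in> events"
    and Q [measurable]: "Q \<in> borel_measurable M" "AE \<omega> in M. 0 \<le> Q \<omega> \<and> Q \<omega> \<le> 1"
  shows "\<exists>l. (\<lambda>k. prob (A \<inter> {\<omega>\<in>space M. Q \<omega> \<le> real (digit B k (U \<omega>)) / real B})) \<longlonglongrightarrow> l \<and>
    \<bar>l - (\<integral>\<omega>. indicator A \<omega> * (1 - Q \<omega>) \<partial>M)\<bar> \<le> 1 / real B"
proof -
  define f where "f j \<omega> = (indicator A \<omega> * of_bool (Q \<omega> \<le> real j / real B) :: real)" for j \<omega>
  have fm [measurable]: "f j \<in> borel_measurable M" for j unfolding f_def by measurable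
  have fint: "integrable M (f j)" for j
    by (rule integrable_const_bound[where B=1]) (auto simp: f_def indicator_def)
  define l where "l = (\<Sum>j<B. (\<integral>\<omega>. f j \<omega> \<partial>M) / B)"
  have dm [measurable]: "(\<lambda>\<omega>. digit B k (U \<omega>)) \<in> measurable M (count_space UNIV)" for k by measurable
  have eq: "prob (A \<inter> {\<omega>\<in>space M. Q \<omega> \<le> real (digit B k (U \<omega>)) / real B})
      = (\<Sum>j<B. \<integral>\<omega>. indicator {\<omega>\<in>space M. digit B k (U \<omega>) = j} \<omega> * f j \<omega> \<partial>M)" for k
  proof -
    let ?T = "A \<inter> {\<omega>\<in>space M. Q \<omega> \<le> real (digit B k (U \<omega>)) / real B}"
    have [measurable]: "?T \<in> events" by measurable
    have "prob ?T = (\<integral>\<omega>. indicator ?T \<omega> \<partial>M)" by (simp add: sets.Int_space_eq2)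
    also have "\<dots> = (\<integral>\<omega>. (\<Sum>j<B. indicator {\<omega>\<in>space M. digit B k (U \<omega>) = j} \<omega> * f j \<omega>) \<partial>M)"
    proof (rule Bochner_Integration.integral_cong[OF refl])
      fix \<omega> assume w: "\<omega> \<in> space M"
      have d: "digit B k (U \<omega>) < B" using B by (simp add: digit_def)
      have "(\<Sum>j<B. indicator {\<omega>\<in>space M. digit B k (U \<omega>) = j} \<omega> * f j \<omega>)
          = (\<Sum>j<B. if j = digit B k (U \<omega>) then f j \<omega> else 0)"
        by (rule sum.cong) (use w in \<open>auto simp: indicator_def\<close>)
      also have "\<dots> = f (digit B k (U \<omega>)) \<omega>" using d by (simp add: sum.delta)
      also have "\<dots> = indicator ?T \<omega>" using w by (auto simp: f_def indicator_def)
      finally show "indicator ?T \<omega> = (\<Sum>j<B. indicator {\<omega>\<in>space M. digit B k (U \<omega>) = j} \<omega> * f j \<omega>)" by simp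
    qed
    also have "\<dots> = (\<Sum>j<B. \<integral>\<omega>. indicator {\<omega>\<in>space M. digit B k (U \<omega>) = j} \<omega> * f j \<omega> \<partial>M)"
    proof (rule Bochner_Integration.integral_sum)
      fix j
      have "{\<omega>\<in>space M. digit B k (U \<omega>) = j} \<in> events" by measurable
      from integrable_mult_indicator[OF this fint[of j]]
      show "integrable M (\<lambda>\<omega>. indicator {\<omega>\<in>space M. digit B k (U \<omega>) = j} \<omega> * f j \<omega>)" by simp
    qed
    finally show ?thesis .
  qed
  have "(\<lambda>k. prob (A \<inter> {\<omega>\<in>space M. Q \<omega> \<le> real (digit B k (U \<omega>)) / real B})) \<longlonglongrightarrow> l"
    unfolding eq l_def
  proof (rule tendsto_sum)
    fix j assume "j \<in> {..<B}"
    then show "(\<lambda>k. \<integral>\<omega>. indicator {\<omega>\<in>space M. digit B k (U \<omega>) = j} \<omega> * f j \<omega> \<partial>M) \<longlonglongrightarrow> (\<integral>\<omega>. f j \<omega> \<partial>M) / B"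
      unfolding digit_def by (intro mixing_digits U U01 unif fint) auto
  qed
  moreover have "\<bar>l - (\<integral>\<omega>. indicator A \<omega> * (1 - Q \<omega>) \<partial>M)\<bar> \<le> 1 / real B"
  proof -
    have Qint: "integrable M (\<lambda>\<omega>. indicator A \<omega> * (1 - Q \<omega>))"
    proof (rule integrable_const_bound[where B=1])
      show "AE \<omega> in M. norm (indicator A \<omega> * (1 - Q \<omega>)) \<le> 1"
        using Q(2) by eventually_elim (auto simp: indicator_def)
    qed measurable
    have sint: "integrable M (\<lambda>\<omega>. (\<Sum>j<B. f j \<omega>) / B)" using fint by auto
    have "l = (\<integral>\<omega>. (\<Sum>j<B. f j \<omega>) / B \<partial>M)"
      unfolding l_def using fint by (simp add: Bochner_Integration.integral_sum sum_divide_distrib)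
    then have "\<bar>l - (\<integral>\<omega>. indicator A \<omega> * (1 - Q \<omega>) \<partial>M)\<bar>
        = \<bar>\<integral>\<omega>. (\<Sum>j<B. f j \<omega>) / B - indicator A \<omega> * (1 - Q \<omega>) \<partial>M\<bar>"
      using sint Qint by simp
    also have "\<dots> \<le> (\<integral>\<omega>. \<bar>(\<Sum>j<B. f j \<omega>) / B - indicator A \<omega> * (1 - Q \<omega>)\<bar> \<partial>M)" by (rule integral_abs_bound)
    also have "\<dots> \<le> (\<integral>\<omega>. 1 / B \<partial>M)"
    proof (rule integral_mono_AE)
      show "AE \<omega> in M. \<bar>(\<Sum>j<B. f j \<omega>) / B - indicator A \<omega> * (1 - Q \<omega>)\<bar> \<le> 1 / B"
        using Q(2)
      proof eventually_elim
        case (elim \<omega>)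
        show ?case
        proof (cases "\<omega> \<in> A")
          case True
          then show ?thesis using grid_average_approx[OF _ _ B, of "Q \<omega>"] elim by (simp add: f_def)
        qed (simp add: f_def)
      qed
    qed (use sint Qint in auto)
    finally show ?thesis by (simp add: prob_space)
  qed
  ultimately show ?thesis by blast
qed

text \<open>The history up to time \<open>n\<close> of a finite-valued process is coded by an integer \<open>I n < R ^ n\<close> in
  base \<open>R\<close>, most significant digit first. Inverting the conditional distribution function of \<open>I n\<close>
  at an approximately independent uniform variable gives codes \<open>J n\<close>; conditional independence makes
  the distribution functions for different \<open>n\<close> compatible, so the \<open>J n\<close> are again histories of one
  process.\<close>

lemma (in prob_space) adapted_law_approximation:
  fixes I :: "nat \<Rightarrow> 'a \<Rightarrow> nat" and G F :: "nat \<Rightarrow> 'a measure" and U :: "'a \<Rightarrow> real"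
  assumes H: "subalgebra M H" and N: "N \<ge> 1" and R: "R > 0"
    and G: "\<And>n. n \<in> {1..N} \<Longrightarrow> subalgebra H (G n)"
    and U: "\<And>n. n \<in> {1..N} \<Longrightarrow> U \<in> borel_measurable (G n)"
    and U01: "\<And>\<omega>. \<omega> \<in> space M \<Longrightarrow> 0 \<le> U \<omega> \<and> U \<omega> \<le> 1"
    and unif: "\<And>x. 0 \<le> x \<Longrightarrow> x \<le> 1 \<Longrightarrow> prob {\<omega>\<in>space M. U \<omega> < x} = x"
    and F: "\<And>n. n \<in> {1..N} \<Longrightarrow> subalgebra M (F n)"
    and ci: "\<And>n. n \<in> {1..N} \<Longrightarrow> cond_indep M (F n) H (G n)"
    and I: "\<And>n. n \<in> {1..N} \<Longrightarrow> I n \<in> measurable (F n) (count_space UNIV)"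
    and Idiv: "\<And>n \<omega>. n \<in> {1..N} \<Longrightarrow> \<omega> \<in> space M \<Longrightarrow> I n \<omega> = I N \<omega> div R ^ (N - n)"
    and Iless: "\<And>\<omega>. \<omega> \<in> space M \<Longrightarrow> I N \<omega> < R ^ N"
    and fin: "finite \<A>" "\<A> \<subseteq> sets H" and e: "e > 0"
  shows "\<exists>J. (\<forall>n\<in>{1..N}. J n \<in> measurable (G n) (count_space UNIV)) \<and>
    (AE \<omega> in M. \<forall>n\<in>{1..N}. J n \<omega> = J N \<omega> div R ^ (N - n)) \<and> (\<forall>\<omega>. J N \<omega> < R ^ N) \<and>
    (\<forall>A\<in>\<A>. \<forall>l. \<bar>prob (A \<inter> {\<omega>\<in>space M. J N \<omega> = l}) - prob (A \<inter> {\<omega>\<in>space M. I N \<omega> = l})\<bar> < e)"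
proof -
  have NN: "N \<in> {1..N}" using N by simp
  have MG: "subalgebra M (G n)" if "n \<in> {1..N}" for n
    using H G[OF that] by (auto simp: subalgebra_def)
  have UM [measurable]: "U \<in> borel_measurable M" by (rule measurable_from_subalg[OF MG[OF NN] U[OF NN]])
  have IM [measurable]: "I N \<in> measurable M (count_space UNIV)"
    by (rule measurable_from_subalg[OF F[OF NN] I[OF NN]])
  interpret H: finite_measure_subalgebra M H by unfold_locales (rule H)
  define L where "L = R ^ N"
  define E where "E m = {\<omega>\<in>space M. I N \<omega> < m}" for m
  have EM [measurable]: "E m \<in> events" for m unfolding E_def by measurable
  have int: "integrable M (indicator D :: 'a \<Rightarrow> real)" if "D \<in> events" for D
    using that by (auto intro!: integrable_real_indicator simp: emeasure_eq_measure)
  \<comment> \<open>\<open>S n l\<close> is the conditional distribution function of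
    \<open>I n\<close> given \<open>G n\<close>, hence usable by an adapted construction;
    \<open>Q\<close> is that of the full code given \<open>H\<close>, in which the comparison of
    laws is carried out.\<close>
  define Q where "Q m = real_cond_exp M H (indicator (E m))" for m
  define S where "S n l = real_cond_exp M (G n) (indicator (E (l * R ^ (N - n))))" for n l
  have Qm [measurable]: "Q m \<in> borel_measurable M" for m unfolding Q_def by simp
  \<comment> \<open>The full code lies below \<open>l * R ^ (N - n)\<close> exactly when its
    quotient \<open>I n\<close> lies below \<open>l\<close>.\<close>
  have EF: "E (l * R ^ (N - n)) \<in> sets (F n)" if n: "n \<in> {1..N}" for n l
  proof -
    have "E (l * R ^ (N - n)) = I n -` {..<l} \<inter> space (F n)"
      using F[OF n] R Idiv[OF n] by (auto simp: E_def subalgebra_def div_less_iff_less_mult)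
    then show ?thesis using measurable_sets[OF I[OF n], of "{..<l}"] by simp
  qed
  have SQ: "AE \<omega> in M. S n l \<omega> = Q (l * R ^ (N - n)) \<omega>" if "n \<in> {1..N}" for n l
    using cond_indep_cond_exp_eq[OF F[OF that] H G[OF that] ci[OF that] EF[OF that, of l]]
    by (auto simp: S_def Q_def)
  have mono: "AE \<omega> in M. Q m \<omega> \<le> Q m' \<omega>" if "m \<le> m'" for m m'
    unfolding Q_def by (rule H.real_cond_exp_mono) (use that int in \<open>auto simp: E_def indicator_def\<close>)
  have Q01: "AE \<omega> in M. 0 \<le> Q m \<omega> \<and> Q m \<omega> \<le> 1" for m
  proof -
    have "AE \<omega> in M. Q m \<omega> \<ge> 0" unfolding Q_def by (rule H.real_cond_exp_pos) auto
    moreover have "AE \<omega> in M. Q m \<omega> \<le> 1"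
      unfolding Q_def by (rule H.real_cond_exp_le_c) (use int in \<open>auto simp: indicator_def\<close>)
    ultimately show ?thesis by eventually_elim auto
  qed
  \<comment> \<open>Countably many almost sure relations between versions are collected outside one
    null set, on whose complement the construction is pathwise.\<close>
  have good: "AE \<omega> in M. (\<forall>n\<in>{1..N}. \<forall>l. S n l \<omega> = Q (l * R ^ (N - n)) \<omega>) \<and> (\<forall>m m'. m \<le> m' \<longrightarrow> Q m \<omega> \<le> Q m' \<omega>)"
  proof -
    have "AE \<omega> in M. \<forall>n\<in>{1..N}. \<forall>l. S n l \<omega> = Q (l * R ^ (N - n)) \<omega>"
      by (rule AE_ball_countable') (use SQ in \<open>auto simp: AE_all_countable\<close>)
    moreover have "AE \<omega> in M. \<forall>m m'. m \<le> m' \<longrightarrow> Q m \<omega> \<le> Q m' \<omega>"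
      using mono by (auto simp: AE_all_countable)
    ultimately show ?thesis by eventually_elim auto
  qed
  \<comment> \<open>A point probability is a difference of two tail probabilities, each of which
    will be off by less than \<open>2 / B\<close>.\<close>
  obtain B0 :: nat where B0: "real B0 > 4 / e" using reals_Archimedean2 by blast
  define B where "B = B0"
  have Bpos: "B > 0" using B0 e unfolding B_def by (metis divide_pos_pos gr0I less_trans of_nat_0 order_less_irrefl zero_less_numeral)
  have Be: "4 / real B < e" using B0 e Bpos by (simp add: B_def field_simps)
  \<comment> \<open>The generalised inverse of \<open>S n\<close> at the grid point given by the
    digit, with the same digit for all \<open>n\<close>. Counting starts at 1 so that the smallest
    code is 0, and counting keeps \<open>J k n\<close> below \<open>R ^ n\<close> everywhere, even
    where the versions misbehave.\<close>
  define J where "J k n \<omega> = card {l\<in>{1..<R ^ n}. S n l \<omega> \<le> real (digit B k (U \<omega>)) / real B}" for k n \<omega>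
  have Jm: "J k n \<in> measurable (G n) (count_space UNIV)" if n: "n \<in> {1..N}" for k n
  proof -
    note [measurable] = U[OF n]
    have [measurable]: "S n l \<in> borel_measurable (G n)" for l unfolding S_def by simp
    have "J k n \<omega> = (\<Sum>l\<in>{1..<R ^ n}. of_bool (S n l \<omega> \<le> real (digit B k (U \<omega>)) / real B))" for \<omega>
      unfolding J_def by (simp add: sum.If_cases of_bool_def Int_def)
    then have "J k n = (\<lambda>\<omega>. \<Sum>l\<in>{1..<R ^ n}. of_bool (S n l \<omega> \<le> real (digit B k (U \<omega>)) / real B))" by auto
    moreover have "\<dots> \<in> measurable (G n) (count_space UNIV)" by measurable
    ultimately show ?thesis by simp
  qed
  have Jless: "J k n \<omega> < R ^ n" for k n \<omega>
  proof -
    have "J k n \<omega> \<le> card {1..<R ^ n}" unfolding J_def by (rule card_mono) auto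
    then show ?thesis using R by (simp add: less_diff_conv2 Suc_le_eq le_diff_conv2)
  qed
  have Jiff: "m \<le> J k N \<omega> \<longleftrightarrow> Q m \<omega> \<le> real (digit B k (U \<omega>)) / real B"
    if "\<forall>n\<in>{1..N}. \<forall>l. S n l \<omega> = Q (l * R ^ (N - n)) \<omega>" "\<forall>m m'. m \<le> m' \<longrightarrow> Q m \<omega> \<le> Q m' \<omega>" "1 \<le> m" "m < L"
    for m k \<omega>
  proof -
    have "S N l \<omega> = Q l \<omega>" for l using that(1) NN by force
    then have eq: "J k N \<omega> = card {l\<in>{1..<L}. Q l \<omega> \<le> real (digit B k (U \<omega>)) / real B}"
      by (simp add: J_def L_def)
    show ?thesis unfolding eq by (rule card_initial_segment[OF _ that(3,4)]) (use that(2) order_trans in blast)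
  qed
  have Jdiv: "AE \<omega> in M. \<forall>n\<in>{1..N}. J k n \<omega> = J k N \<omega> div R ^ (N - n)" for k
    using good
  proof eventually_elim
    case (elim \<omega>)
    show ?case
    proof
      fix n assume n: "n \<in> {1..N}"
      define q where "q = R ^ (N - n)"
      have q: "q > 0" "R ^ n * q = L" using R n by (auto simp: q_def L_def simp flip: power_add)
      have lt: "J k N \<omega> div q < R ^ n"
        using Jless[of k N \<omega>] q by (simp add: div_less_iff_less_mult L_def)
      \<comment> \<open>The threshold for \<open>l\<close> at time \<open>n\<close> is the threshold
        for \<open>l * q\<close> at time \<open>N\<close>, and
        \<open>l * q \<le> J k N \<omega>\<close> means
        \<open>l \<le> J k N \<omega> div q\<close>.\<close>
      have "{l\<in>{1..<R ^ n}. S n l \<omega> \<le> real (digit B k (U \<omega>)) / real B} = {1..J k N \<omega> div q}"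
      proof (intro set_eqI)
        fix l
        have "S n l \<omega> \<le> real (digit B k (U \<omega>)) / real B \<longleftrightarrow> l \<le> J k N \<omega> div q" if l: "1 \<le> l" "l < R ^ n"
        proof -
          have "1 \<le> l * q" using l(1) q(1) by simp
          moreover have "l * q < L" using l(2) q by (metis mult_less_cancel2)
          ultimately have "l * q \<le> J k N \<omega> \<longleftrightarrow> Q (l * q) \<omega> \<le> real (digit B k (U \<omega>)) / real B"
            by (rule Jiff[OF conjunct1[OF elim] conjunct2[OF elim]])
          moreover have "S n l \<omega> = Q (l * q) \<omega>" using elim n by (simp add: q_def)
          ultimately show ?thesis using q(1) by (simp add: less_eq_div_iff_mult_less_eq)
        qed
        then show "l \<in> {l\<in>{1..<R ^ n}. S n l \<omega> \<le> real (digit B k (U \<omega>)) / real B} \<longleftrightarrow> l \<in> {1..J k N \<omega> div q}"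
          using lt by auto
      qed
      then show "J k n \<omega> = J k N \<omega> div R ^ (N - n)" by (simp add: J_def[of k n] q_def)
    qed
  qed
  have JM [measurable]: "J k N \<in> measurable M (count_space UNIV)" for k
    by (rule measurable_from_subalg[OF MG[OF NN] Jm[OF NN]])
  let ?D = "\<lambda>k A m. \<bar>prob (A \<inter> {\<omega>\<in>space M. m \<le> J k N \<omega>}) - prob (A \<inter> {\<omega>\<in>space M. m \<le> I N \<omega>})\<bar>"
  \<comment> \<open>One \<open>1 / B\<close> is the grid error of the limit, the other the distance
    to the limit for large \<open>k\<close>.\<close>
  have ev: "eventually (\<lambda>k. ?D k A m < 2 / B) sequentially" if A: "A \<in> \<A>" for A m
  proof -
    have AH: "A \<in> sets H" using A fin by auto
    have AM [measurable]: "A \<in> events" using AH H by (auto simp: subalgebra_def)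
    consider "m = 0" | "m \<ge> L" | "1 \<le> m" "m < L" by linarith
    then show ?thesis
    proof cases
      case 1 then show ?thesis using Bpos by simp
    next
      case 2
      have "\<not> m \<le> J k N \<omega>" for k \<omega> using Jless[of k N \<omega>] 2 by (simp add: L_def)
      then have "{\<omega>\<in>space M. m \<le> J k N \<omega>} = {}" for k by simp
      moreover have "\<not> m \<le> I N \<omega>" if "\<omega> \<in> space M" for \<omega> using Iless[OF that] 2 by (simp add: L_def)
      then have "{\<omega>\<in>space M. m \<le> I N \<omega>} = {}" by auto
      ultimately have "?D k A m < 2 / B" for k using Bpos by (simp only: Int_empty_right) simp
      then show ?thesis by simp
    next
      case 3
      obtain l where l: "(\<lambda>k. prob (A \<inter> {\<omega>\<in>space M. Q m \<omega> \<le> real (digit B k (U \<omega>)) / real B})) \<longlonglongrightarrow> l"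
        "\<bar>l - (\<integral>\<omega>. indicator A \<omega> * (1 - Q m \<omega>) \<partial>M)\<bar> \<le> 1 / real B"
        using randomized_threshold[OF UM U01 unif Bpos AM Qm Q01[of m]] by blast
      have eqJ: "prob (A \<inter> {\<omega>\<in>space M. Q m \<omega> \<le> real (digit B k (U \<omega>)) / real B}) = prob (A \<inter> {\<omega>\<in>space M. m \<le> J k N \<omega>})" for k
      proof (rule measure_eq_AE)
        show "AE \<omega> in M. \<omega> \<in> A \<inter> {\<omega>\<in>space M. Q m \<omega> \<le> real (digit B k (U \<omega>)) / real B}
            \<longleftrightarrow> \<omega> \<in> A \<inter> {\<omega>\<in>space M. m \<le> J k N \<omega>}"
          using good by eventually_elim (use Jiff 3 in auto)
      qed measurable
      have Qint: "integrable M (Q m)" unfolding Q_def by (rule H.real_cond_exp_int(1)[OF int]) auto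
      have "(\<integral>\<omega>. indicator A \<omega> * (1 - Q m \<omega>) \<partial>M) = (\<integral>\<omega>. indicator A \<omega> - indicator A \<omega> * Q m \<omega> \<partial>M)"
        by (simp add: right_diff_distrib)
      also have "\<dots> = (\<integral>\<omega>. indicator A \<omega> \<partial>M) - (\<integral>\<omega>. indicator A \<omega> * Q m \<omega> \<partial>M)"
        using integrable_mult_indicator[OF AM Qint] int[OF AM] by simp
      also have "(\<integral>\<omega>. indicator A \<omega> * Q m \<omega> \<partial>M) = (\<integral>\<omega>. indicator A \<omega> * indicator (E m) \<omega> \<partial>M)"
        unfolding Q_def by (rule H.real_cond_exp_intg(2))
          (use integrable_mult_indicator[OF AM int[OF EM[of m]]] AH in auto)
      also have "\<dots> = prob (A \<inter> E m)" by (simp flip: indicator_inter_arith add: sets.Int_space_eq2)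
      also have "(\<integral>\<omega>. indicator A \<omega> \<partial>M) - prob (A \<inter> E m) = prob (A - A \<inter> E m)"
        by (subst finite_measure_Diff) (auto simp: sets.Int_space_eq2)
      also have "A - A \<inter> E m = A \<inter> {\<omega>\<in>space M. m \<le> I N \<omega>}"
        using sets.sets_into_space[OF AM] by (auto simp: E_def)
      finally have lim: "\<bar>l - prob (A \<inter> {\<omega>\<in>space M. m \<le> I N \<omega>})\<bar> \<le> 1 / B" using l(2) by simp
      have "eventually (\<lambda>k. dist (prob (A \<inter> {\<omega>\<in>space M. m \<le> J k N \<omega>})) l < 1 / B) sequentially"
        using l(1) Bpos unfolding eqJ by (intro tendstoD) auto
      then show ?thesis
        by eventually_elim (use lim in \<open>auto simp: dist_real_def\<close>)
    qed
  qed
  \<comment> \<open>Finitely many pairs of \<open>A\<close> and \<open>m\<close>, so a single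
    \<open>k\<close> serves them all.\<close>
  have "eventually (\<lambda>k. \<forall>A\<in>\<A>. \<forall>m\<in>{..Suc L}. ?D k A m < 2 / B) sequentially"
    by (intro eventually_ball_finite fin ballI finite_atMost ev)
  then obtain k where k: "\<And>A m. A \<in> \<A> \<Longrightarrow> m \<le> Suc L \<Longrightarrow> ?D k A m < 2 / B"
    by (auto simp: eventually_sequentially)
  have law: "\<bar>prob (A \<inter> {\<omega>\<in>space M. J k N \<omega> = l}) - prob (A \<inter> {\<omega>\<in>space M. I N \<omega> = l})\<bar> < e" if A: "A \<in> \<A>" for A l
  proof (cases "l < L")
    case True
    have AM [measurable]: "A \<in> events" using A fin H by (auto simp: subalgebra_def)
    have split: "prob (A \<inter> {\<omega>\<in>space M. V \<omega> = l})
        = prob (A \<inter> {\<omega>\<in>space M. l \<le> V \<omega>}) - prob (A \<inter> {\<omega>\<in>space M. Suc l \<le> V \<omega>})"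
      if [measurable]: "V \<in> measurable M (count_space UNIV)" for V :: "'a \<Rightarrow> nat"
      by (subst finite_measure_Diff[symmetric]) (auto intro!: arg_cong[where f=prob])
    show ?thesis
      using k[OF A, of l] k[OF A, of "Suc l"] True Be unfolding split[OF JM] split[OF IM] by linarith
  next
    case False
    have "{\<omega>\<in>space M. J k N \<omega> = l} = {}" "{\<omega>\<in>space M. I N \<omega> = l} = {}"
      using Jless[of k N] Iless False by (auto simp: L_def)
    then show ?thesis using e by (simp only: Int_empty_right)
  qed
  show ?thesis
    by (intro exI[of _ "J k"]) (use Jm Jdiv Jless law in auto)
qed

section \<open>Path vectors, coded histories and the quantitative approximation\<close>

lemma restrict_vector_measurable:
  fixes W :: "nat \<Rightarrow> 'a \<Rightarrow> 'b::second_countable_topology"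
  assumes "\<And>i. i \<in> A \<Longrightarrow> W i \<in> borel_measurable K"
  shows "(\<lambda>\<omega>. restrict (\<lambda>i. W i \<omega>) A) \<in> borel_measurable K"
proof (rule measurable_coordinatewise_then_product)
  fix i show "(\<lambda>\<omega>. restrict (\<lambda>i. W i \<omega>) A i) \<in> borel_measurable K"
    using assms by (cases "i \<in> A") auto
qed

lemma space_nat_filt [simp]: "space (nat_filt M X n) = space M"
  by (simp add: nat_filt_def)

lemma nat_filt_coordinate_measurable:
  fixes X :: "nat \<Rightarrow> 'a \<Rightarrow> 'b::second_countable_topology"
  assumes "i \<in> {1..n}"
  shows "X i \<in> borel_measurable (nat_filt M X n)"
proof -
  have "(\<lambda>\<omega>. restrict (\<lambda>i. X i \<omega>) {1..n}) \<in> borel_measurable (nat_filt M X n)"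
    using measurable_vimage_algebra1[of "\<lambda>\<omega>. restrict (\<lambda>i. X i \<omega>) {1..n}" "space M" borel]
    by (simp add: measurable_cong_sets[OF sets_nat_filt refl])
  then have "(\<lambda>\<omega>. restrict (\<lambda>i. X i \<omega>) {1..n} i) \<in> borel_measurable (nat_filt M X n)"
    by (rule measurable_product_then_coordinatewise)
  then show ?thesis using assms by simp
qed

lemma subalgebra_nat_filt:
  fixes X :: "nat \<Rightarrow> 'a \<Rightarrow> 'b::second_countable_topology"
  assumes "space K = space M" "\<And>i. i \<in> {1..n} \<Longrightarrow> X i \<in> borel_measurable K"
  shows "subalgebra K (nat_filt M X n)"
proof -
  have "(\<lambda>\<omega>. restrict (\<lambda>i. X i \<omega>) {1..n}) \<in> borel_measurable K"
    by (rule restrict_vector_measurable) (rule assms(2))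
  from sets_image_in_sets[OF assms(1) this] show ?thesis
    using assms(1) by (simp add: subalgebra_def sets_nat_filt)
qed

lemma conv_in_law_continuous_map:
  assumes conv: "conv_in_law M UNIV Wk W" and f: "continuous_on UNIV f"
  shows "conv_in_law M UNIV (\<lambda>k \<omega>. f (Wk k \<omega>)) (\<lambda>\<omega>. f (W \<omega>))"
  unfolding conv_in_law_def
proof (intro allI impI)
  fix F :: "'c \<Rightarrow> real" assume F: "continuous_on UNIV F \<and> bounded (range F)"
  have "continuous_on UNIV (\<lambda>x. F (f x))"
    using continuous_on_compose2[OF conjunct1[OF F] f] by simp
  moreover have "bounded (range (\<lambda>x. F (f x)))"
    using F by (elim conjE bounded_subset) auto
  ultimately show "(\<lambda>k. \<integral>\<omega>. F (f (Wk k \<omega>)) \<partial>M) \<longlonglongrightarrow> (\<integral>\<omega>. F (f (W \<omega>)) \<partial>M)"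
    using conv unfolding conv_in_law_def by blast
qed

lemma continuous_on_restrict_fun:
  "continuous_on UNIV (\<lambda>x :: 'i \<Rightarrow> 'b::topological_space. restrict x A)"
proof (rule continuous_on_coordinatewise_then_product)
  fix i show "continuous_on UNIV (\<lambda>x :: 'i \<Rightarrow> 'b. restrict x A i)"
    by (cases "i \<in> A") auto
qed

lemma continuous_on_snd_restrict:
  "continuous_on UNIV (\<lambda>p :: 'z::topological_space \<times> ('i \<Rightarrow> 'b::topological_space). (fst p, restrict (snd p) A))"
  by (intro continuous_on_Pair continuous_on_fst continuous_on_id
      continuous_on_compose2[OF continuous_on_restrict_fun continuous_on_snd[OF continuous_on_id]]) auto

text \<open>The joint law lives on \<open>a * L\<close> cells, each contributing an error of at most
  \<open>e\<close>.\<close>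

lemma (in prob_space) finite_law_estimate:
  fixes r I J :: "'a \<Rightarrow> nat" and h :: "nat \<Rightarrow> nat \<Rightarrow> real"
  assumes m [measurable]: "r \<in> measurable M (count_space UNIV)" "I \<in> measurable M (count_space UNIV)"
      "J \<in> measurable M (count_space UNIV)"
    and less: "\<And>\<omega>. \<omega> \<in> space M \<Longrightarrow> r \<omega> < a" "\<And>\<omega>. \<omega> \<in> space M \<Longrightarrow> I \<omega> < L" "\<And>\<omega>. \<omega> \<in> space M \<Longrightarrow> J \<omega> < L"
    and h: "\<And>i l. \<bar>h i l\<bar> \<le> 1"
    and law: "\<And>i l. i < a \<Longrightarrow> \<bar>prob ({\<omega>\<in>space M. r \<omega> = i} \<inter> {\<omega>\<in>space M. I \<omega> = l})
        - prob ({\<omega>\<in>space M. r \<omega> = i} \<inter> {\<omega>\<in>space M. J \<omega> = l})\<bar> \<le> e"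
  shows "\<bar>(\<integral>\<omega>. h (r \<omega>) (I \<omega>) \<partial>M) - (\<integral>\<omega>. h (r \<omega>) (J \<omega>) \<partial>M)\<bar> \<le> real a * real L * e"
proof -
  let ?A = "\<lambda>V i l. {\<omega>\<in>space M. r \<omega> = i} \<inter> {\<omega>\<in>space M. V \<omega> = l}"
  have ex: "(\<integral>\<omega>. h (r \<omega>) (V \<omega>) \<partial>M) = (\<Sum>(i, l)\<in>{..<a} \<times> {..<L}. h i l * prob (?A V i l))"
    if [measurable]: "V \<in> measurable M (count_space UNIV)" and V: "\<And>\<omega>. \<omega> \<in> space M \<Longrightarrow> V \<omega> < L"
    for V :: "'a \<Rightarrow> nat"
  proof -
    have AM [measurable]: "?A V i l \<in> events" for i l by measurable
    have "(\<integral>\<omega>. h (r \<omega>) (V \<omega>) \<partial>M) = (\<integral>\<omega>. (\<Sum>p\<in>{..<a} \<times> {..<L}. h (fst p) (snd p) * indicator (?A V (fst p) (snd p)) \<omega>) \<partial>M)"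
    proof (rule Bochner_Integration.integral_cong[OF refl])
      fix \<omega> assume w: "\<omega> \<in> space M"
      have "(\<Sum>p\<in>{..<a} \<times> {..<L}. h (fst p) (snd p) * indicator (?A V (fst p) (snd p)) \<omega>)
          = (\<Sum>p\<in>{..<a} \<times> {..<L}. if p = (r \<omega>, V \<omega>) then h (fst p) (snd p) else 0)"
        by (rule sum.cong) (use w in \<open>auto simp: indicator_def\<close>)
      also have "\<dots> = h (r \<omega>) (V \<omega>)" using less(1)[OF w] V[OF w] by (simp add: sum.delta)
      finally show "h (r \<omega>) (V \<omega>) = (\<Sum>p\<in>{..<a} \<times> {..<L}. h (fst p) (snd p) * indicator (?A V (fst p) (snd p)) \<omega>)" by simp
    qed
    also have "\<dots> = (\<Sum>p\<in>{..<a} \<times> {..<L}. \<integral>\<omega>. h (fst p) (snd p) * indicator (?A V (fst p) (snd p)) \<omega> \<partial>M)"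
      by (rule Bochner_Integration.integral_sum)
        (auto intro!: integrable_mult_right integrable_real_indicator simp: emeasure_eq_measure)
    also have "\<dots> = (\<Sum>p\<in>{..<a} \<times> {..<L}. h (fst p) (snd p) * prob (?A V (fst p) (snd p)))"
      by (rule sum.cong) (auto simp: sets.Int_space_eq2[OF AM])
    finally show ?thesis by (simp add: case_prod_unfold)
  qed
  have eI: "(\<integral>\<omega>. h (r \<omega>) (I \<omega>) \<partial>M) = (\<Sum>(i, l)\<in>{..<a} \<times> {..<L}. h i l * prob (?A I i l))"
    and eJ: "(\<integral>\<omega>. h (r \<omega>) (J \<omega>) \<partial>M) = (\<Sum>(i, l)\<in>{..<a} \<times> {..<L}. h i l * prob (?A J i l))"
    using ex[of I] ex[of J] less m by blast+
  have "\<bar>(\<integral>\<omega>. h (r \<omega>) (I \<omega>) \<partial>M) - (\<integral>\<omega>. h (r \<omega>) (J \<omega>) \<partial>M)\<bar>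
      = \<bar>\<Sum>(i, l)\<in>{..<a} \<times> {..<L}. h i l * (prob (?A I i l) - prob (?A J i l))\<bar>"
    unfolding eI eJ
    by (simp add: case_prod_unfold sum_subtractf right_diff_distrib)
  also have "\<dots> \<le> (\<Sum>(i, l)\<in>{..<a} \<times> {..<L}. \<bar>h i l * (prob (?A I i l) - prob (?A J i l))\<bar>)"
    by (simp add: case_prod_unfold)
  also have "\<dots> \<le> (\<Sum>(i, l)\<in>{..<a} \<times> {..<L}. e)"
  proof (rule sum_mono, clarsimp)
    fix i l assume "i < a"
    have "\<bar>h i l\<bar> * \<bar>prob (?A I i l) - prob (?A J i l)\<bar> \<le> 1 * e"
      by (intro mult_mono h law \<open>i < a\<close>) auto
    then show "\<bar>h i l * (prob (?A I i l) - prob (?A J i l))\<bar> \<le> e" by (simp add: abs_mult)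
  qed
  also have "\<dots> = real a * real L * e" by (simp add: case_prod_unfold)
  finally show ?thesis .
qed

text \<open>A new state is appended at the low end: division by powers of \<open>R\<close> then
  forgets the latest times, and the remainder modulo \<open>R\<close> is the current state.\<close>

primrec history_code :: "nat \<Rightarrow> (nat \<Rightarrow> nat) \<Rightarrow> nat \<Rightarrow> nat" where
  "history_code R c 0 = 0"
| "history_code R c (Suc n) = history_code R c n * R + c (Suc n)"

lemma history_code_less:
  assumes "\<And>i. i \<in> {1..n} \<Longrightarrow> c i < R" shows "history_code R c n < R ^ n"
  using assms
proof (induction n)
  case (Suc n)
  have "history_code R c n + 1 \<le> R ^ n" using Suc.IH Suc.prems by (simp add: Suc_le_eq)
  then have "(history_code R c n + 1) * R \<le> R ^ n * R" by (rule mult_right_mono) simp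
  moreover have "c (Suc n) < R" using Suc.prems by simp
  ultimately show ?case by (simp add: algebra_simps)
qed simp

lemma history_code_div:
  assumes "n \<le> N" "\<And>i. i \<in> {1..N} \<Longrightarrow> c i < R"
  shows "history_code R c N div R ^ (N - n) = history_code R c n"
  using assms
proof (induction N rule: dec_induct)
  case (step N)
  have c: "c (Suc N) < R" using step.prems by simp
  have "history_code R c (Suc N) div R ^ (Suc N - n) = history_code R c (Suc N) div R div R ^ (N - n)"
    using step.hyps by (simp add: Suc_diff_le div_mult2_eq del: history_code.simps)
  also have "history_code R c (Suc N) div R = history_code R c N" using c by simp
  finally show ?case using step.IH step.prems by simp
qed simp

lemma history_code_mod:
  assumes "n \<ge> 1" "c n < R" shows "history_code R c n mod R = c n"
  using assms by (cases n) auto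

lemma (in prob_space) prob_finite_Union_le:
  fixes e :: real
  assumes "finite S" "\<And>i. i \<in> S \<Longrightarrow> A i \<in> events" "\<And>i. i \<in> S \<Longrightarrow> prob (A i) \<le> e"
  shows "prob (\<Union>i\<in>S. A i) \<le> card S * e"
proof -
  have "prob (\<Union>i\<in>S. A i) \<le> (\<Sum>i\<in>S. prob (A i))"
    by (rule finite_measure_subadditive_finite) (use assms in auto)
  also have "\<dots> \<le> (\<Sum>i\<in>S. e)" by (rule sum_mono) (rule assms(3))
  finally show ?thesis by simp
qed

text \<open>The two vectors are linked by quantising \<open>X\<close> and \<open>Z\<close>,
  exchanging the coded history for one drawn from \<open>Y\<close>, undoing the quantisation of
  \<open>Z\<close>, and making the resulting states continuous in \<open>Y\<close>. The exchange
  compares laws; the other moves are couplings.\<close>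

lemma (in prob_space) bl_adapted_continuous_approximation:
  fixes Z :: "'a \<Rightarrow> 'z::polish_space" and Y :: "nat \<Rightarrow> 'a \<Rightarrow> 'y::polish_space"
    and X :: "nat \<Rightarrow> 'a \<Rightarrow> 'x::polish_space"
  assumes N: "N \<ge> 1" and Z: "Z \<in> borel_measurable M"
    and X: "\<And>n. n \<in> {1..N} \<Longrightarrow> X n \<in> borel_measurable M"
    and pc: "path_connected (UNIV :: 'x set)"
    and na: "nonatomic (distr M borel (Y 1))"
    and Y: "\<And>n. n \<in> {1..N} \<Longrightarrow> Y n \<in> measurable (vimage_algebra (space M) Z borel) borel"
    and ci: "\<And>n. n \<in> {1..N} \<Longrightarrow>
      cond_indep M (nat_filt M X n) (vimage_algebra (space M) Z borel) (nat_filt M Y n)"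
    and e: "e > 0"
  shows "\<exists>f :: nat \<Rightarrow> (nat \<Rightarrow> 'y) \<Rightarrow> 'x. (\<forall>n\<in>{1..N}. continuous_on UNIV (f n)) \<and>
    (\<forall>\<Phi>\<in>bl_functions. \<bar>(\<integral>\<omega>. \<Phi> (Z \<omega>, restrict (\<lambda>n. f n (restrict (\<lambda>i. Y i \<omega>) {1..n})) {1..N}) \<partial>M)
       - (\<integral>\<omega>. \<Phi> (Z \<omega>, restrict (\<lambda>n. X n \<omega>) {1..N}) \<partial>M)\<bar> \<le> e)"
proof -
  let ?H = "vimage_algebra (space M) Z borel"
  let ?V = "\<lambda>n \<omega>. restrict (\<lambda>i. Y i \<omega>) {1..n}"
  note H = subalgebra_vimage_algebra[OF Z]
  have YM: "Y n \<in> borel_measurable M" if "n \<in> {1..N}" for n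
    by (rule measurable_from_subalg[OF H Y[OF that]])
  have VM: "?V n \<in> borel_measurable M" if "n \<in> {1..N}" for n
    by (rule restrict_vector_measurable) (use that YM in auto)
  have G: "subalgebra ?H (nat_filt M Y n)" if "n \<in> {1..N}" for n
    by (rule subalgebra_nat_filt) (use that Y in auto)
  have F: "subalgebra M (nat_filt M X n)" if "n \<in> {1..N}" for n
    by (rule subalgebra_nat_filt) (use that X in auto)
  have ZH: "Z \<in> borel_measurable ?H" by (rule measurable_vimage_algebra1) auto
  have N1: "1 \<in> {1..N}" "N \<in> {1..N}" using N by auto
  \<comment> \<open>The final budget: \<open>5 * d\<close> from distances and the finite law,
    \<open>4 * (N + 1) * d\<close> from two uses of \<open>A0\<close>, and \<open>2 * N * d\<close>
    from \<open>A1\<close>.\<close>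
  define d where "d = e / (6 * N + 9)"
  have d: "d > 0" "(6 * N + 9) * d = e" using e by (auto simp: d_def)

  obtain xq :: "nat \<Rightarrow> 'x" and q where q: "q \<in> measurable borel (count_space UNIV)" "\<And>w. dist w (xq (q w)) < d"
    using ex_countable_quantizer[OF d(1), where 'w='x] by blast
  obtain zq :: "nat \<Rightarrow> 'z" and r where r: "r \<in> measurable borel (count_space UNIV)" "\<And>w. dist w (zq (r w)) < d"
    using ex_countable_quantizer[OF d(1), where 'w='z] by blast
  have qX: "(\<lambda>\<omega>. q (X n \<omega>)) \<in> measurable M (count_space UNIV)" if "n \<in> {1..N}" for n
    by (rule measurable_compose[OF X[OF that] q(1)])
  have rZ: "(\<lambda>\<omega>. r (Z \<omega>)) \<in> measurable M (count_space UNIV)"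
    by (rule measurable_compose[OF Z r(1)])
  have "eventually (\<lambda>R. (\<forall>n\<in>{1..N}. prob {\<omega>\<in>space M. R \<le> q (X n \<omega>)} < d) \<and>
      prob {\<omega>\<in>space M. R \<le> r (Z \<omega>)} < d \<and> R > 0) sequentially"
    by (intro eventually_conj eventually_ball_finite ballI prob_tail_less qX rZ d eventually_gt_at_top) auto
  then obtain R where R: "\<And>n. n \<in> {1..N} \<Longrightarrow> prob {\<omega>\<in>space M. R \<le> q (X n \<omega>)} < d"
      "prob {\<omega>\<in>space M. R \<le> r (Z \<omega>)} < d" "R > 0"
    using eventually_happens'[OF sequentially_bot] by blast
  define A0 where "A0 = (\<Union>n\<in>{1..N}. {\<omega>\<in>space M. R \<le> q (X n \<omega>)}) \<union> {\<omega>\<in>space M. R \<le> r (Z \<omega>)}"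
  have qe: "{\<omega>\<in>space M. R \<le> q (X n \<omega>)} \<in> events" if "n \<in> {1..N}" for n
    using measurable_sets[OF qX[OF that], of "{R..}"] by (simp add: vimage_def Int_def conj_commute)
  have re: "{\<omega>\<in>space M. R \<le> r (Z \<omega>)} \<in> events"
    using measurable_sets[OF rZ, of "{R..}"] by (simp add: vimage_def Int_def conj_commute)
  have A0e: "A0 \<in> events" unfolding A0_def using qe re by auto
  have A0p: "prob A0 \<le> (N + 1) * d"
  proof -
    have "prob A0 \<le> prob (\<Union>n\<in>{1..N}. {\<omega>\<in>space M. R \<le> q (X n \<omega>)}) + prob {\<omega>\<in>space M. R \<le> r (Z \<omega>)}"
      unfolding A0_def by (rule measure_Un_le) (use qe re in auto)
    also have "prob (\<Union>n\<in>{1..N}. {\<omega>\<in>space M. R \<le> q (X n \<omega>)}) \<le> card {1..N} * d"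
      by (rule prob_finite_Union_le) (use qe R(1) in \<open>auto intro: less_imp_le\<close>)
    finally show ?thesis using R(2) by (simp add: algebra_simps)
  qed

  \<comment> \<open>Indices beyond \<open>R\<close> are sent to the default 0, which changes nothing
    outside the small event \<open>A0\<close>; \<open>R > 0\<close> makes 0 a legitimate
    digit.\<close>
  define c where "c n \<omega> = (if q (X n \<omega>) < R then q (X n \<omega>) else 0)" for n \<omega>
  define rho where "rho \<omega> = (if r (Z \<omega>) < R then r (Z \<omega>) else 0)" for \<omega>
  have cR: "c n \<omega> < R" for n \<omega> using R(3) by (simp add: c_def)
  have rhoR: "rho \<omega> < R" for \<omega> using R(3) by (simp add: rho_def)
  have rhoH: "rho \<in> measurable ?H (count_space UNIV)"
    unfolding rho_def
    by (rule measurable_compose[OF measurable_compose[OF ZH r(1)], of "\<lambda>i. if i < R then i else 0"]) simp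
  have rhoM [measurable]: "rho \<in> measurable M (count_space UNIV)" by (rule measurable_from_subalg[OF H rhoH])
  have cF: "c i \<in> measurable (nat_filt M X n) (count_space UNIV)" if "i \<in> {1..n}" for i n
    unfolding c_def
    by (rule measurable_compose[OF measurable_compose[OF nat_filt_coordinate_measurable[OF that] q(1)],
          of "\<lambda>i. if i < R then i else 0"]) simp
  define I where "I n \<omega> = history_code R (\<lambda>i. c i \<omega>) n" for n \<omega>
  have IF: "I m \<in> measurable (nat_filt M X n) (count_space UNIV)" if "m \<le> n" for m n
    using that
  proof (induction m)
    case 0
    have "I 0 = (\<lambda>_. 0)" by (auto simp: I_def)
    then show ?case by simp
  next
    case (Suc m)
    have [measurable]: "I m \<in> measurable (nat_filt M X n) (count_space UNIV)" by (rule Suc.IH) (use Suc in simp)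
    have [measurable]: "c (Suc m) \<in> measurable (nat_filt M X n) (count_space UNIV)" by (rule cF) (use Suc in simp)
    have "I (Suc m) = (\<lambda>\<omega>. I m \<omega> * R + c (Suc m) \<omega>)" by (auto simp: I_def)
    moreover have "\<dots> \<in> measurable (nat_filt M X n) (count_space UNIV)" by measurable
    ultimately show ?case by simp
  qed
  have IM [measurable]: "I N \<in> measurable M (count_space UNIV)"
    by (rule measurable_from_subalg[OF F[OF N1(2)] IF]) simp
  have Idiv: "I n \<omega> = I N \<omega> div R ^ (N - n)" if "n \<in> {1..N}" for n \<omega>
    using history_code_div[of n N "\<lambda>i. c i \<omega>" R] that cR by (simp add: I_def)
  have Iless: "I N \<omega> < R ^ N" for \<omega>
    unfolding I_def by (rule history_code_less) (rule cR)
  have cI: "c n \<omega> = I N \<omega> div R ^ (N - n) mod R" if "n \<in> {1..N}" for n \<omega>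
    using history_code_mod[of n "\<lambda>i. c i \<omega>" R] that cR Idiv[OF that, of \<omega>] by (simp add: I_def)

  obtain T :: "'y \<Rightarrow> real" where T: "T \<in> borel_measurable borel" "\<And>y. 0 \<le> T y \<and> T y \<le> 1"
      "\<And>x. 0 \<le> x \<Longrightarrow> x \<le> 1 \<Longrightarrow> prob {\<omega>\<in>space M. T (Y 1 \<omega>) < x} = x"
    using ex_uniform_of_nonatomic[OF YM[OF N1(1)] na] by blast
  have TG: "(\<lambda>\<omega>. T (Y 1 \<omega>)) \<in> borel_measurable (nat_filt M Y n)" if "n \<in> {1..N}" for n
    by (rule measurable_compose[OF nat_filt_coordinate_measurable T(1)]) (use that in auto)
  define L where "L = R ^ N"
  \<comment> \<open>Matching the law of the history on each cell of the quantised \<open>Z\<close>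
    amounts to matching the joint law.\<close>
  define \<A> where "\<A> = (\<lambda>i. {\<omega>\<in>space M. rho \<omega> = i}) ` {..<R}"
  have sub: "\<A> \<subseteq> sets ?H"
  proof
    fix A assume "A \<in> \<A>"
    then obtain i where "A = {\<omega>\<in>space M. rho \<omega> = i}" by (auto simp: \<A>_def)
    then show "A \<in> sets ?H"
      using measurable_sets[OF rhoH, of "{i}"] by (simp add: vimage_def Int_def conj_commute)
  qed
  have finA: "finite \<A>" by (simp add: \<A>_def)
  \<comment> \<open>The tolerance per cell: there are \<open>R\<close> cells for \<open>Z\<close>
    and \<open>L\<close> histories, so the total error is \<open>d\<close>.\<close>
  have pos: "d / (real R * real L) > 0" using d R(3) by (simp add: L_def)
  obtain J where J: "\<And>n. n \<in> {1..N} \<Longrightarrow> J n \<in> measurable (nat_filt M Y n) (count_space UNIV)"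
      "AE \<omega> in M. \<forall>n\<in>{1..N}. J n \<omega> = J N \<omega> div R ^ (N - n)" "\<And>\<omega>. J N \<omega> < R ^ N"
      "\<And>A l. A \<in> \<A> \<Longrightarrow> \<bar>prob (A \<inter> {\<omega>\<in>space M. J N \<omega> = l}) - prob (A \<inter> {\<omega>\<in>space M. I N \<omega> = l})\<bar> < d / (real R * real L)"
    using adapted_law_approximation[OF H N R(3) G TG T(2,3) F ci IF[OF order_refl] Idiv Iless finA sub pos]
    by blast
  have MG: "subalgebra M (nat_filt M Y n)" if "n \<in> {1..N}" for n
    using H G[OF that] by (auto simp: subalgebra_def)
  have JM [measurable]: "J n \<in> measurable M (count_space UNIV)" if "n \<in> {1..N}" for n
    by (rule measurable_from_subalg[OF MG[OF that] J(1)[OF that]])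

  have "\<exists>(f :: (nat \<Rightarrow> 'y) \<Rightarrow> 'x) A. continuous_on UNIV f \<and> A \<in> events \<and> prob A < d \<and>
      (\<forall>\<omega>\<in>space M. \<omega> \<notin> A \<longrightarrow> f (?V n \<omega>) = xq (J n \<omega> mod R))" if n: "n \<in> {1..N}" for n
  proof (rule continuous_approx_finite_valued[OF pc VM[OF n] _ _ d(1), of "\<lambda>\<omega>. J n \<omega> mod R" R])
    have "(\<lambda>\<omega>. J n \<omega> mod R) \<in> measurable (nat_filt M Y n) (count_space UNIV)"
      by (rule measurable_compose[OF J(1)[OF n], of "\<lambda>i. i mod R"]) simp
    then show "(\<lambda>\<omega>. J n \<omega> mod R) \<in> measurable (vimage_algebra (space M) (?V n) borel) (count_space UNIV)"
      by (simp only: measurable_cong_sets[OF sets_nat_filt refl])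
  qed (use R(3) in simp)
  then obtain f :: "nat \<Rightarrow> (nat \<Rightarrow> 'y) \<Rightarrow> 'x" and A where
    f: "\<And>n. n \<in> {1..N} \<Longrightarrow> continuous_on UNIV (f n)" "\<And>n. n \<in> {1..N} \<Longrightarrow> A n \<in> events"
      "\<And>n. n \<in> {1..N} \<Longrightarrow> prob (A n) < d"
      "\<And>n \<omega>. n \<in> {1..N} \<Longrightarrow> \<omega> \<in> space M \<Longrightarrow> \<omega> \<notin> A n \<Longrightarrow> f n (?V n \<omega>) = xq (J n \<omega> mod R)"
    by metis
  define A1 where "A1 = (\<Union>n\<in>{1..N}. A n)"
  have A1e: "A1 \<in> events" unfolding A1_def using f(2) by auto
  have A1p: "prob A1 \<le> N * d"
    using prob_finite_Union_le[of "{1..N}" A d] f(2,3) by (auto simp: A1_def intro: less_imp_le)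

  let ?X = "\<lambda>\<omega>. restrict (\<lambda>n. X n \<omega>) {1..N}"
  let ?XI = "\<lambda>\<omega>. restrict (\<lambda>n. xq (c n \<omega>)) {1..N}"
  let ?XJ = "\<lambda>\<omega>. restrict (\<lambda>n. xq (J n \<omega> mod R)) {1..N}"
  let ?XC = "\<lambda>\<omega>. restrict (\<lambda>n. f n (?V n \<omega>)) {1..N}"
  have cM: "c n \<in> measurable M (count_space UNIV)" if "n \<in> {1..N}" for n
    by (rule measurable_from_subalg[OF F[OF that] cF]) (use that in simp)
  have m: "?X \<in> borel_measurable M" "?XI \<in> borel_measurable M" "?XJ \<in> borel_measurable M" "?XC \<in> borel_measurable M"
  proof -
    show "?X \<in> borel_measurable M" by (rule restrict_vector_measurable) (rule X)
    show "?XI \<in> borel_measurable M"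
      by (rule restrict_vector_measurable) (rule measurable_compose[OF cM], auto)
    show "?XJ \<in> borel_measurable M"
      by (rule restrict_vector_measurable)
        (rule measurable_compose[OF JM, of _ "\<lambda>i. xq (i mod R)"], auto)
    show "?XC \<in> borel_measurable M"
      by (rule restrict_vector_measurable)
        (rule measurable_compose[OF VM borel_measurable_continuous_onI[OF f(1)]])
  qed
  let ?Zd = "\<lambda>\<omega>. zq (rho \<omega>)"
  have Zd: "?Zd \<in> borel_measurable M" by (rule measurable_compose[OF rhoM]) auto
  have dZ: "dist (Z \<omega>) (?Zd \<omega>) \<le> d" if "\<omega> \<in> space M" "\<omega> \<notin> A0" for \<omega>
    using that r(2)[of "Z \<omega>"] by (auto simp: A0_def rho_def less_imp_le)
  have dX: "dist (?X \<omega>) (?XI \<omega>) \<le> 2 * d" if w: "\<omega> \<in> space M" "\<omega> \<notin> A0" for \<omega>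
  proof (rule dist_fun_le)
    fix i show "dist (?X \<omega> i) (?XI \<omega> i) \<le> d"
    proof (cases "i \<in> {1..N}")
      case True
      then have "c i \<omega> = q (X i \<omega>)" using w by (auto simp: A0_def c_def not_le)
      then show ?thesis using True q(2)[of "X i \<omega>"] by (simp add: less_imp_le)
    qed (use d in auto)
  qed
  have "\<bar>(\<integral>\<omega>. \<Phi> (Z \<omega>, ?XC \<omega>) \<partial>M) - (\<integral>\<omega>. \<Phi> (Z \<omega>, ?X \<omega>) \<partial>M)\<bar> \<le> e" if \<Phi>: "\<Phi> \<in> bl_functions" for \<Phi>
  proof -
    \<comment> \<open>\<open>d\<close> for \<open>Z\<close> and \<open>2 * d\<close> for the path,
      by the weights in the metric on functions.\<close>
    have s1: "\<bar>(\<integral>\<omega>. \<Phi> (Z \<omega>, ?X \<omega>) \<partial>M) - (\<integral>\<omega>. \<Phi> (?Zd \<omega>, ?XI \<omega>) \<partial>M)\<bar> \<le> 3 * d + 2 * prob A0"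
    proof (rule bl_coupling[OF \<Phi> borel_measurable_Pair[OF Z m(1)] borel_measurable_Pair[OF Zd m(2)] A0e])
      fix \<omega> assume "\<omega> \<in> space M" "\<omega> \<notin> A0"
      then show "dist (Z \<omega>, ?X \<omega>) (?Zd \<omega>, ?XI \<omega>) \<le> 3 * d"
        using dist_prod_le[of "Z \<omega>" "?X \<omega>" "?Zd \<omega>" "?XI \<omega>"] dZ[of \<omega>] dX[of \<omega>] by linarith
    qed (use d in simp)
    have s3: "\<bar>(\<integral>\<omega>. \<Phi> (Z \<omega>, ?XJ \<omega>) \<partial>M) - (\<integral>\<omega>. \<Phi> (?Zd \<omega>, ?XJ \<omega>) \<partial>M)\<bar> \<le> d + 2 * prob A0"
    proof (rule bl_coupling[OF \<Phi> borel_measurable_Pair[OF Z m(3)] borel_measurable_Pair[OF Zd m(3)] A0e])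
      fix \<omega> assume "\<omega> \<in> space M" "\<omega> \<notin> A0"
      then show "dist (Z \<omega>, ?XJ \<omega>) (?Zd \<omega>, ?XJ \<omega>) \<le> d"
        using dist_prod_le[of "Z \<omega>" "?XJ \<omega>" "?Zd \<omega>" "?XJ \<omega>"] dZ[of \<omega>] unfolding dist_self by linarith
    qed (use d in simp)
    have s4: "\<bar>(\<integral>\<omega>. \<Phi> (Z \<omega>, ?XC \<omega>) \<partial>M) - (\<integral>\<omega>. \<Phi> (Z \<omega>, ?XJ \<omega>) \<partial>M)\<bar> \<le> 0 + 2 * prob A1"
    proof (rule bl_coupling[OF \<Phi> borel_measurable_Pair[OF Z m(4)] borel_measurable_Pair[OF Z m(3)] A1e])
      fix \<omega> assume "\<omega> \<in> space M" "\<omega> \<notin> A1"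
      then have "?XC \<omega> = ?XJ \<omega>" by (intro restrict_ext f(4)) (auto simp: A1_def)
      then show "dist (Z \<omega>, ?XC \<omega>) (Z \<omega>, ?XJ \<omega>) \<le> 0" by simp
    qed simp
    \<comment> \<open>Decodes a full history into its path, turning both expectations into functions
      of two integers. For \<open>J\<close> the decoded path is the adapted one almost surely, which
      is where compatibility in time is used.\<close>
    define h where "h i l = \<Phi> (zq i, restrict (\<lambda>n. xq (l div R ^ (N - n) mod R)) {1..N})" for i l
    have hI: "\<Phi> (?Zd \<omega>, ?XI \<omega>) = h (rho \<omega>) (I N \<omega>)" for \<omega>
      unfolding h_def by (intro arg_cong[where f=\<Phi>] prod_eqI) (auto intro!: restrict_ext simp: cI)
    have hJ: "(\<integral>\<omega>. \<Phi> (?Zd \<omega>, ?XJ \<omega>) \<partial>M) = (\<integral>\<omega>. h (rho \<omega>) (J N \<omega>) \<partial>M)"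
    proof (rule integral_cong_AE)
      show "AE \<omega> in M. \<Phi> (?Zd \<omega>, ?XJ \<omega>) = h (rho \<omega>) (J N \<omega>)"
        using J(2)
      proof eventually_elim
        case (elim \<omega>)
        show ?case
          unfolding h_def by (intro arg_cong[where f=\<Phi>] prod_eqI) (use elim in \<open>auto intro!: restrict_ext\<close>)
      qed
      show "(\<lambda>\<omega>. \<Phi> (?Zd \<omega>, ?XJ \<omega>)) \<in> borel_measurable M"
        by (rule measurable_compose[OF borel_measurable_Pair[OF Zd m(3)]
              borel_measurable_continuous_onI[OF bl_functions_continuous[OF \<Phi>]]])
      have JN [measurable]: "J N \<in> measurable M (count_space UNIV)" by (rule JM[OF N1(2)])
      show "(\<lambda>\<omega>. h (rho \<omega>) (J N \<omega>)) \<in> borel_measurable M" by measurable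
    qed
    have s2: "\<bar>(\<integral>\<omega>. h (rho \<omega>) (I N \<omega>) \<partial>M) - (\<integral>\<omega>. h (rho \<omega>) (J N \<omega>) \<partial>M)\<bar> \<le> real R * real L * (d / (real R * real L))"
    proof (rule finite_law_estimate[OF rhoM IM JM[OF N1(2)] rhoR])
      fix i l assume "i < R"
      then show "\<bar>prob ({\<omega>\<in>space M. rho \<omega> = i} \<inter> {\<omega>\<in>space M. I N \<omega> = l})
          - prob ({\<omega>\<in>space M. rho \<omega> = i} \<inter> {\<omega>\<in>space M. J N \<omega> = l})\<bar> \<le> d / (real R * real L)"
        using J(4)[of "{\<omega>\<in>space M. rho \<omega> = i}" l] by (auto simp: \<A>_def abs_minus_commute intro: less_imp_le)
    next
      fix i l show "\<bar>h i l\<bar> \<le> 1" using \<Phi> by (auto simp: h_def bl_functions_def)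
    qed (use Iless J(3) in \<open>auto simp: L_def\<close>)
    have RL: "real R * real L * (d / (real R * real L)) = d" using R(3) by (simp add: L_def)
    have "\<bar>(\<integral>\<omega>. \<Phi> (Z \<omega>, ?XC \<omega>) \<partial>M) - (\<integral>\<omega>. \<Phi> (Z \<omega>, ?X \<omega>) \<partial>M)\<bar> \<le> 5 * d + 4 * prob A0 + 2 * prob A1"
      using s1 s2[unfolded RL] s3 s4 unfolding hI hJ by linarith
    also have "\<dots> \<le> 5 * d + 4 * ((N + 1) * d) + 2 * (N * d)" using A0p A1p by linarith
    also have "\<dots> = e" using d(2) by (simp add: algebra_simps)
    finally show ?thesis .
  qed
  then show ?thesis using f(1) by blast
qed

section \<open>The equivalence of the three conditions\<close>

theorem theorem3p1:
  fixes M :: "'a measure"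
    and Z :: "'a \<Rightarrow> 'z::polish_space"
    and Y :: "nat \<Rightarrow> 'a \<Rightarrow> 'y::polish_space"
    and X :: "nat \<Rightarrow> 'a \<Rightarrow> 'x::polish_space"
    and C :: "'v::{real_vector, t2_space} set"
    and N :: nat
  assumes "prob_space M"
    and "N \<ge> 1"
    and "Z \<in> borel_measurable M"
    and "\<forall>n\<in>{1..N}. X n \<in> borel_measurable M"
    and "locally_convex_tvs TYPE('v)" and "convex C" and "(UNIV :: 'x set) homeomorphic C"
    and "nonatomic (distr M borel (Y 1))"
    and "\<forall>n\<in>{1..N}. Y n \<in> measurable (vimage_algebra (space M) Z borel) borel"
  shows
   "((\<forall>n\<in>{1..N}. cond_indep M (nat_filt M X n) (vimage_algebra (space M) Z borel) (nat_filt M Y n))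
     \<longleftrightarrow>
     (\<exists>Xk :: nat \<Rightarrow> nat \<Rightarrow> 'a \<Rightarrow> 'x.
        (\<forall>k. \<forall>n\<in>{1..N}. Xk k n \<in> measurable (nat_filt M Y n) borel) \<and>
        conv_in_law M (UNIV \<times> Pi\<^sub>E {1..N} (\<lambda>_. UNIV))
          (\<lambda>k \<omega>. (Z \<omega>, restrict (\<lambda>i. Xk k i \<omega>) {1..N}))
          (\<lambda>\<omega>. (Z \<omega>, restrict (\<lambda>i. X i \<omega>) {1..N}))))
   \<and>
    ((\<exists>Xk :: nat \<Rightarrow> nat \<Rightarrow> 'a \<Rightarrow> 'x.
        (\<forall>k. \<forall>n\<in>{1..N}. Xk k n \<in> measurable (nat_filt M Y n) borel) \<and>
        conv_in_law M (UNIV \<times> Pi\<^sub>E {1..N} (\<lambda>_. UNIV))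
          (\<lambda>k \<omega>. (Z \<omega>, restrict (\<lambda>i. Xk k i \<omega>) {1..N}))
          (\<lambda>\<omega>. (Z \<omega>, restrict (\<lambda>i. X i \<omega>) {1..N})))
     \<longleftrightarrow>
     (\<exists>Xk :: nat \<Rightarrow> nat \<Rightarrow> 'a \<Rightarrow> 'x.
        (\<forall>k. \<forall>n\<in>{1..N}. Xk k n \<in> measurable (nat_filt M Y n) borel) \<and>
        conv_in_law M (UNIV \<times> Pi\<^sub>E {1..N} (\<lambda>_. UNIV))
          (\<lambda>k \<omega>. (Z \<omega>, restrict (\<lambda>i. Xk k i \<omega>) {1..N}))
          (\<lambda>\<omega>. (Z \<omega>, restrict (\<lambda>i. X i \<omega>) {1..N})) \<and>
        (\<exists>f :: nat \<Rightarrow> nat \<Rightarrow> (nat \<Rightarrow> 'y) \<Rightarrow> 'x. \<forall>k. \<forall>n\<in>{1..N}.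
           continuous_on (Pi\<^sub>E {1..n} (\<lambda>_. UNIV)) (f k n) \<and>
           (\<forall>\<omega>\<in>space M. Xk k n \<omega> = f k n (restrict (\<lambda>i. Y i \<omega>) {1..n})))))"
proof -
  interpret prob_space M by fact
  let ?H = "vimage_algebra (space M) Z borel"
  let ?S = "UNIV \<times> Pi\<^sub>E {1..N} (\<lambda>_. UNIV) :: ('z \<times> (nat \<Rightarrow> 'x)) set"
  let ?V = "\<lambda>n \<omega>. restrict (\<lambda>i. Y i \<omega>) {1..n}"
  note Z = assms(3)
  have N: "N \<ge> 1" by fact
  have X: "X n \<in> borel_measurable M" if "n \<in> {1..N}" for n using assms(4) that by blast
  have Y: "Y n \<in> borel_measurable ?H" if "n \<in> {1..N}" for n using assms(9) that by blast
  note H = subalgebra_vimage_algebra[OF Z]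
  have G: "subalgebra ?H (nat_filt M Y n)" if "n \<in> {1..N}" for n
    by (rule subalgebra_nat_filt) (use that Y in auto)
  have MG: "subalgebra M (nat_filt M Y n)" if "n \<in> {1..N}" for n
    using H G[OF that] by (auto simp: subalgebra_def)
  \<comment> \<open>Convexity enters through path-connectedness, which the homeomorphism transports
    to \<open>'x\<close>.\<close>
  have pc: "path_connected (UNIV :: 'x set)"
    by (rule iffD2[OF homeomorphic_path_connectedness[OF assms(7)] path_connected_convex_tvs[OF assms(5,6)]])
  define i1 where "i1 \<longleftrightarrow> (\<forall>n\<in>{1..N}. cond_indep M (nat_filt M X n) ?H (nat_filt M Y n))"
  define conv where "conv Xk \<longleftrightarrow> conv_in_law M ?S
      (\<lambda>k \<omega>. (Z \<omega>, restrict (\<lambda>i. Xk k i \<omega>) {1..N})) (\<lambda>\<omega>. (Z \<omega>, restrict (\<lambda>i. X i \<omega>) {1..N}))"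
    for Xk :: "nat \<Rightarrow> nat \<Rightarrow> 'a \<Rightarrow> 'x"
  define adapted where "adapted Xk \<longleftrightarrow> (\<forall>k. \<forall>n\<in>{1..N}. Xk k n \<in> measurable (nat_filt M Y n) borel)"
    for Xk :: "nat \<Rightarrow> nat \<Rightarrow> 'a \<Rightarrow> 'x"
  define cont where "cont Xk \<longleftrightarrow> (\<exists>f :: nat \<Rightarrow> nat \<Rightarrow> (nat \<Rightarrow> 'y) \<Rightarrow> 'x. \<forall>k. \<forall>n\<in>{1..N}.
      continuous_on (Pi\<^sub>E {1..n} (\<lambda>_. UNIV)) (f k n) \<and> (\<forall>\<omega>\<in>space M. Xk k n \<omega> = f k n (?V n \<omega>)))"
    for Xk :: "nat \<Rightarrow> nat \<Rightarrow> 'a \<Rightarrow> 'x"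
  \<comment> \<open>Restriction of the second component to \<open>{1..N}\<close> is the continuous
    retraction onto \<open>?S\<close>.\<close>
  have conv_iff: "conv Xk \<longleftrightarrow> conv_in_law M UNIV
      (\<lambda>k \<omega>. (Z \<omega>, restrict (\<lambda>i. Xk k i \<omega>) {1..N})) (\<lambda>\<omega>. (Z \<omega>, restrict (\<lambda>i. X i \<omega>) {1..N}))"
    for Xk :: "nat \<Rightarrow> nat \<Rightarrow> 'a \<Rightarrow> 'x"
    unfolding conv_def
    by (rule conv_in_law_retract_iff[OF continuous_on_snd_restrict[of "{1..N}"]])
      (auto simp: PiE_restrict)
  have "i1" if "adapted Xk" "conv Xk" for Xk
    unfolding i1_def
  proof
    fix n assume n: "n \<in> {1..N}"
    let ?W = "\<lambda>\<omega>. restrict (\<lambda>i. X i \<omega>) {1..n}"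
    have "?W \<in> borel_measurable M" by (rule restrict_vector_measurable) (use X n in auto)
    moreover have "(\<lambda>\<omega>. restrict (\<lambda>i. Xk k i \<omega>) {1..n}) \<in> borel_measurable (nat_filt M Y n)" for k
    proof (rule restrict_vector_measurable)
      fix i assume i: "i \<in> {1..n}"
      have "subalgebra (nat_filt M Y n) (nat_filt M Y i)"
        by (rule subalgebra_nat_filt) (use i nat_filt_coordinate_measurable[of _ n Y M] in auto)
      moreover have "Xk k i \<in> borel_measurable (nat_filt M Y i)"
        using that(1) i n unfolding adapted_def by auto
      ultimately show "Xk k i \<in> borel_measurable (nat_filt M Y n)" by (rule measurable_from_subalg)
    qed
    \<comment> \<open>Condition (i) at time \<open>n\<close> sees the first \<open>n\<close>
      coordinates; truncating paths is continuous and so preserves convergence in law.\<close>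
    moreover have "conv_in_law M UNIV (\<lambda>k \<omega>. (Z \<omega>, restrict (\<lambda>i. Xk k i \<omega>) {1..n})) (\<lambda>\<omega>. (Z \<omega>, ?W \<omega>))"
    proof -
      have "restrict (restrict x {1..N}) {1..n} = restrict x {1..n}" for x :: "nat \<Rightarrow> 'x"
        using n by (auto simp: restrict_def)
      then show ?thesis
        using conv_in_law_continuous_map[OF that(2)[unfolded conv_iff] continuous_on_snd_restrict[of "{1..n}"]]
        by simp
    qed
    ultimately have "cond_indep M (vimage_algebra (space M) ?W borel) ?H (nat_filt M Y n)"
      by (rule cond_indep_of_conv_in_law[OF Z _ G[OF n]])
    then show "cond_indep M (nat_filt M X n) ?H (nat_filt M Y n)"
      unfolding cond_indep_def sets_nat_filt .
  qed
  moreover have "\<exists>Xk. adapted Xk \<and> conv Xk \<and> cont Xk" if i1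
  proof -
    have ci: "cond_indep M (nat_filt M X n) ?H (nat_filt M Y n)" if "n \<in> {1..N}" for n
      using \<open>i1\<close> that unfolding i1_def by blast
    have "\<forall>k. \<exists>f :: nat \<Rightarrow> (nat \<Rightarrow> 'y) \<Rightarrow> 'x. (\<forall>n\<in>{1..N}. continuous_on UNIV (f n)) \<and>
      (\<forall>\<Phi>\<in>bl_functions. \<bar>(\<integral>\<omega>. \<Phi> (Z \<omega>, restrict (\<lambda>n. f n (?V n \<omega>)) {1..N}) \<partial>M)
        - (\<integral>\<omega>. \<Phi> (Z \<omega>, restrict (\<lambda>n. X n \<omega>) {1..N}) \<partial>M)\<bar> \<le> inverse (real (Suc k)))"
      by (intro allI bl_adapted_continuous_approximation[OF N Z X pc assms(8) Y ci]) auto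
    from choice[OF this] obtain f :: "nat \<Rightarrow> nat \<Rightarrow> (nat \<Rightarrow> 'y) \<Rightarrow> 'x" where
      f: "\<And>k n. n \<in> {1..N} \<Longrightarrow> continuous_on UNIV (f k n)"
        "\<And>k \<Phi>. \<Phi> \<in> bl_functions \<Longrightarrow> \<bar>(\<integral>\<omega>. \<Phi> (Z \<omega>, restrict (\<lambda>n. f k n (?V n \<omega>)) {1..N}) \<partial>M)
          - (\<integral>\<omega>. \<Phi> (Z \<omega>, restrict (\<lambda>n. X n \<omega>) {1..N}) \<partial>M)\<bar> \<le> inverse (real (Suc k))"
      by blast
    define Xk where "Xk k n \<omega> = f k n (?V n \<omega>)" for k n \<omega>
    have XkG: "Xk k n \<in> borel_measurable (nat_filt M Y n)" if n: "n \<in> {1..N}" for k n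
      unfolding Xk_def
      by (rule measurable_compose[OF restrict_vector_measurable borel_measurable_continuous_onI[OF f(1)[OF n]]])
        (rule nat_filt_coordinate_measurable)
    have "conv_in_law M UNIV (\<lambda>k \<omega>. (Z \<omega>, restrict (\<lambda>i. Xk k i \<omega>) {1..N})) (\<lambda>\<omega>. (Z \<omega>, restrict (\<lambda>i. X i \<omega>) {1..N}))"
    proof (rule conv_in_law_of_bl)
      show "(\<lambda>\<omega>. (Z \<omega>, restrict (\<lambda>i. Xk k i \<omega>) {1..N})) \<in> borel_measurable M" for k
        by (intro borel_measurable_Pair Z restrict_vector_measurable measurable_from_subalg[OF MG XkG])
      show "(\<lambda>\<omega>. (Z \<omega>, restrict (\<lambda>i. X i \<omega>) {1..N})) \<in> borel_measurable M"
        by (intro borel_measurable_Pair Z restrict_vector_measurable X)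
      fix \<Phi> :: "'z \<times> (nat \<Rightarrow> 'x) \<Rightarrow> real" assume \<Phi>: "\<Phi> \<in> bl_functions"
      have "(\<lambda>k. (\<integral>\<omega>. \<Phi> (Z \<omega>, restrict (\<lambda>i. Xk k i \<omega>) {1..N}) \<partial>M)
          - (\<integral>\<omega>. \<Phi> (Z \<omega>, restrict (\<lambda>i. X i \<omega>) {1..N}) \<partial>M)) \<longlonglongrightarrow> 0"
        by (rule Lim_null_comparison[OF always_eventually LIMSEQ_inverse_real_of_nat])
          (intro allI, unfold real_norm_def Xk_def, rule f(2)[OF \<Phi>])
      then show "(\<lambda>k. \<integral>\<omega>. \<Phi> (Z \<omega>, restrict (\<lambda>i. Xk k i \<omega>) {1..N}) \<partial>M)
          \<longlonglongrightarrow> (\<integral>\<omega>. \<Phi> (Z \<omega>, restrict (\<lambda>i. X i \<omega>) {1..N}) \<partial>M)"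
        by (rule LIM_zero_cancel)
    qed
    moreover have "cont Xk"
      unfolding cont_def
      by (rule exI[of _ f]) (auto simp: Xk_def intro!: continuous_on_subset[OF f(1)])
    ultimately show ?thesis using XkG unfolding conv_iff adapted_def by blast
  qed
  \<comment> \<open>Dropping \<open>cont\<close> takes (iii) to (ii), so the two implications proved
    close the cycle.\<close>
  ultimately show ?thesis
    unfolding i1_def[symmetric] conv_def[symmetric] adapted_def[symmetric] cont_def[symmetric] by blast
qed

end
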